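(* Let $\widehat u$ be the solution of the regularized problem $\widehat u_t=\widehat u_{xx}+\mathcal W$ in $(0,T]\times D$, $\widehat u(t,\cdot)|_{\partial D}=0$ for $t\in(0,T]$, $\widehat u(0,\cdot)=0$ in $D$ (as given in the context), and let $(U_h^m)_{m=0}^M\subset Z_h^r$ be its Crank-Nicolson fully-discrete approximations defined by $U_h^0:=0$ and, for $m=1,\dots,M$, $$\left(U_h^m-U_h^{m-1},\chi\right)_{L^2(D)}+\tfrac{\Delta\tau}{2}\left(\partial(U_h^m+U_h^{m-1}),\partial\chi\right)_{L^2(D)}=\int_{\Delta_m}(\mathcal W(s,\cdot),\chi)_{L^2(D)}\,ds\qquad\forall\,\chi\in Z_h^r .$$ Then there exists a constant $C>0$, independent of $\Delta x$, $\Delta t$, $h$ and $\Delta\tau$, such that $$\max_{0\le m\le M}\left(\mathbb E\left[\|U_h^m-\widehat u(\tau_m,\cdot)\|_{L^2(D)}^2\right]\right)^{1/2}\le C\left(\epsilon_1^{-\frac12}\,h^{\frac12-\epsilon_1}+\epsilon_2^{-\frac12}\,\Delta\tau^{\frac14-\epsilon_2}\right)$$ for all $\epsilon_1\in\left(0,\tfrac12\right]$ and $\epsilon_2\in\left(0,\tfrac14\right]$.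
   Context: $T>0$ is fixed, $D=(0,1)$, $(\Omega,\mathcal F,P)$ is a complete probability space, $\mathbb E$ denotes expectation, and $\dot W$ is a space-time white noise on $[0,T]\times D$; $W$ denotes the associated Gaussian random measure ($W(S)\sim N(0,|S|)$, with $W(S_1),W(S_2)$ independent when $S_1\cap S_2=\varnothing$). $\partial$ denotes differentiation in space. Regularized problem: for $N_\star,J_\star\in\mathbb N$ let $\Delta t:=T/N_\star$, $\Delta x:=1/J_\star$, $t_n:=n\Delta t$, $x_j:=j\Delta x$, $T_n:=(t_{n-1},t_n)$, $D_j:=(x_{j-1},x_j)$ for $n=1,\dots,N_\star$, $j=1,\dots,J_\star$, and $$\mathcal W:=\frac{1}{\Delta t\,\Delta x}\sum_{n=1}^{N_\star}\sum_{j=1}^{J_\star}W(T_n\times D_j)\,\mathcal X_{T_n\times D_j},$$ where $\mathcal X_A$ is the indicator function of $A$. With $\lambda_k:=k\pi$, $\varepsilon_k(z):=\sqrt2\sin(\lambda_kz)$ and $G_t(x,y):=\sum_{k=1}^\infty e^{-\lambda_k^2t}\varepsilon_k(x)\varepsilon_k(y)$, the solution is $\widehat u(t,x)=\int_0^t\int_D G_{t-s}(x,y)\,\mathcal W(s,y)\,dy\,ds$. Discretization: $M\in\mathbb N$, $\Delta\tau:=T/M$, $\tau_m:=m\Delta\tau$ for $m=0,\dots,M$, $\Delta_m:=(\tau_{m-1},\tau_m)$ for $m=1,\dots,M$. For $r\in\mathbb N$, $Z_h^r\subset H_0^1(D)$ is a finite element space of functions that are piecewise polynomials of degree at most $r$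 over a partition of $D$ into intervals with maximum mesh-length $h$, having the approximation property: there is a constant $C_{\rm FE}>0$ (independent of $h$) with $\inf_{\chi\in Z_h^r}\|g-\chi\|_{H^1(D)}\le C_{\rm FE}\,h\,\|g\|_{H^2(D)}$ for all $g\in H^2(D)\cap H_0^1(D)$. *)

theory Defs
  imports "HOL-Probability.Probability" "HOL-Computational_Algebra.Polynomial"
begin

abbreviation D :: "real set" where "D \<equiv> {0<..<1}"


subsection \<open>Space-time white noise\<close>

text \<open>The library's \<^const>\<open>normal_density\<close> requires a positive standard deviation;
  the variance-zero case (needed for null sets) is the point mass at 0.\<close>

definition centered_normal :: "'w measure \<Rightarrow> ('w \<Rightarrow> real) \<Rightarrow> real \<Rightarrow> bool" where
  "centered_normal P X v \<longleftrightarrow>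
     (if v = 0 then X \<in> borel_measurable P \<and> (AE \<omega> in P. X \<omega> = 0)
      else v > 0 \<and> distributed P lborel X (normal_density 0 (sqrt v)))"

text \<open>Countable additivity (in mean square) follows from finite additivity and the variance
  formula, so only the latter two are required.\<close>

locale white_noise = prob_space P + complete_measure P for P :: "'w measure" +
  fixes T :: real and W :: "(real \<times> real) set \<Rightarrow> 'w \<Rightarrow> real"
  assumes normal:
      "\<And>S. S \<in> sets borel \<Longrightarrow> S \<subseteq> {0..T} \<times> D \<Longrightarrow>
        centered_normal P (W S) (measure lborel S)"
    and indep:
      "\<And>S1 S2. S1 \<in> sets borel \<Longrightarrow> S1 \<subseteq> {0..T} \<times> D \<Longrightarrow>
        S2 \<in> sets borel \<Longrightarrow> S2 \<subseteq> {0..T} \<times> D \<Longrightarrow> S1 \<inter> S2 = {} \<Longrightarrow>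
        indep_var borel (W S1) borel (W S2)"
    and additive:
      "\<And>S1 S2. S1 \<in> sets borel \<Longrightarrow> S1 \<subseteq> {0..T} \<times> D \<Longrightarrow>
        S2 \<in> sets borel \<Longrightarrow> S2 \<subseteq> {0..T} \<times> D \<Longrightarrow> S1 \<inter> S2 = {} \<Longrightarrow>
        AE \<omega> in P. W (S1 \<union> S2) \<omega> = W S1 \<omega> + W S2 \<omega>"
    and jointly_normal:
      "\<And>F c. finite F \<Longrightarrow> (\<And>S. S \<in> F \<Longrightarrow> S \<in> sets borel \<and> S \<subseteq> {0..T} \<times> D) \<Longrightarrow>
        \<exists>v. centered_normal P (\<lambda>\<omega>. \<Sum>S\<in>F. c S * W S \<omega>) v"


subsection \<open>The regularized problem\<close>

definition cell :: "real \<Rightarrow> nat \<Rightarrow> nat \<Rightarrow> nat \<Rightarrow> nat \<Rightarrow> (real \<times> real) set" where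
  "cell T N J n j =
     {(real n - 1) * (T / N) <..< real n * (T / N)} \<times>
     {(real j - 1) * (1 / J) <..< real j * (1 / J)}"

definition regularized_noise ::
    "real \<Rightarrow> ((real \<times> real) set \<Rightarrow> 'w \<Rightarrow> real) \<Rightarrow> nat \<Rightarrow> nat \<Rightarrow> 'w \<Rightarrow> real \<Rightarrow> real \<Rightarrow> real" where
  "regularized_noise T W N J \<omega> s y =
     1 / ((T / N) * (1 / J)) *
       (\<Sum>n=1..N. \<Sum>j=1..J. W (cell T N J n j) \<omega> * indicator (cell T N J n j) (s, y))"

definition eigval :: "nat \<Rightarrow> real" where
  "eigval k = real k * pi"

definition eigfun :: "nat \<Rightarrow> real \<Rightarrow> real" where
  "eigfun k z = sqrt 2 * sin (eigval k * z)"

text \<open>The series starts at index 1, hence the shift.\<close>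

definition heat_kernel :: "real \<Rightarrow> real \<Rightarrow> real \<Rightarrow> real" where
  "heat_kernel t x y =
     (\<Sum>k. exp (- (eigval (Suc k))\<^sup>2 * t) * eigfun (Suc k) x * eigfun (Suc k) y)"

definition regularized_solution ::
    "real \<Rightarrow> ((real \<times> real) set \<Rightarrow> 'w \<Rightarrow> real) \<Rightarrow> nat \<Rightarrow> nat \<Rightarrow> 'w \<Rightarrow> real \<Rightarrow> real \<Rightarrow> real" where
  "regularized_solution T W N J \<omega> t x =
     (LBINT s:{0<..<t}. LBINT y:D. heat_kernel (t - s) x y * regularized_noise T W N J \<omega> s y)"


subsection \<open>Lebesgue and Sobolev spaces on the unit interval\<close>

text \<open>Elements of these spaces are represented by functions on the reals of which only the
  almost everywhere values on the interval matter.\<close>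

definition L2_space :: "(real \<Rightarrow> real) set" where
  "L2_space = {f. set_borel_measurable lborel D f \<and> set_integrable lborel D (\<lambda>x. (f x)\<^sup>2)}"

definition L2_inner :: "(real \<Rightarrow> real) \<Rightarrow> (real \<Rightarrow> real) \<Rightarrow> real" where
  "L2_inner f g = (LBINT x:D. f x * g x)"

definition L2_norm :: "(real \<Rightarrow> real) \<Rightarrow> real" where
  "L2_norm f = sqrt (L2_inner f f)"

text \<open>Weak derivatives on an interval, tested against continuously differentiable functions with
  compact support in it, as in Brezis's textbook.\<close>

definition weak_derivative :: "(real \<Rightarrow> real) \<Rightarrow> (real \<Rightarrow> real) \<Rightarrow> bool" where
  "weak_derivative f g \<longleftrightarrow>
     (\<forall>\<phi> \<phi>'. (\<forall>x. (\<phi> has_real_derivative \<phi>' x) (at x)) \<longrightarrow> continuous_on UNIV \<phi>' \<longrightarrow>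
        closure {x. \<phi> x \<noteq> 0} \<subseteq> D \<longrightarrow> L2_inner f \<phi>' = - L2_inner g \<phi>)"

definition H1_space :: "(real \<Rightarrow> real) set" where
  "H1_space = {f \<in> L2_space. \<exists>g\<in>L2_space. weak_derivative f g}"

text \<open>The weak derivative is unique up to null sets; the choice of a representative is
  immaterial.\<close>

definition wderiv :: "(real \<Rightarrow> real) \<Rightarrow> real \<Rightarrow> real" where
  "wderiv f = (SOME g. g \<in> L2_space \<and> weak_derivative f g)"

definition H2_space :: "(real \<Rightarrow> real) set" where
  "H2_space = {f \<in> H1_space. wderiv f \<in> H1_space}"

text \<open>Zero trace: the continuous representative vanishes at the endpoints.\<close>

definition H01_space :: "(real \<Rightarrow> real) set" where
  "H01_space = {f \<in> H1_space. \<exists>F. continuous_on {0..1} F \<and>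
     (AE x in lborel. x \<in> D \<longrightarrow> F x = f x) \<and> F 0 = 0 \<and> F 1 = 0}"

definition H1_norm :: "(real \<Rightarrow> real) \<Rightarrow> real" where
  "H1_norm f = sqrt ((L2_norm f)\<^sup>2 + (L2_norm (wderiv f))\<^sup>2)"

definition H2_norm :: "(real \<Rightarrow> real) \<Rightarrow> real" where
  "H2_norm f = sqrt ((L2_norm f)\<^sup>2 + (L2_norm (wderiv f))\<^sup>2 + (L2_norm (wderiv (wderiv f)))\<^sup>2)"


subsection \<open>Finite elements and the Crank-Nicolson method\<close>

text \<open>Only a linear subspace of the piecewise polynomials is required, so that additional
  smoothness at the nodes may be built into the space.\<close>

definition fe_space :: "nat \<Rightarrow> real \<Rightarrow> (real \<Rightarrow> real) set \<Rightarrow> bool" where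
  "fe_space r h Z \<longleftrightarrow>
     Z \<subseteq> H01_space \<and>
     (\<lambda>x. 0) \<in> Z \<and> (\<forall>f\<in>Z. \<forall>g\<in>Z. \<forall>a b. (\<lambda>x. a * f x + b * g x) \<in> Z) \<and>
     (\<exists>(K::nat) z. K \<ge> 1 \<and> z 0 = 0 \<and> z K = 1 \<and> (\<forall>i\<in>{1..K}. z (i - 1) < z i) \<and>
        h = (MAX i\<in>{1..K}. z i - z (i - 1)) \<and>
        (\<forall>f\<in>Z. \<forall>i\<in>{1..K}. \<exists>p :: real poly. degree p \<le> r \<and>
           (\<forall>x\<in>{z (i - 1)<..<z i}. f x = poly p x)))"

definition approximation_property :: "real \<Rightarrow> real \<Rightarrow> (real \<Rightarrow> real) set \<Rightarrow> bool" where
  "approximation_property C h Z \<longleftrightarrow>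
     (\<forall>g \<in> H2_space \<inter> H01_space.
        (INF v\<in>Z. H1_norm (\<lambda>x. g x - v x)) \<le> C * h * H2_norm g)"

text \<open>The method for a given source term \<open>f\<close>, i.e. along one realization of the noise.\<close>

definition crank_nicolson ::
    "real \<Rightarrow> nat \<Rightarrow> (real \<Rightarrow> real) set \<Rightarrow> (real \<Rightarrow> real \<Rightarrow> real) \<Rightarrow> (nat \<Rightarrow> real \<Rightarrow> real) \<Rightarrow> bool" where
  "crank_nicolson T M Z f U \<longleftrightarrow>
     (\<forall>m\<in>{0..M}. U m \<in> Z) \<and> (\<forall>x\<in>D. U 0 x = 0) \<and>
     (\<forall>m\<in>{1..M}. \<forall>v\<in>Z.
        L2_inner (\<lambda>x. U m x - U (m - 1) x) v +
        (T / M) / 2 * L2_inner (wderiv (\<lambda>x. U m x + U (m - 1) x)) (wderiv v) =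
        (LBINT s:{real (m - 1) * (T / M) <..< real m * (T / M)}. L2_inner (f s) v))"

end

theory Submission imports Defs begin

text \<open>Fix a time \<open>t = m \<tau>\<close> with \<open>\<tau> = T / M\<close>. The mean square error is at most the sum over \<open>k\<close> of the
second moments of the sine coefficients of the error (\<open>sine_completeness\<close>), and each coefficient is a
linear functional of the noise. For the exact solution this is Duhamel's formula: with
\<open>\<lambda> = (k \<pi>)\<^sup>2\<close>, the coefficient is the integral of \<open>exp (- \<lambda> (t - s))\<close> times the coefficient of the
noise at time \<open>s\<close>. For the scheme, let \<open>Y 0, Y 1, \<dots>\<close> be the solution, in the finite element space,
of the scheme run backwards in time with the \<open>k\<close>-th sine as data; then the coefficient of \<open>U m\<close> is
the sum over \<open>i < m\<close> of the integrals, over the \<open>i\<close>-th time step before \<open>t\<close>, of the inner product of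
the noise with \<open>Y i\<close> (\<open>duality\<close>). Hence the coefficient of the error is the pairing of the noise with the
deterministic defect \<open>Y i - exp (- \<lambda> (t - s)) eigfun k\<close> (\<open>coefficient_error\<close>). The values of the
noise on the cells of the grid are orthogonal and have the cell areas as variances, so replacing
white noise by the regularized noise only projects the defect onto step functions: the second
moment is at most the squared norm \<open>Q k\<close> of the defect in time and space, whatever the grid
(\<open>second_moment_disjoint\<close>, \<open>sum_cell_functionals_le\<close>). This is why no constant depends on it.

It remains to sum the purely deterministic numbers \<open>Q k\<close>. The idea is to write \<open>Y i\<close> as the
difference quotient \<open>- (X (i + 1) - X i) / \<tau>\<close> of a Crank-Nicolson solution \<open>X\<close> that starts at the
Ritz projection of \<open>eigfun k / \<lambda>\<close>, just as the exact dual solution \<open>exp (- \<lambda> t) eigfun k\<close> is minus the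
derivative of \<open>exp (- \<lambda> t) eigfun k / \<lambda>\<close>. Testing the equation of \<open>X\<close> with its increments is an
energy identity for exactly these quotients, free of the weak damping of high frequencies
from which Crank-Nicolson suffers. It gives \<open>Q k \<le> 2 / \<lambda>\<close>
(\<open>defect_total_le_stability\<close>), and, applied to \<open>X i - exp (- \<lambda> i \<tau>) X 0\<close>, it gives
\<open>Q k \<le> 8 \<lambda> (\<eta>\<^sup>2 + \<tau>\<^sup>2)\<close>, where \<open>\<eta>\<close> is the error of the initial Ritz projection
(\<open>defect_total_le_error\<close>). The Aubin-Nitsche argument bounds \<open>\<lambda> \<eta>\<^sup>2\<close> by a multiple of \<open>h\<^sup>2\<close>. Together,
\<open>Q k\<close> is at most a constant times \<open>min (1 / k\<^sup>2) (h\<^sup>2) + min (1 / k\<^sup>2) \<tau>\<close>, and the sum of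
\<open>min (1 / k\<^sup>2) (d\<^sup>2)\<close> over \<open>k\<close> is at most \<open>3 d\<close>: up to \<open>k = 1 / d\<close> use the second argument of the
minimum, beyond it the first. So the mean square error is of order \<open>h + sqrt \<tau>\<close>. Its root is of
order \<open>h powr (1/2) + \<tau> powr (1/4)\<close>, which implies the bound with \<open>\<epsilon>1\<close> and \<open>\<epsilon>2\<close>, as \<open>h \<le> 1\<close>, \<open>\<tau> \<le> T\<close>
and \<open>\<epsilon> powr (-1/2) \<ge> 1\<close>.

The dual scheme is solvable because functions in the finite element space are determined, up to null
sets, by finitely many point values (\<open>fe_space_Riesz\<close>). What is needed about weak derivatives rests
on their uniqueness up to null sets and on one representation: a function with zero trace is the
primitive of its weak derivative, whose mean is zero (\<open>H01_space_primitive\<close>). Integration by parts is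
then Fubini's theorem.\<close>

section \<open>Square-integrable functions\<close>

definition square_integrable :: "'a measure \<Rightarrow> ('a \<Rightarrow> real) \<Rightarrow> bool" where
  "square_integrable M f \<longleftrightarrow> f \<in> borel_measurable M \<and> integrable M (\<lambda>x. (f x)\<^sup>2)"

lemma square_integrable_times:
  assumes "square_integrable M f" "square_integrable M g"
  shows "integrable M (\<lambda>x. f x * g x)"
proof (rule Bochner_Integration.integrable_bound)
  show "integrable M (\<lambda>x. (f x)\<^sup>2 + (g x)\<^sup>2)"
    using assms by (auto simp: square_integrable_def)
  show "(\<lambda>x. f x * g x) \<in> borel_measurable M"
    using assms by (auto simp: square_integrable_def)
  have "\<bar>f x * g x\<bar> \<le> (f x)\<^sup>2 + (g x)\<^sup>2" for x
  proof -
    have "2 * (\<bar>f x\<bar> * \<bar>g x\<bar>) \<le> (f x)\<^sup>2 + (g x)\<^sup>2"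
      using sum_squares_bound[of "\<bar>f x\<bar>" "\<bar>g x\<bar>"] by simp
    moreover have "0 \<le> \<bar>f x\<bar> * \<bar>g x\<bar>" by simp
    ultimately show ?thesis unfolding abs_mult by linarith
  qed
  then show "AE x in M. norm (f x * g x) \<le> norm ((f x)\<^sup>2 + (g x)\<^sup>2)"
    by (auto intro!: AE_I2 order_trans[OF _ abs_ge_self])
qed

lemma square_integrable_lincomb:
  assumes f: "square_integrable M f" and g: "square_integrable M g"
  shows "square_integrable M (\<lambda>x. a * f x + b * g x)"
proof -
  have "(\<lambda>x. (a * f x + b * g x)\<^sup>2) =
    (\<lambda>x. a\<^sup>2 * (f x)\<^sup>2 + b\<^sup>2 * (g x)\<^sup>2 + 2 * a * b * (f x * g x))"
    by (auto simp: power2_eq_square algebra_simps)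
  then show ?thesis
    using f g square_integrable_times[OF f g] by (auto simp: square_integrable_def)
qed

text \<open>The quadratic form \<open>\<integral> (s f + t g)\<^sup>2\<close> is nonnegative; the vertex of the parabola in \<open>s\<close> gives the
inequality. A vanishing leading coefficient needs a separate argument.\<close>

lemma Cauchy_Schwarz_integral:
  assumes f: "square_integrable M f" and g: "square_integrable M g"
  shows "(\<integral>x. f x * g x \<partial>M)\<^sup>2 \<le> (\<integral>x. (f x)\<^sup>2 \<partial>M) * (\<integral>x. (g x)\<^sup>2 \<partial>M)"
proof -
  let ?A = "\<integral>x. (f x)\<^sup>2 \<partial>M" and ?B = "\<integral>x. f x * g x \<partial>M" and ?C = "\<integral>x. (g x)\<^sup>2 \<partial>M"
  have quad: "0 \<le> s\<^sup>2 * ?A + 2 * s * t * ?B + t\<^sup>2 * ?C" for s t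
  proof -
    have "0 \<le> (\<integral>x. (s * f x + t * g x)\<^sup>2 \<partial>M)" by simp
    also have "\<dots> = (\<integral>x. s\<^sup>2 * (f x)\<^sup>2 + 2 * s * t * (f x * g x) + t\<^sup>2 * (g x)\<^sup>2 \<partial>M)"
      by (intro Bochner_Integration.integral_cong) (auto simp: power2_eq_square algebra_simps)
    also have "\<dots> = s\<^sup>2 * ?A + 2 * s * t * ?B + t\<^sup>2 * ?C"
      using f g square_integrable_times[OF f g] by (simp add: square_integrable_def)
    finally show ?thesis .
  qed
  have A0: "0 \<le> ?A" and C0: "0 \<le> ?C" by simp_all
  show ?thesis
  proof (cases "?A = 0")
    case True
    have "?B = 0"
    proof (rule ccontr)
      assume "?B \<noteq> 0"
      moreover have "0 \<le> 2 * (- (?C + 1) / (2 * ?B)) * ?B + ?C"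
        using quad[of "- (?C + 1) / (2 * ?B)" 1] True by simp
      ultimately show False by (simp add: field_simps)
    qed
    then show ?thesis using True by simp
  next
    case False
    have "0 \<le> ?B\<^sup>2 * ?A + 2 * (- ?B) * ?A * ?B + ?A\<^sup>2 * ?C"
      using quad[of "- ?B" ?A] by simp
    then have "0 \<le> ?A * (?A * ?C - ?B\<^sup>2)" by (simp add: power2_eq_square algebra_simps)
    then show ?thesis using False A0 by (simp add: zero_le_mult_iff)
  qed
qed

lemma square_integrable_bounded:
  assumes "finite_measure M" "f \<in> borel_measurable M" "\<And>x. x \<in> space M \<Longrightarrow> \<bar>f x\<bar> \<le> B"
  shows "square_integrable M f"
proof -
  have "(f x)\<^sup>2 \<le> B\<^sup>2" if "x \<in> space M" for x
    using assms(3)[OF that] by (simp add: abs_le_square_iff[symmetric])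
  then show ?thesis unfolding square_integrable_def
    using assms by (auto intro!: finite_measure.integrable_const_bound[where B="B\<^sup>2"])
qed

subsection \<open>The unit interval\<close>

text \<open>Working with a probability measure on \<open>D\<close>, instead of Lebesgue integrals over the set \<open>D\<close>, makes the
lemmas on square-integrable functions and on product measures directly applicable.\<close>

definition unit_measure :: "real measure" ("\<mu>") where
  "\<mu> = restrict_space lborel D"

lemma space_unit: "space \<mu> = D" by (simp add: unit_measure_def space_restrict_space)

lemma sets_unit: "sets \<mu> = sets (restrict_space borel D)"
  by (simp add: unit_measure_def sets_restrict_space)

lemma prob_space_unit: "prob_space \<mu>"
  by (auto intro!: prob_spaceI simp: unit_measure_def space_restrict_space emeasure_restrict_space)

interpretation unit: prob_space \<mu> by (rule prob_space_unit)

interpretation unit_pair: pair_prob_space \<mu> \<mu> ..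

lemma borel_measurable_unit:
  "f \<in> borel_measurable borel \<Longrightarrow> f \<in> borel_measurable \<mu>"
  unfolding unit_measure_def by (intro measurable_restrict_space1) simp

lemma measurable_ident_unit [measurable]: "(\<lambda>x. x) \<in> \<mu> \<rightarrow>\<^sub>M borel"
  by (intro borel_measurable_unit) simp

lemma measurable_pair_unit [measurable]:
  "fst \<in> \<mu> \<Otimes>\<^sub>M M \<rightarrow>\<^sub>M borel" "snd \<in> M \<Otimes>\<^sub>M \<mu> \<rightarrow>\<^sub>M borel"
  using measurable_compose[OF measurable_fst measurable_ident_unit]
    measurable_compose[OF measurable_snd measurable_ident_unit] by auto

lemma set_integral_unit: "(LBINT x:D. f x) = (\<integral>x. f x \<partial>\<mu>)" for f :: "real \<Rightarrow> real"
  unfolding unit_measure_def set_lebesgue_integral_def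
  by (subst integral_restrict_space) auto

lemma set_integrable_unit: "set_integrable lborel D f \<longleftrightarrow> integrable \<mu> f" for f :: "real \<Rightarrow> real"
  unfolding unit_measure_def set_integrable_def
  by (subst integrable_restrict_space) auto

lemma set_borel_measurable_unit:
  "set_borel_measurable lborel D f \<longleftrightarrow> f \<in> borel_measurable \<mu>" for f :: "real \<Rightarrow> real"
  unfolding unit_measure_def set_borel_measurable_def
  by (subst borel_measurable_restrict_space_iff) (auto simp: mult.commute)

lemma AE_unit: "(AE x in \<mu>. Q x) \<longleftrightarrow> (AE x in lborel. x \<in> D \<longrightarrow> Q x)"
  unfolding unit_measure_def by (subst AE_restrict_space_iff) auto

lemma L2_space_iff: "f \<in> L2_space \<longleftrightarrow> square_integrable \<mu> f"
  by (simp add: L2_space_def square_integrable_def set_integrable_unit set_borel_measurable_unit)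

lemma L2_inner_eq: "L2_inner f g = (\<integral>x. f x * g x \<partial>\<mu>)"
  by (simp add: L2_inner_def set_integral_unit)

lemma L2_inner_commute: "L2_inner f g = L2_inner g f"
  by (simp add: L2_inner_def mult.commute)

lemma L2_inner_self_nonneg [simp]: "0 \<le> L2_inner f f"
  by (simp add: L2_inner_eq)

lemma L2_norm_square: "(L2_norm f)\<^sup>2 = L2_inner f f"
  by (simp add: L2_norm_def)

lemma L2_norm_nonneg [simp]: "0 \<le> L2_norm f"
  by (simp add: L2_norm_def)

lemma L2_space_lincomb:
  "f \<in> L2_space \<Longrightarrow> g \<in> L2_space \<Longrightarrow> (\<lambda>x. a * f x + b * g x) \<in> L2_space"
  by (simp add: L2_space_iff square_integrable_lincomb)

lemma L2_inner_lincomb: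
  assumes "f \<in> L2_space" "g \<in> L2_space" "v \<in> L2_space"
  shows "L2_inner (\<lambda>x. a * f x + b * g x) v = a * L2_inner f v + b * L2_inner g v"
proof -
  have "(\<lambda>x. (a * f x + b * g x) * v x) = (\<lambda>x. a * (f x * v x) + b * (g x * v x))"
    by (auto simp: algebra_simps)
  then show ?thesis
    using assms square_integrable_times[of \<mu> _ v] by (simp add: L2_inner_eq L2_space_iff)
qed

lemma L2_inner_Cauchy_Schwarz:
  assumes "f \<in> L2_space" "g \<in> L2_space"
  shows "\<bar>L2_inner f g\<bar> \<le> L2_norm f * L2_norm g"
proof (rule power2_le_imp_le)
  show "\<bar>L2_inner f g\<bar>\<^sup>2 \<le> (L2_norm f * L2_norm g)\<^sup>2"
    using Cauchy_Schwarz_integral[of \<mu> f g] assms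
    unfolding power_mult_distrib L2_norm_square L2_inner_eq L2_space_iff
    by (simp add: power2_eq_square)
qed simp

lemma L2_inner_cong_AE:
  assumes "AE x in \<mu>. f x = f' x" "AE x in \<mu>. g x = g' x"
    and "f \<in> L2_space" "f' \<in> L2_space" "g \<in> L2_space" "g' \<in> L2_space"
  shows "L2_inner f g = L2_inner f' g'"
  unfolding L2_inner_eq
proof (rule integral_cong_AE)
  show "AE x in \<mu>. f x * g x = f' x * g' x" using assms(1,2) by eventually_elim simp
qed (use assms in \<open>auto simp: L2_space_iff square_integrable_def\<close>)

lemma L2_space_bounded:
  assumes "f \<in> borel_measurable \<mu>" "\<And>x. x \<in> D \<Longrightarrow> \<bar>f x\<bar> \<le> B"
  shows "f \<in> L2_space"
  unfolding L2_space_iff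
  using assms by (intro square_integrable_bounded[where B=B]) (auto simp: space_unit unit.finite_measure_axioms)

lemma L2_space_continuous:
  assumes "continuous_on {0..1} F" shows "F \<in> L2_space"
proof -
  obtain B where "\<And>x. x \<in> {0..1} \<Longrightarrow> \<bar>F x\<bar> \<le> B"
    using continuous_on_compact_bound[OF _ assms] by (metis compact_Icc real_norm_def)
  moreover have "F \<in> borel_measurable \<mu>"
  proof -
    have "continuous_on D F" by (rule continuous_on_subset[OF assms]) auto
    then have "F \<in> borel_measurable (restrict_space borel D)"
      by (rule borel_measurable_continuous_on_restrict)
    then show ?thesis by (simp add: unit_measure_def cong: measurable_cong_sets)
  qed
  ultimately show ?thesis by (intro L2_space_bounded[where B=B]) auto
qed

lemma L2_space_integrable: "f \<in> L2_space \<Longrightarrow> integrable \<mu> f"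
  using square_integrable_times[of \<mu> f "\<lambda>_. 1"]
  by (simp add: L2_space_iff square_integrable_def)

section \<open>Weak derivatives on the unit interval\<close>

text \<open>A continuously differentiable transition from 0 to 1 over the unit interval, built from squared
positive parts so that differentiability at the knots is inherited from a single function.\<close>

definition smooth_step :: "real \<Rightarrow> real" where
  "smooth_step y = 2 * ((max 0 y)\<^sup>2 - 2 * (max 0 (y - 1/2))\<^sup>2 + (max 0 (y - 1))\<^sup>2)"

text \<open>The derivative of the smooth step: an approximate identity after rescaling.\<close>

definition tent :: "real \<Rightarrow> real" where
  "tent y = 4 * (max 0 y - 2 * max 0 (y - 1/2) + max 0 (y - 1))"

lemma square_pos_part_derivative:
  "((\<lambda>y::real. (max 0 y)\<^sup>2) has_real_derivative 2 * max 0 y) (at y)"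
proof -
  consider "y < 0" | "y = 0" | "y > 0" by linarith
  then show ?thesis
  proof cases
    case 1
    have "((\<lambda>y::real. 0) has_real_derivative 2 * max 0 y) (at y)" using 1 by simp
    then show ?thesis
      by (rule has_field_derivative_transform_within_open[where S="{..<0}"]) (use 1 in auto)
  next
    case 2
    have "\<bar>(max 0 h)\<^sup>2 / h\<bar> \<le> \<bar>h\<bar>" for h :: real
      by (cases "h > 0") (auto simp: max_def power2_eq_square)
    then have "((\<lambda>h::real. (max 0 h)\<^sup>2 / h) \<longlongrightarrow> 0) (at 0)"
      by (intro tendsto_0_le[OF tendsto_ident_at[of 0 UNIV], where K=1] always_eventually allI) simp
    then show ?thesis using 2 by (simp add: DERIV_def)
  next
    case 3
    have "((\<lambda>y::real. y\<^sup>2) has_real_derivative 2 * max 0 y) (at y)"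
      using 3 by (auto intro!: derivative_eq_intros)
    then show ?thesis
      by (rule has_field_derivative_transform_within_open[where S="{0<..}"]) (use 3 in auto)
  qed
qed

lemma smooth_step_derivative:
  "(smooth_step has_real_derivative tent y) (at y)"
proof -
  have shifted: "((\<lambda>y. (max 0 (y - c))\<^sup>2) has_real_derivative 2 * max 0 (y - c)) (at y)" for c :: real
    using DERIV_chain2[OF square_pos_part_derivative DERIV_diff[OF DERIV_ident DERIV_const], of c y]
    by simp
  have "((\<lambda>y. 2 * ((max 0 y)\<^sup>2 - 2 * (max 0 (y - 1/2))\<^sup>2 + (max 0 (y - 1))\<^sup>2)) has_real_derivative
      2 * (2 * max 0 y - 2 * (2 * max 0 (y - 1/2)) + 2 * max 0 (y - 1))) (at y)"
    by (intro DERIV_cmult DERIV_add DERIV_diff square_pos_part_derivative shifted)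
  moreover have "2 * (2 * max 0 y - 2 * (2 * max 0 (y - 1/2)) + 2 * max 0 (y - 1)) = tent y"
    unfolding tent_def by algebra
  ultimately show ?thesis unfolding smooth_step_def[abs_def] by (simp only:)
qed

lemma continuous_tent: "continuous_on A tent"
  unfolding tent_def[abs_def]
  by (intro continuous_on_mult continuous_on_add continuous_on_diff continuous_on_max
      continuous_on_const continuous_on_id)

lemma smooth_step_values [simp]:
  "y \<le> 0 \<Longrightarrow> smooth_step y = 0" "y \<ge> 1 \<Longrightarrow> smooth_step y = 1"
proof -
  show "smooth_step y = 0" if "y \<le> 0"
    using that by (simp add: smooth_step_def max_absorb1)
  show "smooth_step y = 1" if "y \<ge> 1"
  proof -
    have "smooth_step y = 2 * (y\<^sup>2 - 2 * (y - 1/2)\<^sup>2 + (y - 1)\<^sup>2)"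
      using that by (simp add: smooth_step_def max_absorb2)
    then show ?thesis by (simp add: power2_eq_square algebra_simps)
  qed
qed

lemma tent_eq_0 [simp]: "y \<le> 0 \<or> y \<ge> 1 \<Longrightarrow> tent y = 0"
  by (auto simp: tent_def max_absorb1 max_absorb2)

lemma tent_nonneg: "0 \<le> tent y" by (auto simp: tent_def max_def)

lemma smooth_step_range: "0 \<le> smooth_step y" "smooth_step y \<le> 1"
proof -
  have "mono smooth_step"
  proof (rule monoI)
    fix x y :: real assume "x \<le> y"
    then show "smooth_step x \<le> smooth_step y"
    proof (rule DERIV_nonneg_imp_nondecreasing)
      fix u show "\<exists>v. (smooth_step has_real_derivative v) (at u) \<and> 0 \<le> v"
          using smooth_step_derivative[of u] tent_nonneg[of u] by blast
    qed
  qed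
  then show "0 \<le> smooth_step y" "smooth_step y \<le> 1"
    using monoD[of smooth_step "min 0 y" y] monoD[of smooth_step y "max 1 y"] by auto
qed

text \<open>A test function supported in \<open>[a, b]\<close> that equals 1 between \<open>a + d\<close> and \<open>b - d\<close>, for \<open>0 < d\<close>
and \<open>2 * d \<le> b - a\<close>.\<close>

definition bump :: "real \<Rightarrow> real \<Rightarrow> real \<Rightarrow> real \<Rightarrow> real" where
  "bump a b d x = smooth_step ((x - a) / d) - smooth_step ((x - (b - d)) / d)"

definition bump_deriv :: "real \<Rightarrow> real \<Rightarrow> real \<Rightarrow> real \<Rightarrow> real" where
  "bump_deriv a b d x = tent ((x - a) / d) / d - tent ((x - (b - d)) / d) / d"

lemma bump_derivative:
  "(bump a b d has_real_derivative bump_deriv a b d x) (at x)"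
proof -
  have "((\<lambda>x. smooth_step ((x - c) / d)) has_real_derivative tent ((x - c) / d) * ((1 - 0) / d)) (at x)" for c
    by (intro DERIV_chain2[OF smooth_step_derivative] DERIV_cdivide DERIV_diff DERIV_ident DERIV_const)
  then have "((\<lambda>x. smooth_step ((x - a) / d) - smooth_step ((x - (b - d)) / d)) has_real_derivative
      tent ((x - a) / d) * ((1 - 0) / d) - tent ((x - (b - d)) / d) * ((1 - 0) / d)) (at x)"
    by (intro DERIV_diff)
  then show ?thesis by (simp add: bump_def[abs_def] bump_deriv_def)
qed

lemma bump_test_function:
  assumes "0 < a" "b < 1" "0 < d" "2 * d \<le> b - a"
  shows "\<forall>x. (bump a b d has_real_derivative bump_deriv a b d x) (at x)"
    and "continuous_on UNIV (bump_deriv a b d)"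
    and "closure {x. bump a b d x \<noteq> 0} \<subseteq> D"
proof -
  show "\<forall>x. (bump a b d has_real_derivative bump_deriv a b d x) (at x)"
    by (intro allI bump_derivative)
  show "continuous_on UNIV (bump_deriv a b d)"
    unfolding bump_deriv_def[abs_def]
    by (intro continuous_intros continuous_on_compose2[OF continuous_tent[of UNIV]]) (use assms in auto)
  have "bump a b d x = 0" if "x \<notin> {a..b}" for x
  proof (cases "x < a")
    case True
    then show ?thesis using assms by (simp add: bump_def divide_nonpos_pos)
  next
    case False
    with that have "x > b" by auto
    then show ?thesis using assms by (simp add: bump_def le_divide_eq)
  qed
  then have "{x. bump a b d x \<noteq> 0} \<subseteq> {a..b}" by blast
  then have "closure {x. bump a b d x \<noteq> 0} \<subseteq> {a..b}" by (intro closure_minimal) auto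
  then show "closure {x. bump a b d x \<noteq> 0} \<subseteq> D" using assms by force
qed

text \<open>Widths of the transition layers of the bumps; they tend to 0 and leave room for two layers
in \<open>[a, b]\<close>.\<close>

definition mesh_seq :: "real \<Rightarrow> real \<Rightarrow> nat \<Rightarrow> real" where
  "mesh_seq a b n = (b - a) / (2 * real (Suc n))"

lemma mesh_seq:
  assumes "a < b"
  shows "0 < mesh_seq a b n" "2 * mesh_seq a b n \<le> b - a" "mesh_seq a b \<longlonglongrightarrow> 0"
proof -
  show "0 < mesh_seq a b n" using assms by (simp add: mesh_seq_def)
  have "(b - a) * 1 \<le> (b - a) * real (Suc n)"
    using assms by (intro mult_left_mono) auto
  then show "2 * mesh_seq a b n \<le> b - a" by (simp add: mesh_seq_def field_simps)
  have "(\<lambda>n. (b - a) / 2 * inverse (real (Suc n))) \<longlonglongrightarrow> (b - a) / 2 * 0"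
    by (intro tendsto_intros LIMSEQ_inverse_real_of_nat)
  then show "mesh_seq a b \<longlonglongrightarrow> 0" by (simp add: mesh_seq_def[abs_def] field_simps)
qed

lemma bump_tendsto_indicator:
  assumes "a < b"
  shows "(\<lambda>n. bump a b (mesh_seq a b n) x) \<longlonglongrightarrow> indicator {a<..<b} x"
proof (rule tendsto_eventually)
  note m = mesh_seq[OF assms]
  consider "x \<le> a" | "x \<ge> b" | "a < x" "x < b" by linarith
  then show "\<forall>\<^sub>F n in sequentially. bump a b (mesh_seq a b n) x = indicator {a<..<b} x"
  proof cases
    case 1
    have "bump a b (mesh_seq a b n) x = 0" for n
      using 1 m(1,2)[of n] by (simp add: bump_def divide_nonpos_pos)
    then show ?thesis using 1 by simp
  next
    case 2
    have "bump a b (mesh_seq a b n) x = 0" for n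
      using 2 m(1,2)[of n] by (simp add: bump_def le_divide_eq)
    then show ?thesis using 2 by simp
  next
    case 3
    have "\<forall>\<^sub>F n in sequentially. mesh_seq a b n < min (x - a) (b - x)"
      using 3 by (intro order_tendstoD[OF m(3)]) auto
    then show ?thesis
    proof eventually_elim
      case (elim n)
      then show ?case using 3 m(1,2)[of n]
        by (simp add: bump_def le_divide_eq divide_nonpos_pos)
    qed
  qed
qed

lemma bump_measurable [measurable]: "bump a b d \<in> borel_measurable borel"
  by (intro borel_measurable_continuous_onI continuous_at_imp_continuous_on ballI
      DERIV_isCont[OF bump_derivative])

lemma bump_bounded: "\<bar>bump a b d x\<bar> \<le> 1"
  using smooth_step_range[of "(x - a) / d"] smooth_step_range[of "(x - (b - d)) / d"]
  unfolding bump_def by linarith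

text \<open>Bumps approximate indicators of intervals, so testing against smooth functions controls integrals
over intervals.\<close>

lemma integral_bump_tendsto:
  assumes "g \<in> L2_space" "a < b"
  shows "(\<lambda>n. L2_inner g (bump a b (mesh_seq a b n))) \<longlonglongrightarrow> L2_inner g (indicator {a<..<b})"
  unfolding L2_inner_eq
proof (rule integral_dominated_convergence)
  have [measurable]: "g \<in> borel_measurable \<mu>" using assms by (simp add: L2_space_iff square_integrable_def)
  show "(\<lambda>x. g x * indicator {a<..<b} x) \<in> borel_measurable \<mu>" by measurable
  show "(\<lambda>x. g x * bump a b (mesh_seq a b n) x) \<in> borel_measurable \<mu>" for n by measurable
  show "integrable \<mu> (\<lambda>x. \<bar>g x\<bar>)" using L2_space_integrable[OF assms(1)] by simp
  show "AE x in \<mu>. (\<lambda>n. g x * bump a b (mesh_seq a b n) x) \<longlonglongrightarrow> g x * indicator {a<..<b} x"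
    by (intro AE_I2 tendsto_intros bump_tendsto_indicator assms)
  show "AE x in \<mu>. norm (g x * bump a b (mesh_seq a b n) x) \<le> \<bar>g x\<bar>" for n
    by (intro AE_I2) (simp add: abs_mult mult_left_le bump_bounded)
qed

lemma AE_neq_unit: "AE x in \<mu>. x \<noteq> a"
  unfolding AE_unit using AE_lborel_singleton[of a] by eventually_elim simp

lemma interval_integral_tendsto:
  fixes g :: "real \<Rightarrow> real"
  assumes g: "integrable \<mu> g" and a: "a' \<longlonglongrightarrow> a" and b: "b' \<longlonglongrightarrow> b"
  shows "(\<lambda>n. \<integral>x. g x * indicator {a' n<..<b' n} x \<partial>\<mu>) \<longlonglongrightarrow> (\<integral>x. g x * indicator {a<..<b} x \<partial>\<mu>)"
proof (rule integral_dominated_convergence)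
  have [measurable]: "g \<in> borel_measurable \<mu>" using g by auto
  show "(\<lambda>x. g x * indicator {a<..<b} x) \<in> borel_measurable \<mu>"
    "(\<lambda>x. g x * indicator {a' n<..<b' n} x) \<in> borel_measurable \<mu>" for n by measurable
  show "integrable \<mu> (\<lambda>x. \<bar>g x\<bar>)" using g by simp
  show "AE x in \<mu>. (\<lambda>n. g x * indicator {a' n<..<b' n} x) \<longlonglongrightarrow> g x * indicator {a<..<b} x"
    using AE_neq_unit[of a] AE_neq_unit[of b]
  proof eventually_elim
    case (elim x)
    consider "x < a" | "b < x" | "a < x" "x < b" using elim by linarith
    then have "\<forall>\<^sub>F n in sequentially. (indicator {a' n<..<b' n} x :: real) = indicator {a<..<b} x"
    proof cases
      case 1
      show ?thesis using order_tendstoD(1)[OF a 1] by eventually_elim (use 1 in auto)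
    next
      case 2
      show ?thesis using order_tendstoD(2)[OF b 2] by eventually_elim (use 2 in auto)
    next
      case 3
      from order_tendstoD(2)[OF a 3(1)] order_tendstoD(1)[OF b 3(2)]
      show ?thesis by eventually_elim (use 3 in auto)
    qed
    then show ?case by (intro tendsto_intros tendsto_eventually)
  qed
  show "AE x in \<mu>. norm (g x * indicator {a' n<..<b' n} x) \<le> \<bar>g x\<bar>" for n
    by (auto simp: indicator_def)
qed

text \<open>The positive and the negative part of \<open>g\<close> are densities of two finite measures that agree on all
half-lines, hence are equal; the densities then agree almost everywhere.\<close>

lemma AE_zero_if_interval_integrals_zero:
  fixes g :: "real \<Rightarrow> real"
  assumes g: "integrable \<mu> g"
    and 0: "\<And>a b. 0 < a \<Longrightarrow> a < b \<Longrightarrow> b < 1 \<Longrightarrow> (\<integral>x. g x * indicator {a<..<b} x \<partial>\<mu>) = 0"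
  shows "AE x in \<mu>. g x = 0"
proof -
  have [measurable]: "g \<in> borel_measurable \<mu>" using g by auto
  have all: "(\<integral>x. g x * indicator {a<..<b} x \<partial>\<mu>) = 0" for a b
  proof -
    define e :: "nat \<Rightarrow> real" where "e n = inverse (real (Suc n))" for n
    have e: "e \<longlonglongrightarrow> 0" "e n > 0" for n
      unfolding e_def[abs_def] by (rule LIMSEQ_inverse_real_of_nat) simp
    have "(\<lambda>n. \<integral>x. g x * indicator {max a (e n)<..<min b (1 - e n)} x \<partial>\<mu>)
        \<longlonglongrightarrow> (\<integral>x. g x * indicator {max a 0<..<min b (1 - 0)} x \<partial>\<mu>)"
      by (intro interval_integral_tendsto g tendsto_intros e)
    moreover have "(\<integral>x. g x * indicator {max a (e n)<..<min b (1 - e n)} x \<partial>\<mu>) = 0" for n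
    proof (cases "max a (e n) < min b (1 - e n)")
      case True
      then show ?thesis using e(2)[of n] by (intro 0) auto
    next
      case False
      then have "{max a (e n)<..<min b (1 - e n)} = {}"
        by (intro greaterThanLessThan_empty) (simp only: not_less)
      then show ?thesis by (simp only:) simp
    qed
    moreover have "(\<integral>x. g x * indicator {max a 0<..<min b (1 - 0)} x \<partial>\<mu>) = (\<integral>x. g x * indicator {a<..<b} x \<partial>\<mu>)"
      by (intro Bochner_Integration.integral_cong) (auto simp: space_unit indicator_def)
    ultimately show ?thesis by (simp add: LIMSEQ_const_iff)
  qed
  define G where "G x = indicator D x * g x" for x
  have G: "integrable lborel G"
    using g unfolding G_def by (simp add: set_integrable_unit[symmetric] set_integrable_def)
  then have [measurable]: "G \<in> borel_measurable borel" by auto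
  have G_int: "(\<integral>x. G x * indicator {a<..} x \<partial>lborel) = 0" for a
  proof -
    have "(\<integral>x. G x * indicator {a<..} x \<partial>lborel) = (LBINT x:D. g x * indicator {a<..<max 1 (a + 1)} x)"
      unfolding set_lebesgue_integral_def
      by (intro Bochner_Integration.integral_cong) (auto simp: G_def indicator_def)
    then show ?thesis using all[of a "max 1 (a + 1)"] by (simp add: set_integral_unit)
  qed
  have pos: "emeasure (density lborel (\<lambda>x. ennreal (max 0 (s * G x)))) {a<..} =
      ennreal (\<integral>x. max 0 (s * G x) * indicator {a<..} x \<partial>lborel)" for s a
  proof -
    have "emeasure (density lborel (\<lambda>x. ennreal (max 0 (s * G x)))) {a<..} =
        (\<integral>\<^sup>+x. ennreal (max 0 (s * G x) * indicator {a<..} x) \<partial>lborel)"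
      by (subst emeasure_density) (auto intro!: nn_integral_cong simp: indicator_def)
    also have "\<dots> = ennreal (\<integral>x. max 0 (s * G x) * indicator {a<..} x \<partial>lborel)"
      using G by (intro nn_integral_eq_integral integrable_real_mult_indicator AE_I2) auto
    finally show ?thesis .
  qed
  have "density lborel (\<lambda>x. ennreal (max 0 (1 * G x))) = density lborel (\<lambda>x. ennreal (max 0 (- 1 * G x)))"
  proof (rule measure_eqI_lessThan)
    fix a
    have i: "integrable lborel (\<lambda>x. max 0 (s * G x) * indicator {a<..} x)" for s
      using G by (intro integrable_real_mult_indicator) auto
    have "(\<integral>x. max 0 (1 * G x) * indicator {a<..} x \<partial>lborel) - (\<integral>x. max 0 (- 1 * G x) * indicator {a<..} x \<partial>lborel)
      = (\<integral>x. max 0 (1 * G x) * indicator {a<..} x - max 0 (- 1 * G x) * indicator {a<..} x \<partial>lborel)"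
      using i by (intro Bochner_Integration.integral_diff[symmetric])
    also have "\<dots> = (\<integral>x. G x * indicator {a<..} x \<partial>lborel)"
      by (intro Bochner_Integration.integral_cong) (auto simp: indicator_def max_def)
    finally show "emeasure (density lborel (\<lambda>x. ennreal (max 0 (1 * G x)))) {a<..} =
        emeasure (density lborel (\<lambda>x. ennreal (max 0 (- 1 * G x)))) {a<..}"
      unfolding pos using G_int by simp
  qed (auto simp only: pos, auto)
  then have "AE x in lborel. ennreal (max 0 (1 * G x)) = ennreal (max 0 (- 1 * G x))"
    by (intro sigma_finite_measure.density_unique[OF sigma_finite_lborel]) auto
  then have "AE x in lborel. G x = 0"
    by eventually_elim (auto simp: max_def split: if_splits)
  then show ?thesis unfolding AE_unit by eventually_elim (auto simp: G_def indicator_def)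
qed


text \<open>The fundamental lemma of the calculus of variations. It makes weak derivatives unique up to null
sets, so that the choice of a representative in \<open>wderiv\<close> is harmless.\<close>

lemma AE_zero_if_orthogonal_to_test_functions:
  assumes g: "g \<in> L2_space"
    and 0: "\<And>\<phi> \<phi>'. (\<forall>x. (\<phi> has_real_derivative \<phi>' x) (at x)) \<Longrightarrow> continuous_on UNIV \<phi>' \<Longrightarrow>
        closure {x. \<phi> x \<noteq> 0} \<subseteq> D \<Longrightarrow> L2_inner g \<phi> = 0"
  shows "AE x in \<mu>. g x = 0"
proof (rule AE_zero_if_interval_integrals_zero[OF L2_space_integrable[OF g]])
  fix a b :: real assume ab: "0 < a" "a < b" "b < 1"
  have "L2_inner g (bump a b (mesh_seq a b n)) = 0" for n
    using ab mesh_seq(1,2)[OF ab(2), where n=n]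
    by (intro 0[of _ "bump_deriv a b (mesh_seq a b n)"] bump_test_function) auto
  with integral_bump_tendsto[OF g ab(2)] show "(\<integral>x. g x * indicator {a<..<b} x \<partial>\<mu>) = 0"
    by (simp add: LIMSEQ_const_iff L2_inner_eq)
qed

lemma test_function_L2:
  assumes "\<forall>x. (\<phi> has_real_derivative \<phi>' x) (at x)" "continuous_on UNIV \<phi>'"
  shows "\<phi> \<in> L2_space" "\<phi>' \<in> L2_space"
proof -
  show "\<phi> \<in> L2_space"
    using assms by (intro L2_space_continuous continuous_at_imp_continuous_on) (auto intro: DERIV_isCont)
  show "\<phi>' \<in> L2_space"
    using assms by (intro L2_space_continuous) (auto intro: continuous_on_subset)
qed

lemma weak_derivative_unique:
  assumes "weak_derivative f g" "weak_derivative f g'" "g \<in> L2_space" "g' \<in> L2_space"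
  shows "AE x in \<mu>. g x = g' x"
proof -
  have "AE x in \<mu>. 1 * g x + (-1) * g' x = 0"
  proof (rule AE_zero_if_orthogonal_to_test_functions)
    show "(\<lambda>x. 1 * g x + (-1) * g' x) \<in> L2_space" by (intro L2_space_lincomb assms)
    fix \<phi> \<phi>' :: "real \<Rightarrow> real"
    assume *: "\<forall>x. (\<phi> has_real_derivative \<phi>' x) (at x)" "continuous_on UNIV \<phi>'"
      "closure {x. \<phi> x \<noteq> 0} \<subseteq> D"
    then have "L2_inner g \<phi> = L2_inner g' \<phi>"
      using assms(1,2) unfolding weak_derivative_def by (metis add.inverse_inverse)
    then show "L2_inner (\<lambda>x. 1 * g x + (-1) * g' x) \<phi> = 0"
      using test_function_L2[OF *(1,2)] assms by (subst L2_inner_lincomb) auto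
  qed
  then show ?thesis by simp
qed

lemma weak_derivative_cong_AE:
  assumes "weak_derivative f g" "AE x in \<mu>. f x = f' x" "AE x in \<mu>. g x = g' x"
    and "f \<in> L2_space" "f' \<in> L2_space" "g \<in> L2_space" "g' \<in> L2_space"
  shows "weak_derivative f' g'"
  unfolding weak_derivative_def
proof (intro allI impI)
  fix \<phi> \<phi>' :: "real \<Rightarrow> real"
  assume *: "\<forall>x. (\<phi> has_real_derivative \<phi>' x) (at x)" "continuous_on UNIV \<phi>'"
    "closure {x. \<phi> x \<noteq> 0} \<subseteq> D"
  note l2 = test_function_L2[OF *(1,2)]
  have "L2_inner f' \<phi>' = L2_inner f \<phi>'" "L2_inner g' \<phi> = L2_inner g \<phi>"
    using assms l2 by (intro L2_inner_cong_AE; auto simp: eq_commute)+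
  then show "L2_inner f' \<phi>' = - L2_inner g' \<phi>"
    using assms(1) * unfolding weak_derivative_def by metis
qed

lemma weak_derivative_lincomb:
  assumes "weak_derivative f f'" "weak_derivative g g'"
    and "f \<in> L2_space" "f' \<in> L2_space" "g \<in> L2_space" "g' \<in> L2_space"
  shows "weak_derivative (\<lambda>x. a * f x + b * g x) (\<lambda>x. a * f' x + b * g' x)"
  unfolding weak_derivative_def
proof (intro allI impI)
  fix \<phi> \<phi>' :: "real \<Rightarrow> real"
  assume *: "\<forall>x. (\<phi> has_real_derivative \<phi>' x) (at x)" "continuous_on UNIV \<phi>'"
    "closure {x. \<phi> x \<noteq> 0} \<subseteq> D"
  have "L2_inner f \<phi>' = - L2_inner f' \<phi>" "L2_inner g \<phi>' = - L2_inner g' \<phi>"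
    using assms * unfolding weak_derivative_def by metis+
  then show "L2_inner (\<lambda>x. a * f x + b * g x) \<phi>' = - L2_inner (\<lambda>x. a * f' x + b * g' x) \<phi>"
    using test_function_L2[OF *(1,2)] assms by (simp add: L2_inner_lincomb)
qed

lemma wderiv_works:
  assumes "f \<in> H1_space"
  shows "wderiv f \<in> L2_space" "weak_derivative f (wderiv f)"
proof -
  have "\<exists>g. g \<in> L2_space \<and> weak_derivative f g" using assms by (auto simp: H1_space_def)
  from someI_ex[OF this] show "wderiv f \<in> L2_space" "weak_derivative f (wderiv f)"
    by (simp_all add: wderiv_def)
qed

lemma H1_spaceI: "f \<in> L2_space \<Longrightarrow> g \<in> L2_space \<Longrightarrow> weak_derivative f g \<Longrightarrow> f \<in> H1_space"
  by (auto simp: H1_space_def)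

lemma H1_space_L2: "f \<in> H1_space \<Longrightarrow> f \<in> L2_space"
  by (auto simp: H1_space_def)

lemma wderiv_AE_eq:
  assumes "f \<in> L2_space" "weak_derivative f g" "g \<in> L2_space"
  shows "AE x in \<mu>. wderiv f x = g x"
  using weak_derivative_unique wderiv_works[OF H1_spaceI[OF assms(1,3,2)]] assms by blast

lemma H1_space_lincomb:
  assumes "f \<in> H1_space" "g \<in> H1_space"
  shows "(\<lambda>x. a * f x + b * g x) \<in> H1_space"
    and "AE x in \<mu>. wderiv (\<lambda>x. a * f x + b * g x) x = a * wderiv f x + b * wderiv g x"
proof -
  note w = wderiv_works[OF assms(1)] wderiv_works[OF assms(2)] H1_space_L2[OF assms(1)] H1_space_L2[OF assms(2)]
  have "weak_derivative (\<lambda>x. a * f x + b * g x) (\<lambda>x. a * wderiv f x + b * wderiv g x)"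
    by (intro weak_derivative_lincomb w)
  then show "(\<lambda>x. a * f x + b * g x) \<in> H1_space"
    and "AE x in \<mu>. wderiv (\<lambda>x. a * f x + b * g x) x = a * wderiv f x + b * wderiv g x"
    using w by (auto intro: H1_spaceI wderiv_AE_eq L2_space_lincomb)
qed

lemma H01_space_H1: "f \<in> H01_space \<Longrightarrow> f \<in> H1_space"
  by (simp add: H01_space_def)

lemma H01_space_lincomb:
  assumes "f \<in> H01_space" "g \<in> H01_space"
  shows "(\<lambda>x. a * f x + b * g x) \<in> H01_space"
proof -
  obtain F where F: "continuous_on {0..1} F" "AE x in lborel. x \<in> D \<longrightarrow> F x = f x" "F 0 = 0" "F 1 = 0"
    using assms(1) by (auto simp: H01_space_def)
  obtain G where G: "continuous_on {0..1} G" "AE x in lborel. x \<in> D \<longrightarrow> G x = g x" "G 0 = 0" "G 1 = 0"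
    using assms(2) by (auto simp: H01_space_def)
  have "continuous_on {0..1} (\<lambda>x. a * F x + b * G x)" using F G by (intro continuous_intros)
  moreover have "AE x in lborel. x \<in> D \<longrightarrow> a * F x + b * G x = a * f x + b * g x"
    using F(2) G(2) by eventually_elim simp
  ultimately show ?thesis
    using H1_space_lincomb(1)[OF assms[THEN H01_space_H1]] F G unfolding H01_space_def
    by (auto intro!: exI[of _ "\<lambda>x. a * F x + b * G x"])
qed

subsection \<open>Primitives and integration by parts\<close>

text \<open>The integral of \<open>q\<close> from 0 to \<open>x\<close>, written with an indicator so that Fubini's theorem applies as it
stands.\<close>

definition primitive :: "(real \<Rightarrow> real) \<Rightarrow> real \<Rightarrow> real" where
  "primitive q x = (\<integral>y. indicator {..<x} y * q y \<partial>\<mu>)"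

lemma integrable_primitive: "integrable \<mu> q \<Longrightarrow> integrable \<mu> (\<lambda>y. indicator {..<x} y * q y)"
  for q :: "real \<Rightarrow> real"
proof (rule Bochner_Integration.integrable_bound[where f=q])
  assume q: "integrable \<mu> q"
  then have [measurable]: "q \<in> borel_measurable \<mu>" by auto
  show "(\<lambda>y. indicator {..<x} y * q y) \<in> borel_measurable \<mu>" by measurable
  show "AE y in \<mu>. norm (indicator {..<x} y * q y) \<le> norm (q y)" by (auto simp: indicator_def)
qed

lemma primitive_measurable [measurable]:
  assumes [measurable]: "q \<in> borel_measurable \<mu>"
  shows "primitive q \<in> borel_measurable borel"
proof -
  have "(\<lambda>(x, y). indicator {..<x} y * q y) \<in> borel_measurable (borel \<Otimes>\<^sub>M \<mu>)"
    unfolding indicator_def lessThan_iff by measurable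
  then show ?thesis unfolding primitive_def[abs_def]
    by (intro unit.borel_measurable_lebesgue_integral)
qed

lemma primitive_bound:
  assumes "q \<in> L2_space" shows "(primitive q x)\<^sup>2 \<le> L2_inner q q"
proof -
  have "(\<integral>y. indicator {..<x} y * q y \<partial>\<mu>)\<^sup>2
      \<le> (\<integral>y. (indicator {..<x} y :: real)\<^sup>2 \<partial>\<mu>) * (\<integral>y. (q y)\<^sup>2 \<partial>\<mu>)"
  proof (rule Cauchy_Schwarz_integral)
    show "square_integrable \<mu> (indicator {..<x})"
      by (rule square_integrable_bounded[where B=1, OF unit.finite_measure_axioms]) auto
    show "square_integrable \<mu> q" using assms by (simp add: L2_space_iff)
  qed
  also have "\<dots> \<le> 1 * (\<integral>y. (q y)\<^sup>2 \<partial>\<mu>)"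
  proof (rule mult_right_mono)
    show "(\<integral>y. (indicator {..<x} y :: real)\<^sup>2 \<partial>\<mu>) \<le> 1"
      by (intro unit.integral_le_const unit.integrable_const_bound[where B=1] AE_I2) (auto simp: indicator_def)
  qed simp
  finally show ?thesis by (simp add: primitive_def L2_inner_eq power2_eq_square)
qed

lemma primitive_L2: assumes "q \<in> L2_space" shows "primitive q \<in> L2_space"
proof (rule L2_space_bounded)
  have [measurable]: "q \<in> borel_measurable \<mu>" using assms by (simp add: L2_space_iff square_integrable_def)
  show "primitive q \<in> borel_measurable \<mu>" by measurable
  show "\<bar>primitive q x\<bar> \<le> L2_norm q" for x
    using primitive_bound[OF assms, of x] by (simp add: L2_norm_def real_le_rsqrt)
qed

text \<open>Both sides are integrals of \<open>q y * g x\<close> over a triangle. Since \<open>g\<close> has mean zero, the integral of \<open>g\<close>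
over \<open>x > y\<close> is minus the integral over \<open>x < y\<close>, and the constant \<open>c\<close> drops out.\<close>

lemma integration_by_parts:
  assumes q: "integrable \<mu> q" and g: "integrable \<mu> g" and g0: "(\<integral>x. g x \<partial>\<mu>) = 0"
  shows "(\<integral>x. (c + primitive q x) * g x \<partial>\<mu>) = - (\<integral>x. q x * primitive g x \<partial>\<mu>)"
proof -
  have [measurable]: "q \<in> borel_measurable \<mu>" "g \<in> borel_measurable \<mu>" using q g by auto
  let ?k = "\<lambda>x y. indicator {..<x} y * q y * g x"
  have int: "integrable (\<mu> \<Otimes>\<^sub>M \<mu>) (\<lambda>(x, y). ?k x y)"
  proof (rule Bochner_Integration.integrable_bound)
    show "integrable (\<mu> \<Otimes>\<^sub>M \<mu>) (\<lambda>(x, y). g x * q y)"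
      by (rule unit_pair.Fubini_integrable) (use q g in \<open>auto simp: abs_mult\<close>)
    show "(\<lambda>(x, y). ?k x y) \<in> borel_measurable (\<mu> \<Otimes>\<^sub>M \<mu>)"
      unfolding indicator_def lessThan_iff by measurable
    show "AE z in \<mu> \<Otimes>\<^sub>M \<mu>. norm (case z of (x, y) \<Rightarrow> ?k x y) \<le> norm (case z of (x, y) \<Rightarrow> g x * q y)"
      by (intro AE_I2) (auto simp: indicator_def abs_mult)
  qed
  have prim_q: "(\<integral>x. primitive q x * g x \<partial>\<mu>) = (\<integral>x. (\<integral>y. ?k x y \<partial>\<mu>) \<partial>\<mu>)"
    by (simp add: primitive_def)
  have swap: "(\<integral>x. (\<integral>y. ?k x y \<partial>\<mu>) \<partial>\<mu>) = (\<integral>y. (\<integral>x. ?k x y \<partial>\<mu>) \<partial>\<mu>)"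
    using unit_pair.Fubini_integral[OF int] by simp
  have inner: "(\<integral>x. ?k x y \<partial>\<mu>) = - (q y * primitive g y)" for y
  proof -
    have "(\<integral>x. ?k x y \<partial>\<mu>) = (\<integral>x. q y * (g x - indicator {..<y} x * g x) \<partial>\<mu>)"
    proof (rule integral_cong_AE)
      show "AE x in \<mu>. ?k x y = q y * (g x - indicator {..<y} x * g x)"
        using AE_neq_unit[of y] by eventually_elim (auto simp: indicator_def)
    qed (auto simp: indicator_def)
    also have "\<dots> = q y * ((\<integral>x. g x \<partial>\<mu>) - primitive g y)"
      using g integrable_primitive[OF g] by (simp add: primitive_def)
    finally show ?thesis by (simp add: g0)
  qed
  have "integrable \<mu> (\<lambda>x. \<integral>y. ?k x y \<partial>\<mu>)"
    using unit_pair.integrable_fst'[OF int] by simp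
  then have "integrable \<mu> (\<lambda>x. primitive q x * g x)" by (simp add: primitive_def)
  then have "(\<integral>x. (c + primitive q x) * g x \<partial>\<mu>) = c * (\<integral>x. g x \<partial>\<mu>) + (\<integral>x. primitive q x * g x \<partial>\<mu>)"
    using g by (simp add: distrib_right)
  then show ?thesis unfolding g0 prim_q swap inner by simp
qed

lemma integral_unit_derivative:
  assumes "\<And>x. x \<in> {a..b} \<Longrightarrow> (f has_real_derivative f' x) (at x)" "continuous_on UNIV f'"
    and "0 \<le> a" "a \<le> b" "b \<le> 1"
  shows "(\<integral>x. indicator {a..b} x * f' x \<partial>\<mu>) = f b - f a"
proof -
  have "(\<integral>x. indicator {a..b} x * f' x \<partial>\<mu>) = (LBINT x:D. indicator {a..b} x * f' x)"
    by (simp add: set_integral_unit)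
  also have "\<dots> = (\<integral>x. f' x * indicator {a..b} x \<partial>lborel)"
    unfolding set_lebesgue_integral_def
  proof (rule integral_cong_AE)
    have [measurable]: "f' \<in> borel_measurable borel" by (rule borel_measurable_continuous_onI[OF assms(2)])
    show "(\<lambda>x. indicator D x *\<^sub>R (indicator {a..b} x * f' x)) \<in> borel_measurable lborel"
      "(\<lambda>x. f' x * indicator {a..b} x) \<in> borel_measurable lborel" by simp_all
    show "AE x in lborel. indicator D x *\<^sub>R (indicator {a..b} x * f' x) = f' x * indicator {a..b} x"
      using AE_lborel_singleton[of 0] AE_lborel_singleton[of 1]
      by eventually_elim (use assms in \<open>auto simp: indicator_def\<close>)
  qed
  also have "\<dots> = f b - f a"
    using assms by (intro integral_FTC_Icc_real) (auto simp: continuous_on_eq_continuous_at)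
  finally show ?thesis .
qed

lemma primitive_of_derivative:
  assumes "\<And>x. (f has_real_derivative f' x) (at x)" "continuous_on UNIV f'" "x \<in> {0..1}"
  shows "primitive f' x = f x - f 0"
proof -
  have "primitive f' x = (\<integral>y. indicator {0..x} y * f' y \<partial>\<mu>)"
    unfolding primitive_def
  proof (rule integral_cong_AE)
    have [measurable]: "f' \<in> borel_measurable borel" by (rule borel_measurable_continuous_onI[OF assms(2)])
    show "AE y in \<mu>. indicator {..<x} y * f' y = indicator {0..x} y * f' y"
      using AE_neq_unit[of x] AE_space by eventually_elim (auto simp: indicator_def space_unit)
    show "(\<lambda>y. indicator {..<x} y * f' y) \<in> borel_measurable \<mu>"
       "(\<lambda>y. indicator {0..x} y * f' y) \<in> borel_measurable \<mu>" by measurable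
  qed
  also have "\<dots> = f x - f 0"
    using assms by (intro integral_unit_derivative) (auto intro: continuous_on_subset)
  finally show ?thesis .
qed

lemma weak_derivative_primitive:
  assumes q: "q \<in> L2_space" shows "weak_derivative (\<lambda>x. c + primitive q x) q"
  unfolding weak_derivative_def
proof (intro allI impI)
  fix \<phi> \<phi>' :: "real \<Rightarrow> real"
  assume *: "\<forall>x. (\<phi> has_real_derivative \<phi>' x) (at x)" "continuous_on UNIV \<phi>'"
    "closure {x. \<phi> x \<noteq> 0} \<subseteq> D"
  have 0: "\<phi> 0 = 0" "\<phi> 1 = 0"
    using *(3) closure_subset[of "{x. \<phi> x \<noteq> 0}"] by force+
  have prim: "primitive \<phi>' x = \<phi> x" if "x \<in> {0..1}" for x
    using primitive_of_derivative[of \<phi> \<phi>' x] * that 0 by simp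
  have "(\<integral>x. \<phi>' x \<partial>\<mu>) = primitive \<phi>' 1"
    unfolding primitive_def by (intro Bochner_Integration.integral_cong) (auto simp: space_unit)
  then have "(\<integral>x. \<phi>' x \<partial>\<mu>) = 0" using prim 0 by simp
  then have "(\<integral>x. (c + primitive q x) * \<phi>' x \<partial>\<mu>) = - (\<integral>x. q x * primitive \<phi>' x \<partial>\<mu>)"
    using q test_function_L2[OF *(1,2)] by (intro integration_by_parts L2_space_integrable) auto
  also have "(\<integral>x. q x * primitive \<phi>' x \<partial>\<mu>) = (\<integral>x. q x * \<phi> x \<partial>\<mu>)"
    by (intro Bochner_Integration.integral_cong) (auto simp: space_unit prim)
  finally show "L2_inner (\<lambda>x. c + primitive q x) \<phi>' = - L2_inner q \<phi>"
    by (simp add: L2_inner_eq)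
qed

lemma integral_tent:
  assumes "0 \<le> c" "0 < d" "c + d \<le> 1"
  shows "integrable \<mu> (\<lambda>x. tent ((x - c) / d) / d)" "(\<integral>x. tent ((x - c) / d) / d \<partial>\<mu>) = 1"
proof -
  have deriv: "((\<lambda>x. smooth_step ((x - c) / d)) has_real_derivative tent ((x - c) / d) / d) (at x)" for x
  proof -
    have "((\<lambda>x. smooth_step ((x - c) / d)) has_real_derivative tent ((x - c) / d) * ((1 - 0) / d)) (at x)"
      by (intro DERIV_chain2[OF smooth_step_derivative] DERIV_cdivide DERIV_diff DERIV_ident DERIV_const)
    then show ?thesis by simp
  qed
  have cont: "continuous_on A (\<lambda>x. tent ((x - c) / d) / d)" for A
    using assms by (intro continuous_intros continuous_on_compose2[OF continuous_tent[of UNIV]]) auto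
  show "integrable \<mu> (\<lambda>x. tent ((x - c) / d) / d)"
    by (intro L2_space_integrable L2_space_continuous cont)
  have "(\<integral>x. tent ((x - c) / d) / d \<partial>\<mu>) = (\<integral>x. indicator {0..1} x * (tent ((x - c) / d) / d) \<partial>\<mu>)"
    by (intro Bochner_Integration.integral_cong) (auto simp: space_unit)
  also have "\<dots> = smooth_step ((1 - c) / d) - smooth_step ((0 - c) / d)"
    by (intro integral_unit_derivative deriv cont) auto
  also have "\<dots> = 1" using assms by (simp add: divide_nonpos_pos le_divide_eq)
  finally show "(\<integral>x. tent ((x - c) / d) / d \<partial>\<mu>) = 1" .
qed

text \<open>Means against a shrinking tent recover the values of a continuous function. The tent may move, as
long as it shrinks towards the point.\<close>

lemma tent_average_tendsto:
  assumes F: "continuous_on {0..1} F" and a: "0 < a" "a < 1"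
    and d: "\<And>n. 0 < d n" "d \<longlonglongrightarrow> 0" and c: "c \<longlonglongrightarrow> a" "\<And>n. 0 \<le> c n" "\<And>n. c n + d n \<le> 1"
  shows "(\<lambda>n. L2_inner F (\<lambda>x. tent ((x - c n) / d n) / d n)) \<longlonglongrightarrow> F a"
proof (rule LIMSEQ_I)
  fix e :: real assume e: "e > 0"
  have "isCont F a"
    using F a by (intro continuous_on_interior) (auto simp: interior_atLeastAtMost_real)
  then obtain s where s: "s > 0" "\<And>x. \<bar>x - a\<bar> < s \<Longrightarrow> \<bar>F x - F a\<bar> < e / 2"
    using e unfolding continuous_at_eps_delta by (metis dist_real_def half_gt_zero_iff)
  have "\<forall>\<^sub>F n in sequentially. a - s < c n" using c(1) s by (intro order_tendstoD) auto
  moreover have "(\<lambda>n. c n + d n) \<longlonglongrightarrow> a + 0" by (intro tendsto_intros c d)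
  then have "\<forall>\<^sub>F n in sequentially. c n + d n < a + s" using s by (intro order_tendstoD) auto
  ultimately have "\<forall>\<^sub>F n in sequentially. \<bar>L2_inner F (\<lambda>x. tent ((x - c n) / d n) / d n) - F a\<bar> \<le> e / 2"
  proof eventually_elim
    case (elim n)
    define t where "t x = tent ((x - c n) / d n) / d n" for x
    have t: "integrable \<mu> t" "(\<integral>x. t x \<partial>\<mu>) = 1"
      unfolding t_def[abs_def] by (rule integral_tent[OF c(2)[of n] d(1)[of n] c(3)[of n]])+
    have tL2: "t \<in> L2_space" unfolding t_def[abs_def]
      using d(1)[of n] by (intro L2_space_continuous continuous_intros continuous_on_compose2[OF continuous_tent[of UNIV]]) auto
    have FL2: "F \<in> L2_space" by (rule L2_space_continuous[OF F])
    have Ft: "integrable \<mu> (\<lambda>x. F x * t x)"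
      using FL2 tL2 unfolding L2_space_iff by (rule square_integrable_times)
    have near: "\<bar>(F x - F a) * t x\<bar> \<le> e / 2 * t x" for x
    proof (cases "c n < x \<and> x < c n + d n")
      case True
      then have "\<bar>F x - F a\<bar> \<le> e / 2" using elim by (intro less_imp_le s) auto
      then show ?thesis using d(1)[of n] tent_nonneg[of "(x - c n) / d n"]
        unfolding abs_mult t_def using e by (intro mult_mono) auto
    next
      case False
      then have "t x = 0" using d(1)[of n] by (auto simp: t_def divide_nonpos_pos le_divide_eq)
      then show ?thesis by simp
    qed
    have "L2_inner F t - F a = (\<integral>x. F x * t x \<partial>\<mu>) - F a * (\<integral>x. t x \<partial>\<mu>)"
      by (simp only: L2_inner_eq t(2))
    also have "\<dots> = (\<integral>x. (F x - F a) * t x \<partial>\<mu>)"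
      using Ft t(1) by (simp add: left_diff_distrib)
    finally have "\<bar>L2_inner F t - F a\<bar> = \<bar>\<integral>x. (F x - F a) * t x \<partial>\<mu>\<bar>" by simp
    also have "\<dots> \<le> (\<integral>x. \<bar>(F x - F a) * t x\<bar> \<partial>\<mu>)" by (rule integral_abs_bound)
    also have "\<dots> \<le> (\<integral>x. e / 2 * t x \<partial>\<mu>)"
    proof (intro integral_mono near integrable_abs)
      show "integrable \<mu> (\<lambda>x. (F x - F a) * t x)" using Ft t(1) by (simp add: left_diff_distrib)
      show "integrable \<mu> (\<lambda>x. e / 2 * t x)" using t(1) by (intro integrable_mult_right)
    qed
    also have "\<dots> = e / 2" using t(2) by simp
    finally show ?case by (simp add: t_def[abs_def])
  qed
  then have "\<forall>\<^sub>F n in sequentially. \<bar>L2_inner F (\<lambda>x. tent ((x - c n) / d n) / d n) - F a\<bar> < e"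
    by eventually_elim (use e in linarith)
  then show "\<exists>no. \<forall>n\<ge>no. norm (L2_inner F (\<lambda>x. tent ((x - c n) / d n) / d n) - F a) < e"
    unfolding eventually_sequentially by simp
qed

lemma continuous_primitive:
  assumes "integrable \<mu> q" shows "continuous_on A (primitive q)"
proof (rule continuous_on_sequentiallyI)
  fix u :: "nat \<Rightarrow> real" and a assume "u \<longlonglongrightarrow> a"
  have eq: "primitive q x = (\<integral>y. q y * indicator {-1<..<x} y \<partial>\<mu>)" for x
    unfolding primitive_def
    by (intro Bochner_Integration.integral_cong) (auto simp: space_unit indicator_def)
  show "(\<lambda>n. primitive q (u n)) \<longlonglongrightarrow> primitive q a"
    unfolding eq by (intro interval_integral_tendsto assms tendsto_const \<open>u \<longlonglongrightarrow> a\<close>)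
qed

lemma primitive_0 [simp]: "primitive q 0 = 0"
proof -
  have "primitive q 0 = (\<integral>y. 0 \<partial>\<mu>)"
    unfolding primitive_def
    by (intro Bochner_Integration.integral_cong) (auto simp: space_unit indicator_def)
  then show ?thesis by simp
qed

lemma primitive_1 [simp]: "primitive q 1 = (\<integral>y. q y \<partial>\<mu>)"
  unfolding primitive_def
  by (intro Bochner_Integration.integral_cong) (auto simp: space_unit indicator_def)

subsection \<open>Functions with zero trace\<close>

lemma H01_spaceE:
  assumes "f \<in> H01_space"
  obtains F where "continuous_on {0..1} F" "AE x in \<mu>. f x = F x" "F 0 = 0" "F 1 = 0"
proof -
  from assms obtain F where F: "continuous_on {0..1} F"
    "AE x in lborel. x \<in> D \<longrightarrow> F x = f x" "F 0 = 0" "F 1 = 0"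
    by (auto simp: H01_space_def)
  have "AE x in \<mu>. f x = F x" unfolding AE_unit using F(2) by eventually_elim auto
  with F that show ?thesis by blast
qed

text \<open>Test the definition of the weak derivative with a bump on \<open>[a, b]\<close>: its derivative is the difference
of two tents, which evaluate the continuous representative at the endpoints, while the bump itself
tends to the indicator of the interval.\<close>

lemma continuous_weak_derivative_increment:
  assumes f: "f \<in> L2_space" "weak_derivative f g" "g \<in> L2_space"
    and F: "continuous_on {0..1} F" "AE x in \<mu>. f x = F x"
    and ab: "0 < a" "a < b" "b < 1"
  shows "(\<integral>x. g x * indicator {a<..<b} x \<partial>\<mu>) = F b - F a"
proof -
  let ?d = "mesh_seq a b"
  note d = mesh_seq[OF ab(2)]
  have FL2: "F \<in> L2_space" by (rule L2_space_continuous[OF F(1)])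
  let ?t = "\<lambda>c n x. tent ((x - c n) / ?d n) / ?d n"
  have tL2: "?t c n \<in> L2_space" for c n
    using d(1)[of n]
    by (intro L2_space_continuous continuous_intros continuous_on_compose2[OF continuous_tent[of UNIV]]) auto
  have diff: "L2_inner F (?t (\<lambda>n. a) n) - L2_inner F (?t (\<lambda>n. b - ?d n) n) = - L2_inner g (bump a b (?d n))" for n
  proof -
    have "L2_inner f (bump_deriv a b (?d n)) = - L2_inner g (bump a b (?d n))"
      using f(2) bump_test_function[OF ab(1,3) d(1,2)] unfolding weak_derivative_def by blast
    moreover have bd: "bump_deriv a b (?d n) = (\<lambda>x. 1 * ?t (\<lambda>n. a) n x + (- 1) * ?t (\<lambda>n. b - ?d n) n x)"
      by (auto simp: bump_deriv_def)
    moreover have "L2_inner f (bump_deriv a b (?d n)) = L2_inner F (bump_deriv a b (?d n))"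
      unfolding bd by (intro L2_inner_cong_AE F f FL2 L2_space_lincomb tL2) auto
    ultimately have "L2_inner F (\<lambda>x. 1 * ?t (\<lambda>n. a) n x + (- 1) * ?t (\<lambda>n. b - ?d n) n x) = - L2_inner g (bump a b (?d n))"
      by metis
    moreover have "L2_inner F (\<lambda>x. 1 * ?t (\<lambda>n. a) n x + (- 1) * ?t (\<lambda>n. b - ?d n) n x)
        = 1 * L2_inner F (?t (\<lambda>n. a) n) + (- 1) * L2_inner F (?t (\<lambda>n. b - ?d n) n)"
      unfolding L2_inner_commute[of F] by (rule L2_inner_lincomb[OF tL2 tL2 FL2])
    ultimately show ?thesis by linarith
  qed
  have lim_a: "(\<lambda>n. L2_inner F (?t (\<lambda>n. a) n)) \<longlonglongrightarrow> F a"
  proof (rule tent_average_tendsto[OF F(1)])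
    show "a + ?d n \<le> 1" for n using d(1,2)[of n] ab by linarith
  qed (use ab d in auto)
  have lim_b: "(\<lambda>n. L2_inner F (?t (\<lambda>n. b - ?d n) n)) \<longlonglongrightarrow> F b"
  proof (rule tent_average_tendsto[OF F(1)])
    have "(\<lambda>n. b - ?d n) \<longlonglongrightarrow> b - 0" by (intro tendsto_intros d)
    then show "(\<lambda>n. b - ?d n) \<longlonglongrightarrow> b" by simp
    show "0 \<le> b - ?d n" for n using d(1,2)[of n] ab by linarith
  qed (use ab d in auto)
  have "(\<lambda>n. - L2_inner g (bump a b (?d n))) \<longlonglongrightarrow> F a - F b"
    using tendsto_diff[OF lim_a lim_b] unfolding diff .
  moreover have "(\<lambda>n. - L2_inner g (bump a b (?d n))) \<longlonglongrightarrow> - L2_inner g (indicator {a<..<b})"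
    by (intro tendsto_minus integral_bump_tendsto f ab)
  ultimately have "F a - F b = - L2_inner g (indicator {a<..<b})" by (rule LIMSEQ_unique)
  then show ?thesis by (simp add: L2_inner_eq)
qed

text \<open>Zero trace enters here: letting the interval in the increment formula grow to \<open>(0, x)\<close> and to \<open>(0, 1)\<close>
gives the representation and the vanishing mean.\<close>

lemma H01_space_primitive:
  assumes f: "f \<in> H01_space"
  shows "AE x in \<mu>. f x = primitive (wderiv f) x" and "(\<integral>x. wderiv f x \<partial>\<mu>) = 0"
proof -
  from H01_spaceE[OF f] obtain F where F: "continuous_on {0..1} F" "AE x in \<mu>. f x = F x" "F 0 = 0" "F 1 = 0"
    by blast
  let ?g = "wderiv f"
  note w = wderiv_works[OF H01_space_H1[OF f]]
  note inc = continuous_weak_derivative_increment[OF H1_space_L2[OF H01_space_H1[OF f]] w(2,1) F(1,2)]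
  have lim: "(\<integral>x. ?g x * indicator {0<..<b} x \<partial>\<mu>) = F b" if b: "b \<in> {0<..1}" for b
  proof -
    define e :: "nat \<Rightarrow> real" where "e n = b / 3 * inverse (real (Suc n))" for n
    have "e \<longlonglongrightarrow> b / 3 * 0" unfolding e_def[abs_def] by (intro tendsto_intros LIMSEQ_inverse_real_of_nat)
    then have e0: "e \<longlonglongrightarrow> 0" by simp
    have e: "0 < e n" "e n \<le> b / 3" for n
      using b by (auto simp: e_def field_simps)
    have in01: "b - e n \<in> {0..1}" "e n \<in> {0..1}" for n
      using e[of n] b by auto
    have "(\<lambda>n. b - e n) \<longlonglongrightarrow> b - 0" by (intro tendsto_intros e0)
    then have be: "(\<lambda>n. b - e n) \<longlonglongrightarrow> b" by simp
    have "(\<lambda>n. \<integral>x. ?g x * indicator {e n<..<b - e n} x \<partial>\<mu>) \<longlonglongrightarrow> (\<integral>x. ?g x * indicator {0<..<b} x \<partial>\<mu>)"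
      by (intro interval_integral_tendsto L2_space_integrable w e0 be)
    moreover have eq: "(\<integral>x. ?g x * indicator {e n<..<b - e n} x \<partial>\<mu>) = F (b - e n) - F (e n)" for n
      using e[of n] b by (intro inc) auto
    moreover have "(\<lambda>n. F (b - e n) - F (e n)) \<longlonglongrightarrow> F b - F 0"
    proof (intro tendsto_diff)
      show "(\<lambda>n. F (b - e n)) \<longlonglongrightarrow> F b"
        by (rule continuous_on_tendsto_compose[OF F(1) be])
(use b in01 in auto)
      show "(\<lambda>n. F (e n)) \<longlonglongrightarrow> F 0"
        by (rule continuous_on_tendsto_compose[OF F(1) e0])
(use b in01 in auto)
    qed
    ultimately show ?thesis using F(3) unfolding eq by (auto dest: LIMSEQ_unique)
  qed
  have prim: "primitive ?g b = F b" if "b \<in> {0<..1}" for b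
    unfolding lim[OF that, symmetric] primitive_def
    by (intro Bochner_Integration.integral_cong) (auto simp: space_unit indicator_def)
  show "AE x in \<mu>. f x = primitive ?g x"
    using F(2) AE_space by eventually_elim (simp add: prim space_unit)
  show "(\<integral>x. ?g x \<partial>\<mu>) = 0" using prim[of 1] F(4) by simp
qed

text \<open>The Dirichlet form, that is, the bilinear form of the Laplacian.\<close>

definition energy :: "(real \<Rightarrow> real) \<Rightarrow> (real \<Rightarrow> real) \<Rightarrow> real" where
  "energy u v = L2_inner (wderiv u) (wderiv v)"

lemma energy_commute: "energy u v = energy v u"
  by (simp add: energy_def L2_inner_commute)

lemma energy_self_nonneg [simp]: "0 \<le> energy u u" by (simp add: energy_def)

lemma energy_lincomb:
  assumes "u \<in> H01_space" "v \<in> H01_space" "w \<in> H01_space"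
  shows "energy (\<lambda>x. a * u x + b * v x) w = a * energy u w + b * energy v w"
proof -
  note h = assms[THEN H01_space_H1]
  note l = h[THEN wderiv_works(1)]
  have "energy (\<lambda>x. a * u x + b * v x) w = L2_inner (\<lambda>x. a * wderiv u x + b * wderiv v x) (wderiv w)"
    unfolding energy_def
    by (intro L2_inner_cong_AE H1_space_lincomb h wderiv_works(1) L2_space_lincomb l) auto
  then show ?thesis by (simp add: L2_inner_lincomb l energy_def)
qed

lemma energy_Cauchy_Schwarz:
  assumes "u \<in> H01_space" "v \<in> H01_space"
  shows "\<bar>energy u v\<bar> \<le> sqrt (energy u u) * sqrt (energy v v)"
  using L2_inner_Cauchy_Schwarz[OF assms[THEN H01_space_H1, THEN wderiv_works(1)]]
  by (simp add: energy_def L2_norm_def)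

lemma H01_space_L2: "f \<in> H01_space \<Longrightarrow> f \<in> L2_space"
  by (simp add: H01_space_H1 H1_space_L2)

lemma L2_inner_AE_zero:
  assumes "AE x in \<mu>. u x = 0" "u \<in> L2_space" "v \<in> L2_space" shows "L2_inner u v = 0"
proof -
  have "(\<lambda>x. 0::real) \<in> L2_space" by (intro L2_space_continuous continuous_intros)
  then have "L2_inner u v = L2_inner (\<lambda>x. 0) v"
    using assms by (intro L2_inner_cong_AE) auto
  then show ?thesis by (simp add: L2_inner_eq)
qed

lemma energy_AE_zero:
  assumes "AE x in \<mu>. u x = 0" "u \<in> H01_space" "v \<in> H01_space" shows "energy u v = 0"
proof -
  have zero: "(\<lambda>x. 0::real) \<in> L2_space" by (intro L2_space_continuous continuous_intros)
  have "weak_derivative (\<lambda>x. 0) (\<lambda>x. 0)" by (simp add: weak_derivative_def L2_inner_eq)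
  then have "weak_derivative u (\<lambda>x. 0)"
  proof (rule weak_derivative_cong_AE[OF _ _ _ zero H01_space_L2[OF assms(2)] zero zero])
    show "AE x in \<mu>. 0 = u x" using assms(1) by eventually_elim simp
  qed simp
  then have "AE x in \<mu>. wderiv u x = 0" by (intro wderiv_AE_eq H01_space_L2 assms zero)
  then show ?thesis
    unfolding energy_def by (intro L2_inner_AE_zero wderiv_works H01_space_H1 assms)
qed

text \<open>The primitive of a square-integrable function is bounded by the norm of the function.\<close>

lemma Poincare:
  assumes "v \<in> H01_space" shows "L2_inner v v \<le> energy v v"
proof -
  note w = wderiv_works[OF H01_space_H1[OF assms]]
  have "L2_inner v v = L2_inner (primitive (wderiv v)) (primitive (wderiv v))"
    by (rule L2_inner_cong_AE[OF H01_space_primitive(1)[OF assms] H01_space_primitive(1)[OF assms]])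
      (use H01_space_L2[OF assms] primitive_L2[OF w(1)] in auto)
  also have "\<dots> \<le> energy v v"
    unfolding L2_inner_eq
    using primitive_L2[OF w(1)] primitive_bound[OF w(1)]
    by (intro unit.integral_le_const) (auto simp: L2_space_iff square_integrable_def power2_eq_square energy_def)
  finally show ?thesis .
qed

lemma integration_by_parts_H01:
  assumes v: "v \<in> H01_space" and q: "q \<in> L2_space"
    and p: "p \<in> L2_space" "AE x in \<mu>. p x = c + primitive q x"
  shows "L2_inner p (wderiv v) = - L2_inner q v"
proof -
  note w = wderiv_works[OF H01_space_H1[OF v]]
  have cp: "(\<lambda>x. c + primitive q x) \<in> L2_space"
    using L2_space_lincomb[OF L2_space_continuous[of "\<lambda>_. 1"] primitive_L2[OF q], of c 1] by simp
  have "L2_inner p (wderiv v) = L2_inner (\<lambda>x. c + primitive q x) (wderiv v)"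
    using p w cp by (intro L2_inner_cong_AE) auto
  also have "\<dots> = - L2_inner q (primitive (wderiv v))"
    unfolding L2_inner_eq
    by (intro integration_by_parts L2_space_integrable q w H01_space_primitive(2) v)
  also have "L2_inner q (primitive (wderiv v)) = L2_inner q v"
    using H01_space_primitive(1)[OF v] q primitive_L2[OF w(1)] H01_space_L2[OF v]
    by (intro L2_inner_cong_AE) (auto elim: eventually_mono)
  finally show ?thesis .
qed

lemma primitive_H01:
  assumes q: "q \<in> L2_space" and 0: "(\<integral>x. q x \<partial>\<mu>) = 0"
  shows "primitive q \<in> H01_space" "AE x in \<mu>. wderiv (primitive q) x = q x"
proof -
  have wd: "weak_derivative (primitive q) q" using weak_derivative_primitive[OF q, of 0] by simp
  then show "AE x in \<mu>. wderiv (primitive q) x = q x"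
    by (intro wderiv_AE_eq primitive_L2 q)
  show "primitive q \<in> H01_space"
    unfolding H01_space_def
    using H1_spaceI[OF primitive_L2[OF q] q wd] continuous_primitive[OF L2_space_integrable[OF q]] 0
    by (auto intro!: exI[of _ "primitive q"])
qed

text \<open>The solution of \<open>- w'' = e\<close> with zero boundary values, obtained by integrating twice: the constant in
\<open>w'\<close> is chosen to make the mean of \<open>w'\<close> vanish. It serves as the dual problem in the Aubin-Nitsche
argument, for which the bound of its second-order Sobolev norm is needed.\<close>

lemma Dirichlet_problem:
  assumes e: "e \<in> L2_space"
  obtains w where "w \<in> H2_space" "w \<in> H01_space"
    "\<And>v. v \<in> H01_space \<Longrightarrow> energy w v = L2_inner e v" "H2_norm w \<le> 2 * L2_norm e"
proof -
  define c where "c = (\<integral>x. primitive e x \<partial>\<mu>)"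
  define q where "q x = c + primitive (\<lambda>x. - e x) x" for x
  have me: "(\<lambda>x. - e x) \<in> L2_space" using L2_space_lincomb[OF e e, of "-1" 0] by simp
  have neg: "primitive (\<lambda>x. - e x) x = - primitive e x" for x by (simp add: primitive_def)
  have qL2: "q \<in> L2_space"
    using L2_space_lincomb[OF L2_space_continuous[of "\<lambda>_. 1"] primitive_L2[OF me], of c 1]
    by (simp add: q_def[abs_def])
  have q0: "(\<integral>x. q x \<partial>\<mu>) = 0"
    using L2_space_integrable[OF primitive_L2[OF e]] unit.prob_space by (simp add: q_def neg c_def)
  define w where "w = primitive q"
  have wH: "w \<in> H01_space" and wd: "AE x in \<mu>. wderiv w x = q x"
    unfolding w_def by (rule primitive_H01[OF qL2 q0])+
  note ww = wderiv_works[OF H01_space_H1[OF wH]]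
  have wdq: "weak_derivative q (\<lambda>x. - e x)" unfolding q_def[abs_def] by (rule weak_derivative_primitive[OF me])
  then have wd2: "weak_derivative (wderiv w) (\<lambda>x. - e x)"
    using weak_derivative_cong_AE[OF wdq, of "wderiv w" "\<lambda>x. - e x"] wd qL2 ww me by (auto simp: eq_commute)
  then have wH1: "wderiv w \<in> H1_space" by (intro H1_spaceI[OF ww(1) me])
  have wdd: "AE x in \<mu>. wderiv (wderiv w) x = - e x"
    by (rule wderiv_AE_eq[OF ww(1) wd2 me])
  have en: "energy w v = L2_inner e v" if "v \<in> H01_space" for v
  proof -
    have "energy w v = - L2_inner (\<lambda>x. - e x) v"
      unfolding energy_def using wd
      by (intro integration_by_parts_H01[where c=c] that me ww) (simp add: q_def)
    then show ?thesis by (simp add: L2_inner_eq)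
  qed
  have "energy w w \<le> L2_norm e * sqrt (energy w w)"
  proof -
    have "energy w w = L2_inner e w" by (rule en[OF wH])
    also have "\<dots> \<le> L2_norm e * L2_norm w"
      using L2_inner_Cauchy_Schwarz[OF e H01_space_L2[OF wH]] by linarith
    also have "\<dots> \<le> L2_norm e * sqrt (energy w w)"
      using Poincare[OF wH] by (intro mult_left_mono) (auto simp: L2_norm_def)
    finally show ?thesis .
  qed
  then have "sqrt (energy w w) * sqrt (energy w w) \<le> L2_norm e * sqrt (energy w w)" by simp
  then have s: "sqrt (energy w w) \<le> L2_norm e"
  proof (cases "energy w w = 0")
    case False
    then have "0 < sqrt (energy w w)" using energy_self_nonneg[of w] by (simp add: less_le)
    with \<open>sqrt (energy w w) * sqrt (energy w w) \<le> L2_norm e * sqrt (energy w w)\<close>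
    show ?thesis by (rule mult_right_le_imp_le)
  qed simp
  have 1: "(L2_norm (wderiv w))\<^sup>2 \<le> (L2_norm e)\<^sup>2"
    using s by (intro power_mono) (auto simp: energy_def L2_norm_def)
  have 2: "(L2_norm w)\<^sup>2 \<le> (L2_norm e)\<^sup>2"
    using Poincare[OF wH] 1 by (simp add: L2_norm_square energy_def)
  have 3: "(L2_norm (wderiv (wderiv w)))\<^sup>2 = (L2_norm e)\<^sup>2"
  proof -
    have "L2_inner (wderiv (wderiv w)) (wderiv (wderiv w)) = L2_inner (\<lambda>x. - e x) (\<lambda>x. - e x)"
      by (intro L2_inner_cong_AE wdd wderiv_works(1)[OF wH1] me)
    then show ?thesis by (simp add: L2_norm_square L2_inner_eq)
  qed
  have "H2_norm w \<le> sqrt ((2 * L2_norm e)\<^sup>2)"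
    unfolding H2_norm_def 3
  proof (rule real_sqrt_le_mono)
    have "(2 * L2_norm e)\<^sup>2 = 4 * (L2_norm e)\<^sup>2" by (simp add: power_mult_distrib)
    then show "(L2_norm w)\<^sup>2 + (L2_norm (wderiv w))\<^sup>2 + (L2_norm e)\<^sup>2 \<le> (2 * L2_norm e)\<^sup>2"
      using 1 2 zero_le_power2[of "L2_norm e"] by linarith
  qed
  also have "\<dots> = 2 * L2_norm e" by (rule real_sqrt_unique) auto
  finally have "H2_norm w \<le> 2 * L2_norm e" .
  moreover have "w \<in> H2_space" using wH1 H01_space_H1[OF wH] by (simp add: H2_space_def)
  ultimately show ?thesis using that wH en by blast
qed

section \<open>The sine basis\<close>

lemma eigval_pos: "k \<ge> 1 \<Longrightarrow> eigval k > 0"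
  by (simp add: eigval_def)

lemma eigfun_bound: "\<bar>eigfun k x\<bar> \<le> sqrt 2"
  using abs_sin_le_one[of "eigval k * x"] by (simp add: eigfun_def abs_mult mult_left_le)

lemma eigfun_boundary [simp]: "eigfun k 0 = 0" "eigfun k 1 = 0"
  by (simp_all add: eigfun_def eigval_def)

lemma continuous_eigfun [continuous_intros]: "continuous_on A (eigfun k)"
  unfolding eigfun_def[abs_def] by (intro continuous_intros)

lemma eigfun_L2: "eigfun k \<in> L2_space"
  by (intro L2_space_continuous continuous_eigfun)

definition coseigfun :: "nat \<Rightarrow> real \<Rightarrow> real" where
  "coseigfun k x = eigval k * sqrt 2 * cos (eigval k * x)"

lemma eigfun_derivative: "(eigfun k has_real_derivative coseigfun k x) (at x)"
  unfolding eigfun_def[abs_def] coseigfun_def by (auto intro!: derivative_eq_intros)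

lemma coseigfun_derivative:
  "(coseigfun k has_real_derivative - (eigval k)\<^sup>2 * eigfun k x) (at x)"
  unfolding eigfun_def coseigfun_def[abs_def]
  by (auto intro!: derivative_eq_intros simp: power2_eq_square)

lemma coseigfun_L2: "coseigfun k \<in> L2_space"
  unfolding coseigfun_def[abs_def] by (intro L2_space_continuous continuous_intros)

lemma eigfun_weak_derivative: "weak_derivative (eigfun k) (coseigfun k)"
proof -
  have prim: "primitive (coseigfun k) x = eigfun k x" if "x \<in> {0..1}" for x
  proof -
    have "continuous_on UNIV (coseigfun k)" unfolding coseigfun_def[abs_def] by (intro continuous_intros)
    from primitive_of_derivative[OF eigfun_derivative this that] show ?thesis by simp
  qed
  have "AE x in \<mu>. 0 + primitive (coseigfun k) x = eigfun k x"
    using AE_space by eventually_elim (auto simp: space_unit prim)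
  from weak_derivative_cong_AE[OF weak_derivative_primitive[OF coseigfun_L2] this]
  show ?thesis using primitive_L2[OF coseigfun_L2] by (simp add: eigfun_L2 coseigfun_L2)
qed

lemma eigfun_H01: "eigfun k \<in> H01_space"
  unfolding H01_space_def
  using H1_spaceI[OF eigfun_L2 coseigfun_L2 eigfun_weak_derivative]
  by (auto intro!: exI[of _ "eigfun k"] continuous_eigfun)

text \<open>The weak form of the eigenvalue equation.\<close>

lemma energy_eigfun:
  assumes v: "v \<in> H01_space" shows "energy (eigfun k) v = (eigval k)\<^sup>2 * L2_inner (eigfun k) v"
proof -
  let ?q = "\<lambda>x. - (eigval k)\<^sup>2 * eigfun k x"
  have qL2: "?q \<in> L2_space" by (intro L2_space_continuous continuous_intros)
  have prim: "coseigfun k x = coseigfun k 0 + primitive ?q x" if "x \<in> {0..1}" for x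
  proof -
    have "continuous_on UNIV ?q" by (intro continuous_intros)
    from primitive_of_derivative[OF coseigfun_derivative this that] show ?thesis by simp
  qed
  have "AE x in \<mu>. wderiv (eigfun k) x = coseigfun k x"
    by (rule wderiv_AE_eq[OF eigfun_L2 eigfun_weak_derivative coseigfun_L2])
  then have "AE x in \<mu>. wderiv (eigfun k) x = coseigfun k 0 + primitive ?q x"
    using AE_space
  proof eventually_elim
    case (elim x)
    then have "x \<in> {0..1}" by (simp add: space_unit)
    from prim[OF this] elim(1) show ?case by simp
  qed
  then have "energy (eigfun k) v = - L2_inner ?q v"
    unfolding energy_def
    by (rule integration_by_parts_H01[OF v qL2 wderiv_works(1)[OF H01_space_H1[OF eigfun_H01]]])
  moreover have "L2_inner ?q v = - (eigval k)\<^sup>2 * L2_inner (eigfun k) v"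
    unfolding L2_inner_eq mult.assoc by (rule integral_mult_right_zero)
  ultimately show ?thesis by simp
qed

lemma eigfun_normalized:
  assumes "k \<ge> 1" shows "L2_inner (eigfun k) (eigfun k) = 1"
proof -
  let ?c = "2 * eigval k"
  have c: "?c \<noteq> 0" using eigval_pos[OF assms] by simp
  let ?f = "\<lambda>x. x - sin (?c * x) / ?c"
  have "(?f has_real_derivative 1 - (cos (?c * x) * (?c * 1)) / ?c) (at x)" for x
    by (intro DERIV_diff DERIV_ident DERIV_cdivide DERIV_chain2[OF DERIV_sin] DERIV_cmult)
  then have "(?f has_real_derivative 1 - cos (?c * x)) (at x)" for x using c by simp
  moreover have "continuous_on UNIV (\<lambda>x. 1 - cos (?c * x))" by (intro continuous_intros)
  ultimately have p: "primitive (\<lambda>x. 1 - cos (?c * x)) 1 = ?f 1 - ?f 0"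
    by (intro primitive_of_derivative) auto
  have s: "sin ?c = 0" using sin_npi[of "2 * k"] by (simp add: eigval_def algebra_simps)
  have "L2_inner (eigfun k) (eigfun k) = (\<integral>x. 1 - cos (?c * x) \<partial>\<mu>)"
    unfolding L2_inner_eq
  proof (intro Bochner_Integration.integral_cong refl)
    fix x
    have "cos (?c * x) = 1 - 2 * (sin (eigval k * x))\<^sup>2"
      using cos_double_sin[of "eigval k * x"] by (simp add: mult.assoc)
    then show "eigfun k x * eigfun k x = 1 - cos (?c * x)"
      by (simp add: eigfun_def power2_eq_square)
  qed
  then show ?thesis using p s by simp
qed

text \<open>Symmetry of the Dirichlet form: both eigenvalues times the inner product give the same number.\<close>

lemma eigfun_orthogonal:
  assumes "k \<ge> 1" "l \<ge> 1" "k \<noteq> l" shows "L2_inner (eigfun k) (eigfun l) = 0"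
proof -
  have "(eigval k)\<^sup>2 * L2_inner (eigfun k) (eigfun l) = (eigval l)\<^sup>2 * L2_inner (eigfun k) (eigfun l)"
    using energy_eigfun[OF eigfun_H01, of k l] energy_eigfun[OF eigfun_H01, of l k]
    by (simp add: energy_commute L2_inner_commute)
  moreover have "(eigval k)\<^sup>2 \<noteq> (eigval l)\<^sup>2"
  proof -
    have "eigval k \<noteq> eigval l" using assms(3) by (simp add: eigval_def)
    moreover have "eigval k \<noteq> - eigval l"
      using eigval_pos[OF assms(1)] eigval_pos[OF assms(2)] by linarith
    ultimately show ?thesis by (simp add: power2_eq_iff)
  qed
  ultimately show ?thesis by simp
qed

section \<open>Finite element spaces\<close>

text \<open>Finite element spaces are plain sets of functions; the notions of linear algebra that are needed are
stated for such sets.\<close>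

definition linear_space :: "('a \<Rightarrow> real) set \<Rightarrow> bool" where
  "linear_space Z \<longleftrightarrow> (\<lambda>x. 0) \<in> Z \<and> (\<forall>f\<in>Z. \<forall>g\<in>Z. \<forall>a b. (\<lambda>x. a * f x + b * g x) \<in> Z)"

definition linear_functional :: "('a \<Rightarrow> real) set \<Rightarrow> (('a \<Rightarrow> real) \<Rightarrow> real) \<Rightarrow> bool" where
  "linear_functional Z L \<longleftrightarrow> (\<forall>f\<in>Z. \<forall>g\<in>Z. \<forall>a b. L (\<lambda>x. a * f x + b * g x) = a * L f + b * L g)"

lemma linear_space_0: "linear_space Z \<Longrightarrow> (\<lambda>x. 0) \<in> Z"
  by (simp add: linear_space_def)

lemma linear_space_lincomb:
  "linear_space Z \<Longrightarrow> f \<in> Z \<Longrightarrow> g \<in> Z \<Longrightarrow> (\<lambda>x. a * f x + b * g x) \<in> Z"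
  unfolding linear_space_def by blast

lemma linear_functional_lincomb:
  "linear_functional Z L \<Longrightarrow> f \<in> Z \<Longrightarrow> g \<in> Z \<Longrightarrow> L (\<lambda>x. a * f x + b * g x) = a * L f + b * L g"
  unfolding linear_functional_def by blast

lemma linear_functional_0:
  assumes "linear_space Z" "linear_functional Z L" shows "L (\<lambda>x. 0) = 0"
  using linear_functional_lincomb[OF assms(2) linear_space_0 linear_space_0, of 0 0] assms(1) by simp

lemma linear_functional_subset:
  "linear_functional Z L \<Longrightarrow> Y \<subseteq> Z \<Longrightarrow> linear_functional Y L"
  unfolding linear_functional_def by blast

text \<open>The Cauchy-Schwarz argument for a semi-inner product, for null vectors only.\<close>

lemma semi_inner_null:
  assumes Z: "linear_space Z" and B: "\<And>v. v \<in> Z \<Longrightarrow> linear_functional Z (\<lambda>u. B u v)"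
    and sym: "\<And>u v. u \<in> Z \<Longrightarrow> v \<in> Z \<Longrightarrow> B u v = B v u" and pos: "\<And>u. u \<in> Z \<Longrightarrow> 0 \<le> B u u"
    and uv: "u \<in> Z" "v \<in> Z" and null: "B v v = 0"
  shows "B u v = 0"
proof (rule ccontr)
  assume nz: "B u v \<noteq> 0"
  \<comment> \<open>With this factor the form takes the value -1 at \<open>u + t v\<close>.\<close>
  define t where "t = - (B u u + 1) / (2 * B u v)"
  have mem: "(\<lambda>x. 1 * u x + t * v x) \<in> Z" by (rule linear_space_lincomb[OF Z uv])
  have "B (\<lambda>x. 1 * u x + t * v x) w = 1 * B u w + t * B v w" if "w \<in> Z" for w
    by (rule linear_functional_lincomb[OF B[OF that] uv])
  note lin = this
  have "B (\<lambda>x. 1 * u x + t * v x) (\<lambda>x. 1 * u x + t * v x) = B u u + 2 * t * B u v"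
    using lin[OF mem] lin[OF uv(1)] lin[OF uv(2)] sym[OF mem uv(1)] sym[OF mem uv(2)] sym[OF uv] null
    by (simp add: algebra_simps)
  also have "\<dots> = -1" using nz by (simp add: t_def field_simps)
  finally show False using pos[OF mem] by simp
qed

text \<open>Riesz representation for a semi-inner product, finite dimension being expressed by a list of linear
functionals whose common kernel is null. The induction passes to the kernel \<open>Y\<close> of the first
functional: by the induction hypothesis a vector outside \<open>Y\<close> can be made orthogonal to \<open>Y\<close>, and the
representing vector is the one for \<open>Y\<close> plus a multiple of that vector.\<close>

lemma Riesz_finite_dimensional:
  fixes B :: "('a \<Rightarrow> real) \<Rightarrow> ('a \<Rightarrow> real) \<Rightarrow> real" and ls :: "(('a \<Rightarrow> real) \<Rightarrow> real) list"
  assumes "linear_space Z" and "\<And>v. v \<in> Z \<Longrightarrow> linear_functional Z (\<lambda>u. B u v)"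
    and "\<And>u v. u \<in> Z \<Longrightarrow> v \<in> Z \<Longrightarrow> B u v = B v u" and "\<And>u. u \<in> Z \<Longrightarrow> 0 \<le> B u u"
    and "\<And>l. l \<in> set ls \<Longrightarrow> linear_functional Z l"
    and "\<And>u. u \<in> Z \<Longrightarrow> (\<forall>l\<in>set ls. l u = 0) \<Longrightarrow> B u u = 0"
    and "linear_functional Z L" and "\<And>u. u \<in> Z \<Longrightarrow> B u u = 0 \<Longrightarrow> L u = 0"
  shows "\<exists>X\<in>Z. \<forall>v\<in>Z. B X v = L v"
  using assms
proof (induction ls arbitrary: Z L)
  case Nil
  have 0: "(\<lambda>x. 0) \<in> Z" using Nil.prems(1) by (rule linear_space_0)
  have "B (\<lambda>x. 0) v = L v" if v: "v \<in> Z" for v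
    using linear_functional_0[OF Nil.prems(1) Nil.prems(2)[OF v]] Nil.prems(6)[OF v] Nil.prems(8)[OF v] by simp
  then show ?case using 0 by blast
next
  case (Cons l ls)
  note Z = Cons.prems(1) and B = Cons.prems(2) and sym = Cons.prems(3) and pos = Cons.prems(4)
  have lin_l: "linear_functional Z l" using Cons.prems(5) by simp
  define Y where "Y = {u \<in> Z. l u = 0}"
  have YZ: "Y \<subseteq> Z" by (auto simp: Y_def)
  have Y: "linear_space Y"
    using Z lin_l linear_functional_0[OF Z lin_l]
    by (auto simp: linear_space_def Y_def linear_functional_def)
  have IH: "\<exists>X\<in>Y. \<forall>v\<in>Y. B X v = L' v"
    if L': "linear_functional Y L'" "\<And>u. u \<in> Y \<Longrightarrow> B u u = 0 \<Longrightarrow> L' u = 0" for L'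
  proof (rule Cons.IH[OF Y _ _ _ _ _ L'])
    show "linear_functional Y (\<lambda>u. B u v)" if "v \<in> Y" for v
      using B YZ that by (blast intro: linear_functional_subset)
    show "linear_functional Y l'" if "l' \<in> set ls" for l'
      using Cons.prems(5) YZ that by (auto intro: linear_functional_subset)
    show "B u u = 0" if "u \<in> Y" "\<forall>l\<in>set ls. l u = 0" for u
      using Cons.prems(6)[of u] that by (simp add: Y_def)
  qed (use sym pos YZ in auto)
  show ?case
  proof (cases "\<exists>z\<in>Z. l z \<noteq> 0")
    case False
    then have "Y = Z" by (auto simp: Y_def)
    then show ?thesis using IH[of L] Cons.prems(7,8) by simp
  next
    case True
    then obtain z0 where z0: "z0 \<in> Z" "l z0 \<noteq> 0" by blast
    have Zlin: "(\<lambda>x. a * f x + b * g x) \<in> Z" if "f \<in> Z" "g \<in> Z" for f g a b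
      by (rule linear_space_lincomb[OF Z that])
    define z where "z x = (1 / l z0) * z0 x + 0 * z0 x" for x
    have zZ: "z \<in> Z" unfolding z_def[abs_def] by (intro Zlin z0)
    have "l z = (1 / l z0) * l z0 + 0 * l z0"
      unfolding z_def[abs_def] by (rule linear_functional_lincomb[OF lin_l z0(1) z0(1)])
    then have lz: "l z = 1" using z0(2) by simp
    have "linear_functional Y (\<lambda>u. B u z)" using B[OF zZ] YZ by (rule linear_functional_subset)
    moreover have "B u z = 0" if "u \<in> Y" "B u u = 0" for u
    proof -
      have uZ: "u \<in> Z" using that(1) YZ by blast
      have "B z u = 0"
        by (rule semi_inner_null[where Z=Z and B=B]) (fact Z zZ uZ that(2) | erule B | erule (1) sym | erule pos)+
      then show ?thesis using sym[OF uZ zZ] by simp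
    qed
    ultimately obtain p where p: "p \<in> Y" "\<And>v. v \<in> Y \<Longrightarrow> B p v = B v z" using IH[of "\<lambda>u. B u z"] by blast
    have pZ: "p \<in> Z" using p YZ by blast
    define q where "q x = 1 * z x + (- 1) * p x" for x
    have qZ: "q \<in> Z" unfolding q_def[abs_def] by (intro Zlin zZ pZ)
    have "l q = 1 * l z + (- 1) * l p"
      unfolding q_def[abs_def] by (rule linear_functional_lincomb[OF lin_l zZ pZ])
    then have lq: "l q = 1" using lz p(1) by (simp add: Y_def)
    have qY: "B q v = 0" if "v \<in> Y" for v
    proof -
      have vZ: "v \<in> Z" using that YZ by blast
      have "B q v = 1 * B z v + (-1) * B p v"
        unfolding q_def[abs_def] by (rule linear_functional_lincomb[OF B[OF vZ] zZ pZ])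
      then show ?thesis using p(2)[OF that] sym[OF zZ vZ] by simp
    qed
    obtain X where X: "X \<in> Y" "\<And>v. v \<in> Y \<Longrightarrow> B X v = L v"
      using IH[of L] linear_functional_subset[OF Cons.prems(7) YZ] Cons.prems(8) YZ by blast
    have XZ: "X \<in> Z" using X YZ by blast
    \<comment> \<open>If \<open>q\<close> is null, then \<open>c = 0\<close> by division by zero, and this is consistent as \<open>L\<close> vanishes at \<open>q\<close>.\<close>
    define c where "c = L q / B q q"
    have cq: "c * B q q = L q" using Cons.prems(8)[OF qZ] by (cases "B q q = 0") (auto simp: c_def)
    define X' where "X' x = 1 * X x + c * q x" for x
    have X'Z: "X' \<in> Z" unfolding X'_def[abs_def] by (intro Zlin XZ qZ)
    have "B X' v = L v" if v: "v \<in> Z" for v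
    proof -
      define y where "y x = 1 * v x + (- l v) * q x" for x
      have yZ: "y \<in> Z" unfolding y_def[abs_def] by (intro Zlin v qZ)
      have "l y = 1 * l v + (- l v) * l q"
        unfolding y_def[abs_def] by (rule linear_functional_lincomb[OF lin_l v qZ])
      then have "l y = 0" using lq by simp
      then have yY: "y \<in> Y" using yZ by (simp add: Y_def)
      have v_eq: "v = (\<lambda>x. 1 * y x + l v * q x)" by (auto simp: y_def)
      have "L (\<lambda>x. 1 * y x + l v * q x) = 1 * L y + l v * L q"
        by (rule linear_functional_lincomb[OF Cons.prems(7) yZ qZ])
      then have Lv: "L v = L y + l v * L q" unfolding v_eq[symmetric] by simp
      have split: "B w v = B w y + l v * B w q" if w: "w \<in> Z" for w
      proof -
        have "B (\<lambda>x. 1 * y x + l v * q x) w = 1 * B y w + l v * B q w"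
          by (rule linear_functional_lincomb[OF B[OF w] yZ qZ])
        then have "B v w = B y w + l v * B q w" unfolding v_eq[symmetric] by simp
        then show ?thesis using sym[OF v w] sym[OF yZ w] sym[OF qZ w] by simp
      qed
      have BX': "B X' w = 1 * B X w + c * B q w" if w: "w \<in> Z" for w
        unfolding X'_def[abs_def] by (rule linear_functional_lincomb[OF B[OF w] XZ qZ])
      have "B X q = 0" using qY[OF X(1)] sym[OF XZ qZ] by simp
      then have "B X' v = L y + l v * (c * B q q)"
        using split[OF X'Z] BX'[OF yZ] BX'[OF qZ] X(2)[OF yY] qY[OF yY] by simp
      then show ?thesis using cq Lv by simp
    qed
    then show ?thesis using X'Z by blast
  qed
qed

lemma fe_space_linear: "fe_space r h Z \<Longrightarrow> linear_space Z"
  by (simp add: fe_space_def linear_space_def)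

lemma fe_space_H01: "fe_space r h Z \<Longrightarrow> v \<in> Z \<Longrightarrow> v \<in> H01_space"
  by (auto simp: fe_space_def)

lemma fe_space_lincomb: "fe_space r h Z \<Longrightarrow> f \<in> Z \<Longrightarrow> g \<in> Z \<Longrightarrow> (\<lambda>x. a * f x + b * g x) \<in> Z"
  by (simp add: fe_space_def)

lemma increasing_nodes_cover:
  fixes z :: "nat \<Rightarrow> real"
  assumes "\<forall>i\<in>{1..K}. z (i - 1) < z i" "z 0 < x" "x < z K"
  shows "x \<in> z ` {..K} \<or> (\<exists>i\<in>{1..K}. x \<in> {z (i - 1)<..<z i})"
  using assms
proof (induction K)
  case (Suc K)
  consider "x < z K" | "x = z K" | "z K < x" by linarith
  then show ?case
  proof cases
    case 1
    then show ?thesis using Suc by force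
  next
    case 3
    then show ?thesis using Suc.prems by (auto intro!: bexI[of _ "Suc K"])
  qed auto
qed simp

lemma fe_space_partition:
  assumes "fe_space r h Z"
  obtains K :: nat and z where "K \<ge> 1" "z 0 = 0" "z K = 1" "\<forall>i\<in>{1..K}. z (i - 1) < z i"
    "h = (MAX i\<in>{1..K}. z i - z (i - 1))"
    "\<forall>f\<in>Z. \<forall>i\<in>{1..K}. \<exists>p :: real poly. degree p \<le> r \<and> (\<forall>x\<in>{z (i - 1)<..<z i}. f x = poly p x)"
proof -
  have "\<exists>(K::nat) z. K \<ge> 1 \<and> z 0 = 0 \<and> z K = 1 \<and> (\<forall>i\<in>{1..K}. z (i - 1) < z i) \<and>
        h = (MAX i\<in>{1..K}. z i - z (i - 1)) \<and>
        (\<forall>f\<in>Z. \<forall>i\<in>{1..K}. \<exists>p :: real poly. degree p \<le> r \<and>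
           (\<forall>x\<in>{z (i - 1)<..<z i}. f x = poly p x))"
    using assms unfolding fe_space_def by (elim conjE)
  then obtain K :: nat and z where Kz: "K \<ge> 1 \<and> z 0 = 0 \<and> z K = 1 \<and> (\<forall>i\<in>{1..K}. z (i - 1) < z i) \<and>
        h = (MAX i\<in>{1..K}. z i - z (i - 1)) \<and>
        (\<forall>f\<in>Z. \<forall>i\<in>{1..K}. \<exists>p :: real poly. degree p \<le> r \<and>
           (\<forall>x\<in>{z (i - 1)<..<z i}. f x = poly p x))"
    by (elim exE) (rule that)
  from Kz show ?thesis by (elim conjE) (rule that[of K z])
qed

text \<open>The mesh size is one of the lengths of a partition of the unit interval. The bound \<open>h \<le> 1\<close> is what
allows lowering the exponent of \<open>h\<close>.\<close>

lemma fe_space_mesh_size: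
  assumes "fe_space r h Z" shows "0 < h" "h \<le> 1"
proof -
  obtain K :: nat and z where K: "K \<ge> 1" "z 0 = 0" "z K = 1"
    "\<forall>i\<in>{1..K}. z (i - 1) < z i" and h: "h = (MAX i\<in>{1..K}. z i - z (i - 1))"
    and "\<forall>f\<in>Z. \<forall>i\<in>{1..K}. \<exists>p :: real poly. degree p \<le> r \<and> (\<forall>x\<in>{z (i - 1)<..<z i}. f x = poly p x)"
    by (rule fe_space_partition[OF assms])
  have mono: "i \<le> j \<Longrightarrow> j \<le> K \<Longrightarrow> z i \<le> z j" for i j
  proof (induction j)
    case (Suc j)
    have "z j < z (Suc j)" using K(4) Suc.prems by (metis atLeastAtMost_iff diff_Suc_1 le_add1 plus_1_eq_Suc)
    then show ?case using Suc by (cases "i = Suc j") auto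
  qed simp
  have "z 1 - z 0 \<le> h" unfolding h using K(1) by (intro Max_ge) (auto intro!: image_eqI[of _ _ 1])
  moreover have "z 0 < z 1" using K(1,4) by force
  ultimately show "0 < h" by linarith
  have "h \<in> (\<lambda>i. z i - z (i - 1)) ` {1..K}" unfolding h using K(1) by (intro Max_in) auto
  then obtain i where i: "i \<in> {1..K}" "h = z i - z (i - 1)" by blast
  have "z i \<le> z K" "z 0 \<le> z (i - 1)" using i by (auto intro!: mono)
  then show "h \<le> 1" using i K by simp
qed

text \<open>Evaluations at \<open>r + 1\<close> points inside each interval determine a polynomial of degree at most \<open>r\<close> there;
the nodes form a null set. This is the finite dimension of the space.\<close>

lemma fe_space_point_evaluations:
  assumes "fe_space r h Z"
  obtains xs :: "real list" where "\<And>f. f \<in> Z \<Longrightarrow> (\<forall>x\<in>set xs. f x = 0) \<Longrightarrow> AE x in \<mu>. f x = 0"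
proof -
  obtain K :: nat and z where K: "K \<ge> 1" "z 0 = 0" "z K = 1" "\<forall>i\<in>{1..K}. z (i - 1) < z i"
    and "h = (MAX i\<in>{1..K}. z i - z (i - 1))"
    and poly: "\<forall>f\<in>Z. \<forall>i\<in>{1..K}. \<exists>p :: real poly. degree p \<le> r \<and> (\<forall>x\<in>{z (i - 1)<..<z i}. f x = poly p x)"
    by (rule fe_space_partition[OF assms])
  have "\<exists>S. finite S \<and> card S = Suc r \<and> S \<subseteq> {z (i - 1)<..<z i}" if "i \<in> {1..K}" for i
  proof -
    have "infinite {z (i - 1)<..<z i}" using K(4) that infinite_Ioo by blast
    from infinite_arbitrarily_large[OF this, of "Suc r"] show ?thesis by blast
  qed
  then obtain S where S: "\<And>i. i \<in> {1..K} \<Longrightarrow> finite (S i) \<and> card (S i) = Suc r \<and> S i \<subseteq> {z (i - 1)<..<z i}"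
    by metis
  have "finite (\<Union>i\<in>{1..K}. S i)" using S by blast
  then obtain xs where xs: "set xs = (\<Union>i\<in>{1..K}. S i)" using finite_list by blast
  show ?thesis
  proof (rule that[of xs])
    fix f assume f: "f \<in> Z" "\<forall>x\<in>set xs. f x = 0"
    have zero: "f x = 0" if i: "i \<in> {1..K}" and x: "x \<in> {z (i - 1)<..<z i}" for i x
    proof -
      obtain p where p: "degree p \<le> r" "\<forall>x\<in>{z (i - 1)<..<z i}. f x = poly p x" using poly f(1) i by blast
      have roots: "S i \<subseteq> {x. poly p x = 0}" using S[OF i] p(2) f(2) i unfolding xs by fastforce
      have "p = 0"
      proof (rule ccontr)
        assume "p \<noteq> 0"
        then have "card (S i) \<le> degree p"
          using card_mono[OF poly_roots_finite roots] card_poly_roots_bound[of p] by force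
        then show False using S[OF i] p(1) by simp
      qed
      then show ?thesis using p(2) x by simp
    qed
    have "AE x in \<mu>. \<forall>i\<in>{..K}. x \<noteq> z i" by (intro AE_finite_allI AE_neq_unit) auto
    then show "AE x in \<mu>. f x = 0"
      using AE_space
    proof eventually_elim
      case (elim x)
      then have "0 < x" "x < 1" by (auto simp: space_unit)
      then have "x \<in> z ` {..K} \<or> (\<exists>i\<in>{1..K}. x \<in> {z (i - 1)<..<z i})"
        by (intro increasing_nodes_cover[OF K(4)]) (simp_all add: K(2,3))
      with elim(1) obtain i where "i \<in> {1..K}" "x \<in> {z (i - 1)<..<z i}" by blast
      then show ?case by (rule zero)
    qed
  qed
qed

text \<open>The discrete elliptic problems: \<open>a = 0\<close> is the Ritz projection, \<open>a = 1\<close> is one step of the scheme.\<close>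

lemma fe_space_Riesz:
  assumes fe: "fe_space r h Z" and ab: "0 \<le> a" "0 \<le> b"
    and L: "linear_functional Z L" and L0: "\<And>u. u \<in> Z \<Longrightarrow> a * L2_inner u u + b * energy u u = 0 \<Longrightarrow> L u = 0"
  shows "\<exists>X\<in>Z. \<forall>v\<in>Z. a * L2_inner X v + b * energy X v = L v"
proof -
  obtain xs :: "real list" where xs: "\<And>f. f \<in> Z \<Longrightarrow> (\<forall>x\<in>set xs. f x = 0) \<Longrightarrow> AE x in \<mu>. f x = 0"
    using fe_space_point_evaluations[OF fe] by blast
  note H = fe_space_H01[OF fe]
  show ?thesis
  proof (rule Riesz_finite_dimensional[where ls = "map (\<lambda>x f. f x) xs", OF fe_space_linear[OF fe] _ _ _ _ _ L L0])
    show "linear_functional Z (\<lambda>u. a * L2_inner u v + b * energy u v)" if "v \<in> Z" for v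
      unfolding linear_functional_def
      using that by (auto simp: L2_inner_lincomb energy_lincomb H H01_space_L2 algebra_simps)
    show "a * L2_inner u v + b * energy u v = a * L2_inner v u + b * energy v u" for u v
      by (simp add: L2_inner_commute energy_commute)
    show "0 \<le> a * L2_inner u u + b * energy u u" for u using ab by simp
    show "linear_functional Z l" if "l \<in> set (map (\<lambda>x f. f x) xs)" for l
      using that by (auto simp: linear_functional_def)
    show "a * L2_inner u u + b * energy u u = 0" if u: "u \<in> Z" "\<forall>l\<in>set (map (\<lambda>x f. f x) xs). l u = 0" for u
    proof -
      have ae: "AE x in \<mu>. u x = 0" using xs[OF u(1)] u(2) by simp
      then show ?thesis using L2_inner_AE_zero energy_AE_zero H[OF u(1)] H01_space_L2 by simp
    qed
  qed
qed

section \<open>The dual Crank-Nicolson scheme\<close>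

lemma H01_space_diff: "f \<in> H01_space \<Longrightarrow> g \<in> H01_space \<Longrightarrow> (\<lambda>x. f x - g x) \<in> H01_space"
  using H01_space_lincomb[of f g 1 "-1"] by simp

lemma H01_space_scale: "f \<in> H01_space \<Longrightarrow> (\<lambda>x. c * f x) \<in> H01_space"
  using H01_space_lincomb[of f f c 0] by simp

lemma L2_space_diff: "f \<in> L2_space \<Longrightarrow> g \<in> L2_space \<Longrightarrow> (\<lambda>x. f x - g x) \<in> L2_space"
  using L2_space_lincomb[of f g 1 "-1"] by simp

lemma L2_space_scale: "f \<in> L2_space \<Longrightarrow> (\<lambda>x. c * f x) \<in> L2_space"
  using L2_space_lincomb[of f f c 0] by simp

lemma L2_inner_diff:
  assumes "f \<in> L2_space" "g \<in> L2_space" "v \<in> L2_space"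
  shows "L2_inner (\<lambda>x. f x - g x) v = L2_inner f v - L2_inner g v"
    and "L2_inner v (\<lambda>x. f x - g x) = L2_inner v f - L2_inner v g"
  using L2_inner_lincomb[OF assms, of 1 "-1"] by (simp_all add: L2_inner_commute[of v])

lemma L2_inner_scale:
  "L2_inner (\<lambda>x. c * f x) v = c * L2_inner f v" "L2_inner v (\<lambda>x. c * f x) = c * L2_inner v f"
proof -
  show "L2_inner (\<lambda>x. c * f x) v = c * L2_inner f v"
    unfolding L2_inner_eq mult.assoc by (rule integral_mult_right_zero)
  then show "L2_inner v (\<lambda>x. c * f x) = c * L2_inner v f" by (simp add: L2_inner_commute)
qed

lemma energy_diff:
  assumes "f \<in> H01_space" "g \<in> H01_space" "v \<in> H01_space"
  shows "energy (\<lambda>x. f x - g x) v = energy f v - energy g v"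
    and "energy v (\<lambda>x. f x - g x) = energy v f - energy v g"
  using energy_lincomb[OF assms, of 1 "-1"] by (simp_all add: energy_commute[of v])

lemma energy_scale:
  assumes "f \<in> H01_space" "v \<in> H01_space"
  shows "energy (\<lambda>x. c * f x) v = c * energy f v" "energy v (\<lambda>x. c * f x) = c * energy v f"
  using energy_lincomb[OF assms(1,1,2), of c 0] by (simp_all add: energy_commute[of v])

lemma L2_inner_null:
  assumes "u \<in> L2_space" "v \<in> L2_space" "L2_inner u u = 0" shows "L2_inner v u = 0"
  using L2_inner_Cauchy_Schwarz[OF assms(2,1)] assms(3) by (simp add: L2_norm_def)

lemma energy_null:
  assumes "u \<in> H01_space" "v \<in> H01_space" "energy u u = 0" shows "energy v u = 0"
  using energy_Cauchy_Schwarz[OF assms(2,1)] assms(3) by simp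

lemma L2_inner_square_lincomb:
  assumes "f \<in> L2_space" "g \<in> L2_space"
  shows "L2_inner (\<lambda>x. a * f x + b * g x) (\<lambda>x. a * f x + b * g x)
    = a\<^sup>2 * L2_inner f f + 2 * a * b * L2_inner f g + b\<^sup>2 * L2_inner g g"
proof -
  let ?s = "\<lambda>x. a * f x + b * g x"
  have s: "?s \<in> L2_space" by (intro L2_space_lincomb assms)
  have "L2_inner ?s ?s = a * L2_inner f ?s + b * L2_inner g ?s"
    by (rule L2_inner_lincomb[OF assms s])
  also have "\<dots> = a * (a * L2_inner f f + b * L2_inner g f) + b * (a * L2_inner f g + b * L2_inner g g)"
    by (simp only: L2_inner_commute[of f ?s] L2_inner_commute[of g ?s]
        L2_inner_lincomb[OF assms assms(1)] L2_inner_lincomb[OF assms assms(2)])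
  also have "\<dots> = a\<^sup>2 * L2_inner f f + 2 * a * b * L2_inner f g + b\<^sup>2 * L2_inner g g"
    by (simp only: L2_inner_commute[of g f]) algebra
  finally show ?thesis .
qed

lemma L2_inner_square_lincomb_le:
  assumes "f \<in> L2_space" "g \<in> L2_space"
  shows "L2_inner (\<lambda>x. a * f x + b * g x) (\<lambda>x. a * f x + b * g x)
    \<le> 2 * (a\<^sup>2 * L2_inner f f) + 2 * (b\<^sup>2 * L2_inner g g)"
proof -
  have "0 \<le> a\<^sup>2 * L2_inner f f - 2 * a * b * L2_inner f g + b\<^sup>2 * L2_inner g g"
    using L2_inner_square_lincomb[OF assms, of a "- b"] L2_inner_self_nonneg[of "\<lambda>x. a * f x + - b * g x"] by simp
  then show ?thesis using L2_inner_square_lincomb[OF assms, of a b] by linarith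
qed

text \<open>The sequence \<open>X\<close> is the Crank-Nicolson solution whose negative difference quotients solve the scheme
dual to the given one. It starts at the Ritz projection of the \<open>n\<close>-th sine divided by its eigenvalue.\<close>

locale dual_scheme =
  fixes r :: nat and h :: real and Z :: "(real \<Rightarrow> real) set" and \<tau> :: real and n :: nat
    and X :: "nat \<Rightarrow> real \<Rightarrow> real"
  assumes fe: "fe_space r h Z" and tau: "\<tau> > 0" and n: "n \<ge> 1"
    and X_mem: "\<And>j. X j \<in> Z"
    and X_0: "\<And>v. v \<in> Z \<Longrightarrow> energy (X 0) v = L2_inner (eigfun n) v"
    and X_Suc: "\<And>j v. v \<in> Z \<Longrightarrow> L2_inner (X (Suc j)) v - L2_inner (X j) v
        + \<tau> / 2 * (energy (X (Suc j)) v + energy (X j) v) = 0"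

lemma dual_scheme_exists:
  assumes fe: "fe_space r h Z" and tau: "\<tau> > 0" and n: "n \<ge> 1"
  obtains X where "dual_scheme r h Z \<tau> n X"
proof -
  note H = fe_space_H01[OF fe]
  have "\<exists>X0\<in>Z. \<forall>v\<in>Z. 0 * L2_inner X0 v + 1 * energy X0 v = L2_inner (eigfun n) v"
  proof (rule fe_space_Riesz[OF fe])
    show "linear_functional Z (L2_inner (eigfun n))"
      unfolding linear_functional_def L2_inner_commute[of "eigfun n"]
      by (auto simp: L2_inner_lincomb H01_space_L2 H eigfun_L2)
    show "L2_inner (eigfun n) u = 0" if "u \<in> Z" "0 * L2_inner u u + 1 * energy u u = 0" for u
    proof (rule L2_inner_null)
      show "L2_inner u u = 0"
        using Poincare[OF H[OF that(1)]] that(2) L2_inner_self_nonneg[of u] by linarith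
    qed (use that H in \<open>auto intro: H01_space_L2 eigfun_L2\<close>)
  qed auto
  then obtain X0 where X0: "X0 \<in> Z" "\<And>v. v \<in> Z \<Longrightarrow> energy X0 v = L2_inner (eigfun n) v" by auto
  have step: "\<exists>Y. Y \<in> Z \<and> (\<forall>v\<in>Z. L2_inner Y v - L2_inner Xj v + \<tau> / 2 * (energy Y v + energy Xj v) = 0)"
    if Xj: "Xj \<in> Z" for Xj
  proof -
    have "\<exists>Y\<in>Z. \<forall>v\<in>Z. 1 * L2_inner Y v + \<tau> / 2 * energy Y v = L2_inner Xj v - \<tau> / 2 * energy Xj v"
    proof (rule fe_space_Riesz[OF fe])
      show "linear_functional Z (\<lambda>v. L2_inner Xj v - \<tau> / 2 * energy Xj v)"
        unfolding linear_functional_def L2_inner_commute[of Xj] energy_commute[of Xj]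
        using Xj by (auto simp: L2_inner_lincomb energy_lincomb H01_space_L2 H algebra_simps)
      fix u assume u: "u \<in> Z" "1 * L2_inner u u + \<tau> / 2 * energy u u = 0"
      have "0 \<le> \<tau> / 2 * energy u u" using tau by simp
      then have "L2_inner u u = 0" "\<tau> / 2 * energy u u = 0"
        using u(2) L2_inner_self_nonneg[of u] by linarith+
      then have "L2_inner u u = 0" "energy u u = 0" using tau by auto
      then show "L2_inner Xj u - \<tau> / 2 * energy Xj u = 0"
        using L2_inner_null[of u Xj] energy_null[of u Xj] H[OF u(1)] H[OF Xj] by (simp add: H01_space_L2)
    qed (use tau in auto)
    then show ?thesis by (auto simp: algebra_simps)
  qed
  have "\<exists>X. \<forall>j. (X j \<in> Z \<and> (j = 0 \<longrightarrow> X j = X0)) \<and>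
      (\<forall>v\<in>Z. L2_inner (X (Suc j)) v - L2_inner (X j) v + \<tau> / 2 * (energy (X (Suc j)) v + energy (X j) v) = 0)"
    by (rule dependent_nat_choice) (use X0 step in auto)
  then obtain X where X: "\<And>j. (X j \<in> Z \<and> (j = 0 \<longrightarrow> X j = X0)) \<and>
      (\<forall>v\<in>Z. L2_inner (X (Suc j)) v - L2_inner (X j) v + \<tau> / 2 * (energy (X (Suc j)) v + energy (X j) v) = 0)"
    by blast
  then have "X 0 = X0" by blast
  with X X0(2) fe tau n have "dual_scheme r h Z \<tau> n X" unfolding dual_scheme_def by blast
  then show ?thesis by (rule that)
qed

context dual_scheme
begin

abbreviation lam :: real where "lam \<equiv> (eigval n)\<^sup>2"
abbreviation ef :: "real \<Rightarrow> real" where "ef \<equiv> eigfun n"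

definition rho :: "real \<Rightarrow> real" where "rho t = exp (- lam * t)"
definition incr :: "nat \<Rightarrow> real \<Rightarrow> real" where "incr j x = X (Suc j) x - X j x"
definition dual_step :: "nat \<Rightarrow> real \<Rightarrow> real" where "dual_step j x = - (1 / \<tau>) * incr j x"

text \<open>The \<open>n\<close>-th sine divided by its eigenvalue, which \<open>X 0\<close> projects and whose Dirichlet form with any
\<open>v\<close> is the inner product of the sine with \<open>v\<close>.\<close>

definition potential :: "real \<Rightarrow> real" where "potential x = 1 / lam * ef x"
definition ritz_error :: "real \<Rightarrow> real" where "ritz_error x = X 0 x - potential x"

lemma lam_pos: "lam > 0" using eigval_pos[OF n] by simp

lemma X_H01: "X j \<in> H01_space" by (rule fe_space_H01[OF fe X_mem])
lemma X_L2: "X j \<in> L2_space" by (rule H01_space_L2[OF X_H01])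
lemma incr_mem: "incr j \<in> Z"
  using fe_space_lincomb[OF fe X_mem X_mem, of 1 "Suc j" "-1" j] by (simp add: incr_def[abs_def])
lemma incr_H01: "incr j \<in> H01_space" by (rule fe_space_H01[OF fe incr_mem])
lemma dual_step_mem: "dual_step j \<in> Z"
  using fe_space_lincomb[OF fe incr_mem incr_mem, of "- (1 / \<tau>)" j 0] by (simp add: dual_step_def[abs_def])
lemma dual_step_H01: "dual_step j \<in> H01_space" by (rule fe_space_H01[OF fe dual_step_mem])
lemma potential_H01: "potential \<in> H01_space"
  unfolding potential_def[abs_def] by (intro H01_space_scale eigfun_H01)
lemma ritz_error_H01: "ritz_error \<in> H01_space"
  unfolding ritz_error_def[abs_def] by (intro H01_space_diff potential_H01 X_H01)

lemma L2_inner_incr: "v \<in> L2_space \<Longrightarrow> L2_inner (incr j) v = L2_inner (X (Suc j)) v - L2_inner (X j) v"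
  unfolding incr_def[abs_def] by (simp add: L2_inner_diff X_L2)
lemma energy_incr: "v \<in> H01_space \<Longrightarrow> energy (incr j) v = energy (X (Suc j)) v - energy (X j) v"
  unfolding incr_def[abs_def] by (simp add: energy_diff X_H01)

lemma L2_inner_dual_step: "L2_inner (dual_step j) v = - (1 / \<tau>) * L2_inner (incr j) v"
  unfolding dual_step_def[abs_def] by (rule L2_inner_scale)
lemma energy_dual_step: "v \<in> H01_space \<Longrightarrow> energy (dual_step j) v = - (1 / \<tau>) * energy (incr j) v"
  unfolding dual_step_def[abs_def] by (rule energy_scale[OF incr_H01])

lemma X_increment:
  "v \<in> Z \<Longrightarrow> L2_inner (X (Suc j)) v - L2_inner (X j) v = - (\<tau> / 2 * (energy (X (Suc j)) v + energy (X j) v))"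
  using X_Suc[of v j] by linarith

text \<open>The first step of the dual scheme is an implicit half step with the sine as data.\<close>

lemma dual_step_0:
  assumes v: "v \<in> Z"
  shows "L2_inner (dual_step 0) v + \<tau> / 2 * energy (dual_step 0) v = L2_inner ef v"
proof -
  have vH: "v \<in> H01_space" by (rule fe_space_H01[OF fe v])
  have "L2_inner (dual_step 0) v + \<tau> / 2 * energy (dual_step 0) v = energy (X 0) v"
    unfolding L2_inner_dual_step energy_dual_step[OF vH] energy_incr[OF vH] L2_inner_incr[OF H01_space_L2[OF vH]]
      X_increment[OF v]
    using tau by (simp add: field_simps)
  then show ?thesis using X_0[OF v] by simp
qed

lemma dual_step_Suc:
  assumes v: "v \<in> Z"
  shows "L2_inner (dual_step (Suc j)) v + \<tau> / 2 * energy (dual_step (Suc j)) v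
    = L2_inner (dual_step j) v - \<tau> / 2 * energy (dual_step j) v"
proof -
  have vH: "v \<in> H01_space" by (rule fe_space_H01[OF fe v])
  show ?thesis
    unfolding L2_inner_dual_step energy_dual_step[OF vH] energy_incr[OF vH] L2_inner_incr[OF H01_space_L2[OF vH]]
      X_increment[OF v]
    using tau by (simp add: field_simps)
qed

lemma energy_potential: "v \<in> H01_space \<Longrightarrow> energy potential v = L2_inner ef v"
  unfolding potential_def[abs_def] energy_scale(1)[OF eigfun_H01] using lam_pos by (simp add: energy_eigfun)

lemma energy_ritz_error: "v \<in> Z \<Longrightarrow> energy ritz_error v = 0"
  using fe_space_H01[OF fe] unfolding ritz_error_def[abs_def]
  by (simp add: energy_diff X_H01 potential_H01 energy_potential X_0)

text \<open>The Ritz projection is orthogonal in the Dirichlet form, so both the projection and its error are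
controlled by the projected function.\<close>

lemma energy_Pythagoras: "energy (X 0) (X 0) + energy ritz_error ritz_error = 1 / lam"
proof -
  have "L2_inner ef potential = 1 / lam * L2_inner ef ef"
    unfolding potential_def[abs_def] by (rule L2_inner_scale)
  then have "energy potential potential = 1 / lam"
    using energy_potential[OF potential_H01] eigfun_normalized[OF n] by simp
  moreover have "energy ritz_error ritz_error = energy ritz_error (X 0) - energy ritz_error potential"
    using energy_diff(2)[OF X_H01 potential_H01 ritz_error_H01, of 0] by (simp add: ritz_error_def[abs_def])
  moreover have "energy ritz_error potential = energy (X 0) potential - energy potential potential"
    using energy_diff(1)[OF X_H01 potential_H01 potential_H01, of 0] by (simp add: ritz_error_def[abs_def])
  moreover have "energy (X 0) potential = energy (X 0) (X 0)"
    using energy_potential[OF X_H01, of 0] X_0[OF X_mem, of 0] by (simp add: energy_commute)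
  moreover have "energy ritz_error (X 0) = 0" by (rule energy_ritz_error[OF X_mem])
  ultimately show ?thesis by linarith
qed

text \<open>The squared error equals its Dirichlet form with the solution \<open>w\<close> of the Dirichlet problem that has
the error as data. Galerkin orthogonality allows replacing \<open>w\<close> by \<open>w - v\<close>; the approximation property
gains a factor \<open>h\<close>, and the Dirichlet norm of the error contributes \<open>1 / eigval n\<close>.\<close>

lemma Aubin_Nitsche:
  assumes ap: "approximation_property C h Z" and C: "C > 0"
  shows "L2_inner ritz_error ritz_error \<le> (2 * C * h)\<^sup>2 / lam"
proof -
  let ?z = ritz_error and ?l = "eigval n"
  have l: "?l > 0" by (rule eigval_pos[OF n])
  note zL2 = H01_space_L2[OF ritz_error_H01]
  obtain w where w: "w \<in> H2_space" "w \<in> H01_space"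
    "\<And>v. v \<in> H01_space \<Longrightarrow> energy w v = L2_inner ?z v" "H2_norm w \<le> 2 * L2_norm ?z"
    by (rule Dirichlet_problem[OF zL2]) blast
  have h0: "h > 0" by (rule fe_space_mesh_size(1)[OF fe])
  have "energy ?z ?z \<le> 1 / lam" using energy_Pythagoras energy_self_nonneg[of "X 0"] by linarith
  then have "sqrt (energy ?z ?z) \<le> sqrt (1 / lam)" by simp
  then have sz: "sqrt (energy ?z ?z) \<le> 1 / ?l" using l by (simp add: real_sqrt_divide)
  have "?l * L2_inner ?z ?z \<le> H1_norm (\<lambda>x. w x - v x)" if v: "v \<in> Z" for v
  proof -
    have vH: "v \<in> H01_space" by (rule fe_space_H01[OF fe v])
    have wv: "(\<lambda>x. w x - v x) \<in> H01_space" by (rule H01_space_diff[OF w(2) vH])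
    have "L2_inner ?z ?z = energy w ?z" by (rule w(3)[OF ritz_error_H01, symmetric])
    also have "\<dots> = energy (\<lambda>x. w x - v x) ?z"
      using energy_ritz_error[OF v] by (simp add: energy_diff w vH ritz_error_H01 energy_commute)
    also have "\<dots> \<le> sqrt (energy (\<lambda>x. w x - v x) (\<lambda>x. w x - v x)) * sqrt (energy ?z ?z)"
      using energy_Cauchy_Schwarz[OF wv ritz_error_H01] by linarith
    also have "\<dots> \<le> H1_norm (\<lambda>x. w x - v x) * (1 / ?l)"
      using sz by (intro mult_mono) (auto simp: H1_norm_def energy_def L2_norm_square)
    finally show ?thesis using l by (simp add: field_simps)
  qed
  then have "?l * L2_inner ?z ?z \<le> (INF v\<in>Z. H1_norm (\<lambda>x. w x - v x))"
    using X_mem by (intro cINF_greatest) auto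
  also have "\<dots> \<le> C * h * H2_norm w"
    using ap w(1,2) by (simp add: approximation_property_def)
  also have "\<dots> \<le> C * h * (2 * L2_norm ?z)" using w(4) C h0 by (intro mult_left_mono) auto
  finally have "?l * (L2_norm ?z)\<^sup>2 \<le> 2 * C * h * L2_norm ?z" by (simp add: L2_norm_square algebra_simps)
  then have "(?l * L2_norm ?z) * L2_norm ?z \<le> (2 * C * h) * L2_norm ?z"
    by (simp add: power2_eq_square algebra_simps)
  then have "?l * L2_norm ?z \<le> 2 * C * h"
    using C h0 L2_norm_nonneg[of ?z] by (cases "L2_norm ?z = 0") (auto simp: less_le intro: mult_right_le_imp_le)
  then have "(?l * L2_norm ?z)\<^sup>2 \<le> (2 * C * h)\<^sup>2" using l by (intro power_mono) auto
  then have "lam * L2_inner ?z ?z \<le> (2 * C * h)\<^sup>2" unfolding power_mult_distrib L2_norm_square .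
  then show ?thesis using lam_pos by (simp add: field_simps)
qed

text \<open>The equation of \<open>X\<close> tested with its own increment: the Dirichlet form telescopes.\<close>

lemma energy_identity:
  "L2_inner (incr j) (incr j) + \<tau> / 2 * (energy (X (Suc j)) (X (Suc j)) - energy (X j) (X j)) = 0"
proof -
  have "L2_inner (incr j) (incr j) = L2_inner (X (Suc j)) (incr j) - L2_inner (X j) (incr j)"
    by (rule L2_inner_incr[OF H01_space_L2[OF incr_H01]])
  moreover have "energy (X (Suc j)) (incr j) + energy (X j) (incr j)
      = energy (X (Suc j)) (X (Suc j)) - energy (X j) (X j)"
    using energy_incr[OF X_H01, of j j] energy_incr[OF X_H01, of j "Suc j"]
    by (simp add: energy_commute[of _ "incr j"] energy_commute[of "X (Suc j)" "X j"])
  ultimately show ?thesis using X_Suc[OF incr_mem, of j j] by simp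
qed

text \<open>The initial Dirichlet form is at most \<open>1 / lam\<close>, so the squared difference quotients, summed with
weight \<open>\<tau>\<close>, are at most \<open>1 / (2 lam)\<close>, exactly as for the exponential decay that they approximate.\<close>

lemma sum_incr_le: "(\<Sum>j<m. L2_inner (incr j) (incr j)) \<le> \<tau> / (2 * lam)"
proof -
  have "(\<Sum>j<m. L2_inner (incr j) (incr j)) = \<tau> / 2 * (energy (X 0) (X 0) - energy (X m) (X m))"
  proof (induction m)
    case (Suc m)
    then show ?case using energy_identity[of m] by (simp add: algebra_simps)
  qed simp
  also have "\<dots> \<le> \<tau> / 2 * (1 / lam)"
    using energy_Pythagoras energy_self_nonneg[of ritz_error] energy_self_nonneg[of "X m"] tau
    by (intro mult_left_mono) linarith+
  finally show ?thesis by simp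
qed

end

section \<open>Stability and error of the dual scheme\<close>

context dual_scheme
begin

text \<open>The amount by which \<open>rho\<close> falls in one time step; divided by \<open>lam * \<tau>\<close> it is the mean of \<open>rho\<close>
over the step.\<close>

definition decay :: "nat \<Rightarrow> real" where "decay j = rho (real j * \<tau>) - rho (real (Suc j) * \<tau>)"

text \<open>The comparison with \<open>rho\<close> times the discrete initial value, instead of the exact solution, keeps the
error inside the finite element space and makes it start at zero.\<close>

definition err :: "nat \<Rightarrow> real \<Rightarrow> real" where "err j x = X j x - rho (real j * \<tau>) * X 0 x"

text \<open>The increment of \<open>err\<close>, written as a linear combination to which the closure and linearity rules
apply literally.\<close>

definition err_step :: "nat \<Rightarrow> real \<Rightarrow> real" where "err_step j x = 1 * incr j x + decay j * X 0 x"
definition defect :: "nat \<Rightarrow> real \<Rightarrow> real \<Rightarrow> real" where "defect j t x = dual_step j x - rho t * ef x"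

lemma rho_pos: "rho t > 0" by (simp add: rho_def)

lemma rho_antimono: "s \<le> t \<Longrightarrow> rho t \<le> rho s"
  using lam_pos by (simp add: rho_def)

lemma decay_bounds:
  shows "0 \<le> decay j" "decay j \<le> lam * \<tau>"
    and "rho (real (Suc j) * \<tau>) \<le> decay j / (lam * \<tau>)" "decay j / (lam * \<tau>) \<le> rho (real j * \<tau>)"
proof -
  define y where "y = lam * \<tau>"
  have y: "y > 0" using lam_pos tau by (simp add: y_def)
  let ?R = "rho (real j * \<tau>)"
  have R: "0 < ?R" "?R \<le> 1"
    using lam_pos tau by (auto simp: rho_def)
  have S: "rho (real (Suc j) * \<tau>) = ?R * exp (- y)"
  proof -
    have e: "- lam * (real (Suc j) * \<tau>) = - lam * (real j * \<tau>) + - y" by (simp add: y_def algebra_simps)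
    show ?thesis unfolding rho_def e by (rule exp_add)
  qed
  have D: "decay j = ?R * (1 - exp (- y))" unfolding decay_def S by algebra
  have e1: "1 - exp (- y) \<le> y" using exp_ge_add_one_self[of "- y"] by linarith
  have e0: "0 \<le> 1 - exp (- y)" using y by simp
  have "exp (- y) * (1 + y) \<le> exp (- y) * exp y" by (intro mult_left_mono exp_ge_add_one_self) simp
  then have e2: "y * exp (- y) \<le> 1 - exp (- y)" by (simp add: exp_minus field_simps)
  show "0 \<le> decay j" unfolding D using R e0 by simp
  have "?R * (1 - exp (- y)) \<le> 1 * y" using R e0 e1 by (intro mult_mono) auto
  then show "decay j \<le> lam * \<tau>" by (simp add: D y_def)
  have "?R * (y * exp (- y)) \<le> ?R * (1 - exp (- y))" using R e2 by (intro mult_left_mono) auto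
  then show "rho (real (Suc j) * \<tau>) \<le> decay j / (lam * \<tau>)"
    unfolding S D y_def[symmetric] using y by (simp add: field_simps)
  have "?R * (1 - exp (- y)) \<le> ?R * y" using R e1 by (intro mult_left_mono) auto
  then show "decay j / (lam * \<tau>) \<le> ?R"
    unfolding D y_def[symmetric] using y by (simp add: field_simps)
qed

text \<open>Each decrement is at most \<open>lam * \<tau>\<close>, and the decrements sum up to at most 1.\<close>

lemma sum_decay_square: "(\<Sum>j<m. (decay j)\<^sup>2) \<le> lam * \<tau>"
proof -
  have "(\<Sum>j<m. (decay j)\<^sup>2) \<le> (\<Sum>j<m. lam * \<tau> * decay j)"
  proof (rule sum_mono)
    fix j
    have "decay j * decay j \<le> lam * \<tau> * decay j" by (intro mult_right_mono decay_bounds)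
    then show "(decay j)\<^sup>2 \<le> lam * \<tau> * decay j" by (simp only: power2_eq_square[of "decay j"])
  qed
  also have "\<dots> = lam * \<tau> * (\<Sum>j<m. decay j)" by (simp add: sum_distrib_left)
  also have "(\<Sum>j<m. decay j) = rho 0 - rho (real m * \<tau>)"
    unfolding decay_def by (induction m) simp_all
  also have "lam * \<tau> * (rho 0 - rho (real m * \<tau>)) \<le> lam * \<tau> * 1"
    using lam_pos tau rho_pos[of "real m * \<tau>"] by (intro mult_left_mono) (auto simp: rho_def)
  finally show ?thesis by simp
qed

lemma err_H01: "err j \<in> H01_space"
  unfolding err_def[abs_def] by (intro H01_space_diff H01_space_scale X_H01)

lemma err_step_mem: "err_step j \<in> Z"
  unfolding err_step_def[abs_def] by (rule fe_space_lincomb[OF fe incr_mem X_mem])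

lemma err_step_L2: "err_step j \<in> L2_space"
  by (rule H01_space_L2[OF fe_space_H01[OF fe err_step_mem]])

lemma err_step_eq: "err_step j = (\<lambda>x. err (Suc j) x - err j x)"
  by (auto simp: err_step_def err_def incr_def decay_def algebra_simps)

text \<open>The error solves the scheme with two sources: the Ritz error times the decrement, and the error of
the trapezoidal rule for \<open>rho\<close>.\<close>

lemma err_equation:
  assumes v: "v \<in> Z"
  shows "L2_inner (err_step j) v + \<tau> / 2 * (energy (err (Suc j)) v + energy (err j) v)
    = decay j * L2_inner ritz_error v
      + (decay j / lam - \<tau> / 2 * (rho (real j * \<tau>) + rho (real (Suc j) * \<tau>))) * L2_inner ef v"
proof -
  have vH: "v \<in> H01_space" by (rule fe_space_H01[OF fe v])
  note vL = H01_space_L2[OF vH]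
  have 1: "L2_inner (err_step j) v = 1 * L2_inner (incr j) v + decay j * L2_inner (X 0) v"
    unfolding err_step_def[abs_def] by (rule L2_inner_lincomb[OF H01_space_L2[OF incr_H01] X_L2 vL])
  have 2: "energy (err i) v = energy (X i) v - rho (real i * \<tau>) * energy (X 0) v" for i
    unfolding err_def[abs_def]
    by (simp add: energy_diff X_H01 H01_space_scale vH energy_scale)
  have 3: "L2_inner ritz_error v = L2_inner (X 0) v - 1 / lam * L2_inner ef v"
    unfolding ritz_error_def[abs_def] L2_inner_diff(1)[OF X_L2 H01_space_L2[OF potential_H01] vL]
    unfolding potential_def[abs_def] L2_inner_scale by (rule refl)
  have 4: "L2_inner (incr j) v = - (\<tau> / 2 * (energy (X (Suc j)) v + energy (X j) v))"
    unfolding L2_inner_incr[OF vL] by (rule X_increment[OF v])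
  show ?thesis unfolding 1 2 3 4 X_0[OF v] by (simp add: algebra_simps)
qed

text \<open>Test the error equation with the increment of the error. The trapezoidal error is at most \<open>\<tau>\<close> times
the decrement since the trapezoidal value and the mean both lie between the values of \<open>rho\<close> at the
two ends.\<close>

lemma err_step_bound:
  "L2_inner (err_step j) (err_step j) + \<tau> * (energy (err (Suc j)) (err (Suc j)) - energy (err j) (err j))
    \<le> (decay j)\<^sup>2 * (L2_norm ritz_error + \<tau>)\<^sup>2"
proof -
  let ?v = "err_step j" and ?\<eta> = "L2_norm ritz_error"
  let ?c = "decay j / lam - \<tau> / 2 * (rho (real j * \<tau>) + rho (real (Suc j) * \<tau>))"
  have en: "energy (err (Suc j)) ?v + energy (err j) ?v
      = energy (err (Suc j)) (err (Suc j)) - energy (err j) (err j)"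
    unfolding err_step_eq
    by (simp add: energy_diff err_H01 energy_commute[of "err (Suc j)" "err j"])
  have c: "\<bar>?c\<bar> \<le> \<tau> * decay j"
  proof -
    define \<delta> where "\<delta> = decay j / (lam * \<tau>)"
    have "\<tau> * rho (real (Suc j) * \<tau>) \<le> \<tau> * \<delta>" "\<tau> * \<delta> \<le> \<tau> * rho (real j * \<tau>)"
      unfolding \<delta>_def using tau by (intro mult_left_mono decay_bounds; simp)+
    moreover have "\<bar>x - (a + b) / 2\<bar> \<le> a - b" if "b \<le> x" "x \<le> a" for a b x :: real
      using that by (auto simp: abs_le_iff field_simps)
    ultimately have "\<bar>\<tau> * \<delta> - (\<tau> * rho (real j * \<tau>) + \<tau> * rho (real (Suc j) * \<tau>)) / 2\<bar>
        \<le> \<tau> * rho (real j * \<tau>) - \<tau> * rho (real (Suc j) * \<tau>)" by blast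
    moreover have "decay j / lam = \<tau> * \<delta>" using tau lam_pos by (simp add: \<delta>_def)
    moreover have "\<tau> / 2 * (x + y) = (\<tau> * x + \<tau> * y) / 2" for x y by (simp add: algebra_simps)
    moreover have "\<tau> * decay j = \<tau> * rho (real j * \<tau>) - \<tau> * rho (real (Suc j) * \<tau>)"
      by (simp add: decay_def right_diff_distrib)
    ultimately show ?thesis by (simp only:)
  qed
  have 1: "decay j * L2_inner ritz_error ?v \<le> decay j * (?\<eta> * L2_norm ?v)"
    using L2_inner_Cauchy_Schwarz[OF H01_space_L2[OF ritz_error_H01] err_step_L2, of j]
    by (intro mult_left_mono decay_bounds) linarith
  have "?c * L2_inner ef ?v \<le> \<bar>?c\<bar> * \<bar>L2_inner ef ?v\<bar>" by (simp add: abs_mult[symmetric])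
  also have "\<dots> \<le> (\<tau> * decay j) * L2_norm ?v"
    using L2_inner_Cauchy_Schwarz[OF eigfun_L2 err_step_L2, of n j] eigfun_normalized[OF n] decay_bounds(1)[of j] tau
    by (intro mult_mono c) (auto simp: L2_norm_def)
  finally have 2: "?c * L2_inner ef ?v \<le> (\<tau> * decay j) * L2_norm ?v" .
  have "L2_inner ?v ?v + \<tau> / 2 * (energy (err (Suc j)) (err (Suc j)) - energy (err j) (err j))
      \<le> (decay j * (?\<eta> + \<tau>)) * L2_norm ?v"
    using err_equation[OF err_step_mem, of j j] 1 2 unfolding en by (simp add: algebra_simps)
  moreover have "2 * ((decay j * (?\<eta> + \<tau>)) * L2_norm ?v) \<le> (decay j * (?\<eta> + \<tau>))\<^sup>2 + L2_inner ?v ?v"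
    using sum_squares_bound[of "decay j * (?\<eta> + \<tau>)" "L2_norm ?v"] by (simp add: L2_norm_square)
  moreover have "2 * (\<tau> / 2 * (energy (err (Suc j)) (err (Suc j)) - energy (err j) (err j)))
      = \<tau> * (energy (err (Suc j)) (err (Suc j)) - energy (err j) (err j))" by simp
  ultimately show ?thesis unfolding power_mult_distrib by linarith
qed

lemma sum_err_step: "(\<Sum>j<m. L2_inner (err_step j) (err_step j)) \<le> lam * \<tau> * (L2_norm ritz_error + \<tau>)\<^sup>2"
proof -
  let ?K = "(L2_norm ritz_error + \<tau>)\<^sup>2"
  have e0: "energy (err 0) (err 0) = 0"
  proof -
    have "err 0 = (\<lambda>x. 0 * X 0 x)" by (auto simp: err_def rho_def)
    then show ?thesis using energy_scale(1)[OF X_H01 err_H01, of 0 0 0] by simp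
  qed
  have "(\<Sum>j<m. L2_inner (err_step j) (err_step j)) + \<tau> * energy (err m) (err m) \<le> (\<Sum>j<m. (decay j)\<^sup>2) * ?K"
  proof (induction m)
    case (Suc m)
    then show ?case using err_step_bound[of m] by (simp add: algebra_simps)
  qed (simp add: e0)
  also have "\<dots> \<le> lam * \<tau> * ?K" by (intro mult_right_mono sum_decay_square) simp
  moreover have "0 \<le> \<tau> * energy (err m) (err m)" using tau by simp
  ultimately show ?thesis by linarith
qed

lemma defect_L2: "defect j t \<in> L2_space"
  unfolding defect_def[abs_def] by (intro L2_space_diff L2_space_scale eigfun_L2 H01_space_L2 dual_step_H01)

lemma defect_norm_expand: "L2_inner (defect j t) (defect j t)
    = L2_inner (dual_step j) (dual_step j) - 2 * rho t * L2_inner (dual_step j) ef + (rho t)\<^sup>2"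
  using L2_inner_square_lincomb[OF H01_space_L2[OF dual_step_H01] eigfun_L2, of 1 j "- rho t" n]
  by (simp add: defect_def[abs_def] eigfun_normalized[OF n])

lemma defect_norm_le: "L2_inner (defect j t) (defect j t)
    \<le> 2 * (L2_inner (incr j) (incr j) / \<tau>\<^sup>2) + 2 * (rho t)\<^sup>2"
proof -
  have "L2_inner (defect j t) (defect j t) \<le> 2 * (1\<^sup>2 * L2_inner (dual_step j) (dual_step j))
      + 2 * ((- rho t)\<^sup>2 * L2_inner ef ef)"
    using L2_inner_square_lincomb_le[OF H01_space_L2[OF dual_step_H01] eigfun_L2, of 1 j "- rho t" n]
    by (simp add: defect_def[abs_def])
  moreover have "L2_inner (dual_step j) (dual_step j) = L2_inner (incr j) (incr j) / \<tau>\<^sup>2"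
    unfolding L2_inner_dual_step L2_inner_commute[of "incr j" "dual_step j"]
    by (simp add: power2_eq_square)
  ultimately show ?thesis by (simp add: eigfun_normalized[OF n])
qed

text \<open>Inserting the definitions, the defect is a combination of the error increment, the Ritz error, and the
sine with the factor "mean of \<open>rho\<close> over the step minus \<open>rho t\<close>", which is at most the decrement.\<close>

lemma defect_norm_le_error:
  assumes "real j * \<tau> \<le> t" "t \<le> real (Suc j) * \<tau>"
  shows "L2_inner (defect j t) (defect j t)
    \<le> 2 * (L2_inner (err_step j) (err_step j) / \<tau>\<^sup>2)
      + 4 * ((decay j)\<^sup>2 / \<tau>\<^sup>2 * (L2_norm ritz_error)\<^sup>2) + 4 * (decay j)\<^sup>2"
proof -
  define c where "c = decay j / (lam * \<tau>) - rho t"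
  define A where "A x = decay j / \<tau> * ritz_error x + c * ef x" for x
  have AL2: "A \<in> L2_space"
    unfolding A_def[abs_def] by (intro L2_space_lincomb H01_space_L2[OF ritz_error_H01] eigfun_L2)
  \<comment> \<open>The potential in \<open>X 0\<close> is split off; its decrement per time is the mean of \<open>rho\<close> times the sine.\<close>
  have eq: "defect j t = (\<lambda>x. - (1 / \<tau>) * err_step j x + 1 * A x)"
    using lam_pos tau
    by (auto simp: defect_def A_def c_def err_step_def dual_step_def ritz_error_def potential_def field_simps)
  have "rho t \<le> rho (real j * \<tau>)" "rho (real (Suc j) * \<tau>) \<le> rho t"
    using assms by (auto intro!: rho_antimono)
  then have "\<bar>c\<bar> \<le> decay j"
    using decay_bounds(3,4)[of j] unfolding c_def decay_def abs_le_iff by (intro conjI; linarith)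
  then have c: "c\<^sup>2 \<le> (decay j)\<^sup>2" using decay_bounds(1)[of j] by (simp add: abs_le_square_iff[symmetric])
  have "L2_inner A A \<le> 2 * ((decay j / \<tau>)\<^sup>2 * L2_inner ritz_error ritz_error) + 2 * (c\<^sup>2 * L2_inner ef ef)"
    unfolding A_def[abs_def]
    by (rule L2_inner_square_lincomb_le[OF H01_space_L2[OF ritz_error_H01] eigfun_L2])
  then have A: "L2_inner A A \<le> 2 * ((decay j)\<^sup>2 / \<tau>\<^sup>2 * (L2_norm ritz_error)\<^sup>2) + 2 * (decay j)\<^sup>2"
    using c by (simp add: eigfun_normalized[OF n] L2_norm_square power_divide)
  have "L2_inner (defect j t) (defect j t) \<le> 2 * ((- (1 / \<tau>))\<^sup>2 * L2_inner (err_step j) (err_step j)) + 2 * (1\<^sup>2 * L2_inner A A)"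
    unfolding eq by (rule L2_inner_square_lincomb_le[OF err_step_L2 AL2])
  then show ?thesis using A by (simp add: power_divide)
qed

text \<open>The \<open>i\<close>-th time step counted backwards from \<open>m * \<tau>\<close>.\<close>

definition slot :: "nat \<Rightarrow> nat \<Rightarrow> real set" where
  "slot m i = {real (m - i - 1) * \<tau><..<real (m - i) * \<tau>}"

lemma slot_measurable [measurable]: "slot m i \<in> sets borel" by (simp add: slot_def)

text \<open>The squared norm of the defect over space and the first \<open>m\<close> time steps; the time of the defect runs
backwards from \<open>m * \<tau>\<close>.\<close>

definition defect_total :: "nat \<Rightarrow> real" where
  "defect_total m = (\<Sum>j<m. LBINT s:slot m j.
      L2_inner (defect j (real m * \<tau> - s)) (defect j (real m * \<tau> - s)))"

lemma slot_integrable_continuous: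
  fixes f :: "real \<Rightarrow> real"
  assumes "continuous_on UNIV f" shows "set_integrable lborel (slot m j) f"
  unfolding slot_def
  by (rule set_integrable_subset[of _ "{real (m - j - 1) * \<tau>..real (m - j) * \<tau>}"])
    (auto intro!: borel_integrable_atLeastAtMost' continuous_on_subset[OF assms])

lemma continuous_defect_norm:
  "continuous_on UNIV (\<lambda>s. L2_inner (defect j (c - s)) (defect j (c - s)))"
  unfolding defect_norm_expand rho_def by (intro continuous_intros)

lemma slot_length:
  assumes "j < m" shows "real (m - j) * \<tau> - real (m - j - 1) * \<tau> = \<tau>"
  using assms by (simp add: of_nat_diff algebra_simps)

lemma slot_integral_const:
  assumes "j < m"
  shows "(LBINT s:slot m j. (c::real)) = \<tau> * c"
proof -
  have le: "real (m - j - 1) * \<tau> \<le> real (m - j) * \<tau>" using tau by (intro mult_right_mono) auto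
  have "(LBINT s:slot m j. (c::real)) = measure lborel (slot m j) *\<^sub>R c"
    by (rule set_integral_const) (use le in \<open>auto simp: slot_def\<close>)
  also have "measure lborel (slot m j) = \<tau>"
    using le slot_length[OF assms] by (simp add: slot_def)
  finally show ?thesis by simp
qed

text \<open>Small modes: the bound grows with the eigenvalue but contains the discretization parameters.\<close>

lemma defect_total_le_error:
  "defect_total m \<le> 8 * lam * ((L2_norm ritz_error)\<^sup>2 + \<tau>\<^sup>2)"
proof -
  let ?\<eta> = "L2_norm ritz_error"
  define b where "b j = 2 * (L2_inner (err_step j) (err_step j) / \<tau>\<^sup>2)
      + 4 * ((decay j)\<^sup>2 / \<tau>\<^sup>2 * ?\<eta>\<^sup>2) + 4 * (decay j)\<^sup>2" for j
  have "defect_total m \<le> (\<Sum>j<m. \<tau> * b j)"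
    unfolding defect_total_def
  proof (rule sum_mono)
    fix j assume j: "j \<in> {..<m}"
    have "(LBINT s:slot m j. L2_inner (defect j (real m * \<tau> - s)) (defect j (real m * \<tau> - s)))
        \<le> (LBINT s:slot m j. b j)"
    proof (intro set_integral_mono slot_integrable_continuous continuous_defect_norm continuous_on_const)
      fix s assume s: "s \<in> slot m j"
      then have "real j * \<tau> \<le> real m * \<tau> - s" "real m * \<tau> - s \<le> real (Suc j) * \<tau>"
        using j by (auto simp: slot_def of_nat_diff algebra_simps)
      then show "L2_inner (defect j (real m * \<tau> - s)) (defect j (real m * \<tau> - s)) \<le> b j"
        unfolding b_def by (rule defect_norm_le_error)
    qed
    then show "(LBINT s:slot m j. L2_inner (defect j (real m * \<tau> - s)) (defect j (real m * \<tau> - s))) \<le> \<tau> * b j"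
      using slot_integral_const[of j m "b j"] j by simp
  qed
  also have "(\<Sum>j<m. \<tau> * b j) = 2 / \<tau> * (\<Sum>j<m. L2_inner (err_step j) (err_step j))
      + (4 / \<tau> * ?\<eta>\<^sup>2 + 4 * \<tau>) * (\<Sum>j<m. (decay j)\<^sup>2)"
    unfolding b_def sum_distrib_left sum.distrib[symmetric] using tau
    by (intro sum.cong refl) (simp add: field_simps power2_eq_square)
  also have "\<dots> \<le> 2 / \<tau> * (lam * \<tau> * (?\<eta> + \<tau>)\<^sup>2) + (4 / \<tau> * ?\<eta>\<^sup>2 + 4 * \<tau>) * (lam * \<tau>)"
    using tau by (intro add_mono mult_left_mono sum_err_step sum_decay_square) auto
  also have "\<dots> = lam * (2 * (?\<eta> + \<tau>)\<^sup>2 + 4 * ?\<eta>\<^sup>2 + 4 * \<tau>\<^sup>2)"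
    using tau by (simp add: field_simps power2_eq_square)
  also have "\<dots> \<le> lam * (8 * (?\<eta>\<^sup>2 + \<tau>\<^sup>2))"
  proof (rule mult_left_mono)
    have "(?\<eta> + \<tau>)\<^sup>2 \<le> 2 * (?\<eta>\<^sup>2 + \<tau>\<^sup>2)" using sum_squares_bound[of ?\<eta> \<tau>] by (simp add: power2_sum)
    then show "2 * (?\<eta> + \<tau>)\<^sup>2 + 4 * ?\<eta>\<^sup>2 + 4 * \<tau>\<^sup>2 \<le> 8 * (?\<eta>\<^sup>2 + \<tau>\<^sup>2)" by simp
  qed (use lam_pos in simp)
  finally show ?thesis by (simp add: algebra_simps)
qed

lemma integral_rho_square: "(LBINT s:{a<..<b}. (rho (c - s))\<^sup>2) = ((rho (c - b))\<^sup>2 - (rho (c - a))\<^sup>2) / (2 * lam)"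
  if "a \<le> b"
proof -
  have "(LBINT s:{a<..<b}. (rho (c - s))\<^sup>2) = (\<integral>s. (rho (c - s))\<^sup>2 * indicator {a..b} s \<partial>lborel)"
    unfolding set_lebesgue_integral_def
  proof (rule integral_cong_AE)
    show "AE s in lborel. indicator {a<..<b} s *\<^sub>R (rho (c - s))\<^sup>2 = (rho (c - s))\<^sup>2 * indicator {a..b} s"
      using AE_lborel_singleton[of a] AE_lborel_singleton[of b] by eventually_elim (auto simp: indicator_def)
  qed (simp_all add: rho_def)
  also have "\<dots> = (rho (c - b))\<^sup>2 / (2 * lam) - (rho (c - a))\<^sup>2 / (2 * lam)"
  proof (rule integral_FTC_Icc_real[OF that])
    fix s
    have "(rho has_real_derivative - lam * rho u) (at u)" for u
      unfolding rho_def[abs_def] by (auto intro!: derivative_eq_intros)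
    then have "((\<lambda>s. rho (c - s)) has_real_derivative - lam * rho (c - s) * (0 - 1)) (at s)"
      by (intro DERIV_chain2[where g="\<lambda>s. c - s"] DERIV_diff DERIV_const DERIV_ident)
    then have "((\<lambda>s. (rho (c - s))\<^sup>2 / (2 * lam)) has_real_derivative
        of_nat 2 * ((- lam * rho (c - s) * (0 - 1)) * (rho (c - s)) ^ (2 - Suc 0)) / (2 * lam)) (at s)"
      by (intro DERIV_cdivide DERIV_power)
    moreover have "of_nat 2 * ((- l * e * (0 - 1)) * e ^ (2 - Suc 0)) / (2 * l) = e\<^sup>2" if "l > 0" for e l :: real
      using that by (simp add: power2_eq_square)
    ultimately show "((\<lambda>s. (rho (c - s))\<^sup>2 / (2 * lam)) has_real_derivative (rho (c - s))\<^sup>2) (at s)"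
      using lam_pos by metis
    show "isCont (\<lambda>s. (rho (c - s))\<^sup>2) s" unfolding rho_def by (intro continuous_intros)
  qed
  finally show ?thesis by (simp add: diff_divide_distrib)
qed

text \<open>Large modes: the discrete and the exact dual solution each have squared norm at most \<open>1 / (2 * lam)\<close>,
and no cancellation is needed.\<close>

lemma defect_total_le_stability: "defect_total m \<le> 2 / lam"
proof -
  define p where "p j = (rho (real j * \<tau>))\<^sup>2 / (2 * lam)" for j
  have "defect_total m \<le> (\<Sum>j<m. 2 / \<tau> * L2_inner (incr j) (incr j) + 2 * (p j - p (Suc j)))"
    unfolding defect_total_def
  proof (rule sum_mono)
    fix j assume j: "j \<in> {..<m}"
    have le: "real (m - j - 1) * \<tau> \<le> real (m - j) * \<tau>" using tau by (intro mult_right_mono) auto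
    have cont: "continuous_on UNIV (\<lambda>s. 2 * (rho (c - s))\<^sup>2)" for c unfolding rho_def by (intro continuous_intros)
    have "(LBINT s:slot m j. L2_inner (defect j (real m * \<tau> - s)) (defect j (real m * \<tau> - s)))
        \<le> (LBINT s:slot m j. 2 * (L2_inner (incr j) (incr j) / \<tau>\<^sup>2) + 2 * (rho (real m * \<tau> - s))\<^sup>2)"
      by (intro set_integral_mono slot_integrable_continuous continuous_defect_norm
          continuous_on_add continuous_on_const cont defect_norm_le)
    also have "\<dots> = (LBINT s:slot m j. 2 * (L2_inner (incr j) (incr j) / \<tau>\<^sup>2)) + (LBINT s:slot m j. 2 * (rho (real m * \<tau> - s))\<^sup>2)"
      by (intro set_integral_add slot_integrable_continuous continuous_on_const cont)
    also have "(LBINT s:slot m j. 2 * (rho (real m * \<tau> - s))\<^sup>2) = 2 * (p j - p (Suc j))"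
    proof -
      have "real m * \<tau> - real (m - j) * \<tau> = real j * \<tau>" "real m * \<tau> - real (m - j - 1) * \<tau> = real (Suc j) * \<tau>"
        using j by (auto simp: of_nat_diff algebra_simps)
      then show ?thesis
        by (simp only: slot_def set_integral_mult_right integral_rho_square[OF le] p_def diff_divide_distrib)
    qed
    also have "(LBINT s:slot m j. 2 * (L2_inner (incr j) (incr j) / \<tau>\<^sup>2)) = 2 / \<tau> * L2_inner (incr j) (incr j)"
      using j tau by (subst slot_integral_const) (auto simp: power2_eq_square)
    finally show "(LBINT s:slot m j. L2_inner (defect j (real m * \<tau> - s)) (defect j (real m * \<tau> - s)))
        \<le> 2 / \<tau> * L2_inner (incr j) (incr j) + 2 * (p j - p (Suc j))" .
  qed
  also have "\<dots> = 2 / \<tau> * (\<Sum>j<m. L2_inner (incr j) (incr j)) + 2 * (\<Sum>j<m. p j - p (Suc j))"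
    by (simp add: sum.distrib sum_distrib_left)
  also have "(\<Sum>j<m. p j - p (Suc j)) = p 0 - p m" by (induction m) simp_all
  also have "2 / \<tau> * (\<Sum>j<m. L2_inner (incr j) (incr j)) \<le> 2 / \<tau> * (\<tau> / (2 * lam))"
    using tau by (intro mult_left_mono sum_incr_le) auto
  also have "2 / \<tau> * (\<tau> / (2 * lam)) + 2 * (p 0 - p m) \<le> 1 / lam + 2 * p 0"
    using tau lam_pos by (simp add: p_def)
  also have "\<dots> = 2 / lam" by (simp add: p_def rho_def)
  finally show ?thesis by simp
qed

end

section \<open>Completeness of the sine basis\<close>

definition sine_span :: "(real \<Rightarrow> real) set" where
  "sine_span = {\<lambda>x. \<Sum>k\<in>{1..n}. c k * eigfun k x | c n. True}"

lemma sine_spanI: "(\<lambda>x. \<Sum>k\<in>{1..n}. c k * eigfun k x) \<in> sine_span"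
  unfolding sine_span_def mem_Collect_eq by (rule exI[of _ c], rule exI[of _ n]) simp

lemma sine_span_0: "(\<lambda>x. 0) \<in> sine_span"
  using sine_spanI[where n=0] by simp

lemma sine_span_eigfun: "(\<lambda>x. a * eigfun k x) \<in> sine_span"
proof (cases "k = 0")
  case True
  then show ?thesis using sine_span_0 by (simp add: eigfun_def eigval_def)
next
  case False
  then have "(\<lambda>x. a * eigfun k x) = (\<lambda>x. \<Sum>i\<in>{1..k}. (if i = k then a else 0) * eigfun i x)"
    by (auto simp: if_distrib[of "\<lambda>c. c * _"] sum.delta cong: if_cong)
  then show ?thesis by (simp only: sine_spanI)
qed

lemma sine_span_add:
  assumes "f \<in> sine_span" "g \<in> sine_span" shows "(\<lambda>x. f x + g x) \<in> sine_span"
proof -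
  obtain c n d m where f: "f = (\<lambda>x. \<Sum>k\<in>{1..n}. c k * eigfun k x)" and g: "g = (\<lambda>x. \<Sum>k\<in>{1..m}. d k * eigfun k x)"
    using assms by (auto simp: sine_span_def)
  have ext: "(\<Sum>k\<in>{1..n}. c k * eigfun k x) = (\<Sum>k\<in>{1..n+m}. (if k \<le> n then c k else 0) * eigfun k x)" for c n m x
    by (rule sum.mono_neutral_cong_left) auto
  have "(\<lambda>x. f x + g x) = (\<lambda>x. \<Sum>k\<in>{1..n+m}. ((if k \<le> n then c k else 0) + (if k \<le> m then d k else 0)) * eigfun k x)"
    unfolding f g distrib_right sum.distrib using ext[where n=n and m=m] ext[where n=m and m=n]
    by (simp only: add.commute[of m n])
  then show ?thesis by (simp only: sine_spanI)
qed

lemma sine_span_sum: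
  assumes "finite I" "\<And>i. i \<in> I \<Longrightarrow> f i \<in> sine_span" shows "(\<lambda>x. \<Sum>i\<in>I. f i x) \<in> sine_span"
  using assms by (induction I) (auto intro: sine_span_0 sine_span_add)

lemma eigfun_times_cos:
  "eigfun (Suc k) x * cos (pi * x) = (1/2) * eigfun (Suc (Suc k)) x + (1/2) * eigfun k x"
proof -
  have "sin (eigval (Suc k) * x) * cos (pi * x) =
      (sin (eigval (Suc k) * x + pi * x) + sin (eigval (Suc k) * x - pi * x)) / 2"
    by (simp add: sin_times_cos)
  moreover have "eigval (Suc k) * x + pi * x = eigval (Suc (Suc k)) * x" "eigval (Suc k) * x - pi * x = eigval k * x"
    by (simp_all add: eigval_def algebra_simps)
  ultimately have eq: "sin (eigval (Suc k) * x) * cos (pi * x) =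
      (sin (eigval (Suc (Suc k)) * x) + sin (eigval k * x)) / 2" by simp
  have "eigfun (Suc k) x * cos (pi * x) = sqrt 2 * ((sin (eigval (Suc (Suc k)) * x) + sin (eigval k * x)) / 2)"
    unfolding eigfun_def mult.assoc eq ..
  then show ?thesis by (simp add: eigfun_def algebra_simps add_divide_distrib)
qed

text \<open>The product formula for sine and cosine; the term of index zero vanishes.\<close>

lemma sine_span_times_cos:
  assumes "f \<in> sine_span" shows "(\<lambda>x. f x * cos (pi * x)) \<in> sine_span"
proof -
  obtain c n where f: "f = (\<lambda>x. \<Sum>k\<in>{1..n}. c k * eigfun k x)"
    using assms by (auto simp: sine_span_def)
  have "(\<lambda>x. c k * eigfun k x * cos (pi * x)) \<in> sine_span" if "k \<in> {1..n}" for k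
  proof -
    have k: "k = Suc (k - 1)" using that by auto
    then obtain l where k: "k = Suc l" by blast
    have "(\<lambda>x. c k * eigfun k x * cos (pi * x)) = (\<lambda>x. (c k / 2) * eigfun (Suc (Suc l)) x + (c k / 2) * eigfun l x)"
      unfolding k mult.assoc eigfun_times_cos by (simp add: algebra_simps)
    then show ?thesis by (simp only: sine_span_add sine_span_eigfun)
  qed
  then have "(\<lambda>x. \<Sum>k\<in>{1..n}. c k * eigfun k x * cos (pi * x)) \<in> sine_span"
    by (intro sine_span_sum) auto
  then show ?thesis by (simp add: f sum_distrib_right)
qed

lemma sine_span_sin_cos_power: "(\<lambda>x. a * (sin (pi * x) * cos (pi * x) ^ i)) \<in> sine_span"
proof (induction i)
  case 0
  have "(\<lambda>x. a * (sin (pi * x) * cos (pi * x) ^ 0)) = (\<lambda>x. (a / sqrt 2) * eigfun 1 x)"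
    by (simp add: eigfun_def eigval_def)
  then show ?case by (simp only: sine_span_eigfun)
next
  case (Suc i)
  from sine_span_times_cos[OF this] show ?case by (simp add: mult_ac)
qed

text \<open>Cut \<open>F\<close> off to a function \<open>G\<close> that vanishes near both endpoints. Then \<open>G x / sin (\<pi> x)\<close> is continuous, and
as a function of \<open>cos (\<pi> x)\<close> it is uniformly close to a polynomial by the Weierstrass theorem. Finally,
\<open>sin (\<pi> x)\<close> times a polynomial in \<open>cos (\<pi> x)\<close> is a sine polynomial.\<close>

lemma sine_approximation:
  assumes F: "continuous_on {0..1} F" "F 0 = 0" "F 1 = 0" and e: "e > 0"
  obtains s where "s \<in> sine_span" "\<And>x. x \<in> {0..1} \<Longrightarrow> \<bar>F x - s x\<bar> \<le> e"
proof -
  define d where "d = e / 2"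
  have d: "d > 0" using e by (simp add: d_def)
  \<comment> \<open>Soft thresholding: \<open>G\<close> vanishes wherever \<open>F\<close> is at most \<open>d\<close> in absolute value.\<close>
  define G where "G x = F x - max (- d) (min d (F x))" for x
  have Gcont: "continuous_on {0..1} G" unfolding G_def by (intro continuous_intros F)
  have FG: "\<bar>F x - G x\<bar> \<le> d" for x using d by (auto simp: G_def)
  have G0: "G x = 0" if "\<bar>F x\<bar> \<le> d" for x using that by (auto simp: G_def)
  have lim: "\<exists>r>0. \<forall>x\<in>{0..1}. \<bar>x - a\<bar> < r \<longrightarrow> G x = 0" if "a \<in> {0..1}" "F a = 0" for a
  proof -
    from bspec[OF F(1)[unfolded continuous_on_iff] that(1)] d
    obtain r where "r > 0" "\<forall>x\<in>{0..1}. dist x a < r \<longrightarrow> dist (F x) (F a) < d"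
      by meson
    then have "\<forall>x\<in>{0..1}. \<bar>x - a\<bar> < r \<longrightarrow> \<bar>F x\<bar> \<le> d"
      using that(2) by (simp add: dist_real_def less_imp_le)
    then show ?thesis using \<open>r > 0\<close> by (intro exI[of _ r] conjI ballI impI G0) auto
  qed
  define Q where "Q x = G x / sin (pi * x)" for x
  have sin_nz: "sin (pi * x) \<noteq> 0" if "0 < x" "x < 1" for x
    using sin_gt_zero[of "pi * x"] that by simp
  have Qcont: "continuous_on {0..1} Q"
    unfolding continuous_on_eq_continuous_within
  proof
    fix a :: real assume a: "a \<in> {0..1}"
    show "continuous (at a within {0..1}) Q"
    proof (cases "0 < a \<and> a < 1")
      case True
      then show ?thesis
        unfolding Q_def using Gcont a sin_nz
        by (intro continuous_intros) (auto simp: continuous_on_eq_continuous_within)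
    next
      case False
      then have "F a = 0" using a F by (auto simp: not_less)
      from lim[OF a this] obtain r where r: "r > 0" "\<forall>x\<in>{0..1}. \<bar>x - a\<bar> < r \<longrightarrow> G x = 0" by blast
      have "continuous (at a within {0..1}) (\<lambda>x. 0::real)" by simp
      then show ?thesis
        by (rule continuous_transform_within[OF _ r(1) a]) (use r in \<open>auto simp: Q_def dist_real_def\<close>)
    qed
  qed
  define q where "q c = Q (arccos c / pi)" for c
  have "continuous_on {-1..1} q"
    unfolding q_def
  proof (rule continuous_on_compose2[OF Qcont])
    show "continuous_on {-1..1} (\<lambda>c. arccos c / pi)" by (intro continuous_intros) auto
    show "(\<lambda>c. arccos c / pi) ` {-1..1} \<subseteq> {0..1}"
      using arccos_lbound arccos_ubound by (auto simp: field_simps)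
  qed
  from Stone_Weierstrass_real_polynomial_function[OF compact_Icc this d]
  obtain p where p: "real_polynomial_function p" "\<And>c. c \<in> {-1..1} \<Longrightarrow> \<bar>q c - p c\<bar> < d" by blast
  then obtain a n where pa: "p = (\<lambda>c. \<Sum>i\<le>n. a i * c ^ i)"
    unfolding real_polynomial_function_iff_sum by blast
  define s where "s x = (\<Sum>i\<le>n. a i * (sin (pi * x) * cos (pi * x) ^ i))" for x
  have "s \<in> sine_span" unfolding s_def[abs_def] by (intro sine_span_sum sine_span_sin_cos_power) auto
  moreover have "\<bar>F x - s x\<bar> \<le> e" if x: "x \<in> {0..1}" for x
  proof -
    have s: "s x = sin (pi * x) * p (cos (pi * x))"
      by (simp add: s_def pa sum_distrib_left mult_ac)
    have "arccos (cos (pi * x)) = pi * x" using x by (intro arccos_cos) auto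
    then have q: "q (cos (pi * x)) = Q x" by (simp add: q_def)
    have G: "G x = sin (pi * x) * Q x"
    proof (cases "0 < x \<and> x < 1")
      case True
      then show ?thesis using sin_nz by (simp add: Q_def)
    next
      case False
      then have "x = 0 \<or> x = 1" using x by auto
      then show ?thesis using F d by (auto intro!: G0)
    qed
    have "\<bar>G x - s x\<bar> = \<bar>sin (pi * x)\<bar> * \<bar>q (cos (pi * x)) - p (cos (pi * x))\<bar>"
      unfolding G s q abs_mult[symmetric] by (simp add: algebra_simps)
    also have "\<dots> \<le> 1 * d"
      using p(2)[of "cos (pi * x)"] by (intro mult_mono) auto
    finally show ?thesis
      using FG[of x] abs_triangle_ineq[of "F x - G x" "G x - s x"] by (simp add: d_def)
  qed
  ultimately show ?thesis by (rule that)
qed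

lemma L2_space_sum_eigfun: "finite I \<Longrightarrow> (\<lambda>x. \<Sum>k\<in>I. c k * eigfun k x) \<in> L2_space"
proof (induction I rule: finite_induct)
  case empty
  then show ?case using L2_space_continuous[of "\<lambda>_. 0"] by simp
next
  case (insert k I)
  then show ?case using L2_space_lincomb[OF eigfun_L2 insert(3), of "c k" k 1] by simp
qed

lemma L2_inner_sum_eigfun:
  assumes "finite I" "f \<in> L2_space"
  shows "L2_inner (\<lambda>x. \<Sum>k\<in>I. c k * eigfun k x) f = (\<Sum>k\<in>I. c k * L2_inner (eigfun k) f)"
  using assms(1)
proof (induction I rule: finite_induct)
  case (insert k I)
  then show ?case
    using L2_inner_lincomb[OF eigfun_L2 L2_space_sum_eigfun[OF insert(1)] assms(2), of "c k" k 1 c] by simp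
qed (simp add: L2_inner_eq)

text \<open>The half of Parseval's identity that expresses completeness. Among the sine polynomials of given
degree the partial Fourier sum is the best approximation, so the uniform approximations above bound
the remainder.\<close>

lemma sine_completeness:
  assumes f: "f \<in> L2_space" "AE x in \<mu>. f x = F x"
    and F: "continuous_on {0..1} F" "F 0 = 0" "F 1 = 0"
  shows "ennreal (L2_inner f f) \<le> (\<Sum>k. ennreal ((L2_inner f (eigfun (Suc k)))\<^sup>2))"
proof (rule ennreal_le_epsilon)
  fix e :: real assume e: "e > 0"
  obtain s where s: "s \<in> sine_span" "\<And>x. x \<in> {0..1} \<Longrightarrow> \<bar>F x - s x\<bar> \<le> sqrt e"
    by (rule sine_approximation[OF F, of "sqrt e"]) (use e in auto)
  then obtain c n where s_eq: "s = (\<lambda>x. \<Sum>k\<in>{1..n}. c k * eigfun k x)" by (auto simp: sine_span_def)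
  have sL2: "s \<in> L2_space" unfolding s_eq by (rule L2_space_sum_eigfun) simp
  let ?a = "\<lambda>k. L2_inner f (eigfun k)"
  have fs: "L2_inner f s = (\<Sum>k\<in>{1..n}. c k * ?a k)"
    unfolding L2_inner_commute[of f] s_eq by (subst L2_inner_sum_eigfun[OF _ f(1)]) auto
  have es: "L2_inner (eigfun k) s = c k" if "k \<in> {1..n}" for k
  proof -
    have "L2_inner (eigfun k) s = (\<Sum>i\<in>{1..n}. c i * L2_inner (eigfun i) (eigfun k))"
      unfolding L2_inner_commute[of "eigfun k" s] unfolding s_eq
      by (rule L2_inner_sum_eigfun[OF _ eigfun_L2]) simp
    also have "\<dots> = (\<Sum>i\<in>{1..n}. if i = k then c i else 0)"
      using that eigfun_normalized eigfun_orthogonal by (intro sum.cong) auto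
    finally show ?thesis using that by simp
  qed
  have ss: "L2_inner s s = (\<Sum>k\<in>{1..n}. (c k)\<^sup>2)"
  proof -
    have "L2_inner s s = (\<Sum>k\<in>{1..n}. c k * L2_inner (eigfun k) s)"
      unfolding s_eq by (rule L2_inner_sum_eigfun) (use sL2 s_eq in auto)
    then show ?thesis by (simp add: es power2_eq_square)
  qed
  have close: "L2_inner (\<lambda>x. 1 * f x + (-1) * s x) (\<lambda>x. 1 * f x + (-1) * s x) \<le> e"
    unfolding L2_inner_eq
  proof (rule unit.integral_le_const)
    have "(\<lambda>x. 1 * f x + (-1) * s x) \<in> L2_space" by (intro L2_space_lincomb f sL2)
    then show "integrable \<mu> (\<lambda>x. (1 * f x + (-1) * s x) * (1 * f x + (-1) * s x))"
      unfolding L2_space_iff by (intro square_integrable_times)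
    show "AE x in \<mu>. (1 * f x + (-1) * s x) * (1 * f x + (-1) * s x) \<le> e"
      using f(2) AE_space
    proof eventually_elim
      case (elim x)
      then have "\<bar>f x - s x\<bar> \<le> sqrt e" using s(2)[of x] by (simp add: space_unit)
      then have "\<bar>f x - s x\<bar>\<^sup>2 \<le> (sqrt e)\<^sup>2" by (intro power_mono) auto
      then show ?case using e by (simp add: power2_eq_square)
    qed
  qed
  \<comment> \<open>Completing squares replaces the coefficients \<open>c k\<close> of \<open>s\<close> by the Fourier coefficients.\<close>
  have "0 \<le> (\<Sum>k\<in>{1..n}. (?a k - c k)\<^sup>2)" by (intro sum_nonneg) simp
  also have "\<dots> = (\<Sum>k\<in>{1..n}. (?a k)\<^sup>2) - 2 * L2_inner f s + L2_inner s s"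
    unfolding fs ss by (simp add: power2_diff sum.distrib sum_subtractf sum_distrib_left mult_ac)
  finally have "L2_inner f f \<le> e + (\<Sum>k\<in>{1..n}. (?a k)\<^sup>2)"
    using close L2_inner_square_lincomb[OF f(1) sL2, of 1 "-1"] by simp
  also have "(\<Sum>k\<in>{1..n}. (?a k)\<^sup>2) = (\<Sum>k<n. (?a (Suc k))\<^sup>2)"
    by (rule sum.reindex_bij_witness[of _ Suc "\<lambda>k. k - 1"]) auto
  finally have "ennreal (L2_inner f f) \<le> ennreal (e + (\<Sum>k<n. (?a (Suc k))\<^sup>2))" by (rule ennreal_leI)
  also have "\<dots> = (\<Sum>k<n. ennreal ((?a (Suc k))\<^sup>2)) + ennreal e"
    using e by (subst ennreal_plus) (auto intro!: sum_nonneg simp: sum_ennreal add.commute)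
  also have "\<dots> \<le> (\<Sum>k. ennreal ((?a (Suc k))\<^sup>2)) + ennreal e"
    by (intro add_right_mono sum_le_suminf) auto
  finally show "ennreal (L2_inner f f) \<le> (\<Sum>k. ennreal ((?a (Suc k))\<^sup>2)) + ennreal e" .
qed


section \<open>Second moments of the regularized noise\<close>

(* From here on functions are measurable on the whole line; the rule would send the prover
   looking for maps from the line into the unit interval. *)
declare measurable_ident_unit [measurable del]

context white_noise
begin

lemma noise_moments:
  assumes S: "S \<in> sets borel" "S \<subseteq> {0..T} \<times> D" and v: "measure lborel S = v" "v > 0"
  shows "integrable P (W S)" "integrable P (\<lambda>\<omega>. (W S \<omega>)\<^sup>2)" "expectation (W S) = 0"
    and "expectation (\<lambda>\<omega>. (W S \<omega>)\<^sup>2) = v"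
proof -
  have dist: "distributed P lborel (W S) (normal_density 0 (sqrt v))"
    using normal[OF S] v by (simp add: centered_normal_def)
  have s: "0 < sqrt v" using v by simp
  show int: "integrable P (W S)"
    using distributed_integrable[OF dist, of "\<lambda>x. x"] integrable_normal_moment_nz_1[OF s, of 0] by simp
  show "integrable P (\<lambda>\<omega>. (W S \<omega>)\<^sup>2)"
    using distributed_integrable[OF dist, of "\<lambda>x. x\<^sup>2"] integrable_normal_moment[OF s, of 0 2] by simp
  show e: "expectation (W S) = 0" by (rule normal_distributed_expectation[OF s dist])
  show "expectation (\<lambda>\<omega>. (W S \<omega>)\<^sup>2) = v"
    using normal_distributed_variance[OF s dist] v by (simp add: e)
qed

text \<open>Independence and vanishing means make the cells orthogonal.\<close>

lemma second_moment_disjoint: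
  assumes I: "finite I" and v: "v > 0"
    and S: "\<And>i. i \<in> I \<Longrightarrow> S i \<in> sets borel" "\<And>i. i \<in> I \<Longrightarrow> S i \<subseteq> {0..T} \<times> D"
    and meas: "\<And>i. i \<in> I \<Longrightarrow> measure lborel (S i) = v"
    and disj: "\<And>i j. i \<in> I \<Longrightarrow> j \<in> I \<Longrightarrow> i \<noteq> j \<Longrightarrow> S i \<inter> S j = {}"
  shows "integrable P (\<lambda>\<omega>. (\<Sum>i\<in>I. a i * W (S i) \<omega>)\<^sup>2)"
    and "expectation (\<lambda>\<omega>. (\<Sum>i\<in>I. a i * W (S i) \<omega>)\<^sup>2) = v * (\<Sum>i\<in>I. (a i)\<^sup>2)"
proof -
  note m = noise_moments[OF S meas v]
  have pair: "integrable P (\<lambda>\<omega>. W (S i) \<omega> * W (S j) \<omega>)"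
    "expectation (\<lambda>\<omega>. W (S i) \<omega> * W (S j) \<omega>) = (if i = j then v else 0)" if "i \<in> I" "j \<in> I" for i j
  proof -
    have "integrable P (\<lambda>\<omega>. W (S i) \<omega> * W (S j) \<omega>) \<and>
      expectation (\<lambda>\<omega>. W (S i) \<omega> * W (S j) \<omega>) = (if i = j then v else 0)"
    proof (cases "i = j")
      case True
      then show ?thesis using m(2,4)[OF that(1) that(1) that(1)] by (simp add: power2_eq_square)
    next
      case False
      have ind: "indep_var borel (W (S i)) borel (W (S j))"
        using that False by (intro indep S disj)
      show ?thesis
        using indep_var_lebesgue_integral[OF ind m(1)[OF that(1) that(1) that(1)] m(1)[OF that(2) that(2) that(2)]]
          indep_var_integrable[OF ind m(1)[OF that(1) that(1) that(1)] m(1)[OF that(2) that(2) that(2)]]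
          m(3)[OF that(1) that(1) that(1)] False by simp
    qed
    then show "integrable P (\<lambda>\<omega>. W (S i) \<omega> * W (S j) \<omega>)"
      "expectation (\<lambda>\<omega>. W (S i) \<omega> * W (S j) \<omega>) = (if i = j then v else 0)" by simp_all
  qed
  have sq: "(\<Sum>i\<in>I. a i * W (S i) \<omega>)\<^sup>2 = (\<Sum>i\<in>I. \<Sum>j\<in>I. a i * a j * (W (S i) \<omega> * W (S j) \<omega>))" for \<omega>
    by (simp add: power2_eq_square sum_product mult_ac)
  show "integrable P (\<lambda>\<omega>. (\<Sum>i\<in>I. a i * W (S i) \<omega>)\<^sup>2)"
    unfolding sq by (intro Bochner_Integration.integrable_sum integrable_mult_right pair)
  have "expectation (\<lambda>\<omega>. (\<Sum>i\<in>I. a i * W (S i) \<omega>)\<^sup>2) = (\<Sum>i\<in>I. \<Sum>j\<in>I. a i * a j * expectation (\<lambda>\<omega>. W (S i) \<omega> * W (S j) \<omega>))"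
    unfolding sq
    by (subst Bochner_Integration.integral_sum, intro Bochner_Integration.integrable_sum integrable_mult_right pair, assumption+,
        intro sum.cong refl, subst Bochner_Integration.integral_sum, intro integrable_mult_right pair, assumption+,
        intro sum.cong refl integral_mult_right_zero)
  also have "\<dots> = (\<Sum>i\<in>I. \<Sum>j\<in>I. if i = j then v * (a i)\<^sup>2 else 0)"
    by (intro sum.cong refl) (auto simp: pair power2_eq_square)
  also have "\<dots> = v * (\<Sum>i\<in>I. (a i)\<^sup>2)" using I by (simp add: sum_distrib_left)
  finally show "expectation (\<lambda>\<omega>. (\<Sum>i\<in>I. a i * W (S i) \<omega>)\<^sup>2) = v * (\<Sum>i\<in>I. (a i)\<^sup>2)" .
qed

end

subsection \<open>Grid cells\<close>

definition grid_interval :: "real \<Rightarrow> nat \<Rightarrow> real set" where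
  "grid_interval d n = {(real n - 1) * d<..<real n * d}"

lemma cell_eq: "cell T N J n j = grid_interval (T / N) n \<times> grid_interval (1 / J) j"
  by (simp add: cell_def grid_interval_def)

lemma grid_interval_measurable [measurable]: "grid_interval d n \<in> sets borel"
  by (simp add: grid_interval_def)

lemma grid_interval_disjoint:
  assumes "d > 0" "n \<noteq> n'" shows "grid_interval d n \<inter> grid_interval d n' = {}"
proof -
  have *: "grid_interval d n \<inter> grid_interval d n' = {}" if "n < n'" for n n'
  proof -
    have "real n * d \<le> (real n' - 1) * d" using that \<open>d > 0\<close> by (intro mult_right_mono) auto
    then show ?thesis by (auto simp: grid_interval_def)
  qed
  from assms(2) consider "n < n'" | "n' < n" by linarith
  then show ?thesis using *[of n n'] *[of n' n] by cases (simp_all add: Int_commute)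
qed

lemma emeasure_grid_interval: "d \<ge> 0 \<Longrightarrow> emeasure lborel (grid_interval d n) = ennreal d"
  unfolding grid_interval_def by (subst emeasure_lborel_Ioo) (auto simp: algebra_simps)

lemma grid_interval_subset:
  assumes "d \<ge> 0" "n \<in> {1..N}" shows "grid_interval d n \<subseteq> {0<..<real N * d}"
proof
  fix s assume s: "s \<in> grid_interval d n"
  have "0 \<le> (real n - 1) * d" using assms by auto
  moreover have "real n * d \<le> real N * d" using assms by (intro mult_right_mono) auto
  ultimately show "s \<in> {0<..<real N * d}" using s by (auto simp: grid_interval_def)
qed

lemma cell_properties:
  assumes T: "T > 0" and N: "N \<ge> 1" and J: "J \<ge> 1"
  shows "cell T N J n j \<in> sets borel"
    and "measure lborel (cell T N J n j) = T / N * (1 / J)"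
    and "n \<in> {1..N} \<Longrightarrow> j \<in> {1..J} \<Longrightarrow> cell T N J n j \<subseteq> {0..T} \<times> D"
    and "(n, j) \<noteq> (n', j') \<Longrightarrow> cell T N J n j \<inter> cell T N J n' j' = {}"
proof -
  have t: "T / N > 0" "1 / real J > 0" using assms by auto
  show "cell T N J n j \<in> sets borel" unfolding cell_def by (intro borel_open open_Times) auto
  have "emeasure (lborel \<Otimes>\<^sub>M lborel) (grid_interval (T / N) n \<times> grid_interval (1 / J) j)
      = ennreal (T / N) * ennreal (1 / J)"
    using t by (subst lborel.emeasure_pair_measure_Times) (auto simp: emeasure_grid_interval)
  also have "\<dots> = ennreal (T / N * (1 / J))" using t by (intro ennreal_mult[symmetric]) auto
  finally have E: "emeasure lborel (grid_interval (T / N) n \<times> grid_interval (1 / J) j) = ennreal (T / N * (1 / J))"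
    unfolding lborel_prod .
  have "0 \<le> T / N * (1 / J)" using t by (intro mult_nonneg_nonneg) auto
  then show "measure lborel (cell T N J n j) = T / N * (1 / J)"
    unfolding cell_eq measure_def E by (rule enn2real_ennreal)
  show "cell T N J n j \<subseteq> {0..T} \<times> D" if "n \<in> {1..N}" "j \<in> {1..J}"
    unfolding cell_eq
    using grid_interval_subset[of "T / N" n N] grid_interval_subset[of "1 / J" j J] that t assms
    by (auto simp: subset_iff)
  show "cell T N J n j \<inter> cell T N J n' j' = {}" if "(n, j) \<noteq> (n', j')"
    using that grid_interval_disjoint[OF t(1), of n n'] grid_interval_disjoint[OF t(2), of j j']
    unfolding cell_eq by (auto simp: Times_Int_Times)
qed

lemma square_integrable_indicator_times:
  assumes "square_integrable M f" "A \<in> sets M" shows "square_integrable M (\<lambda>x. indicator A x * f x)"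
proof -
  have "integrable M (\<lambda>x. indicator A x *\<^sub>R (f x)\<^sup>2)"
    using assms by (intro integrable_mult_indicator) (auto simp: square_integrable_def)
  moreover have "(\<lambda>x. (indicator A x * f x)\<^sup>2) = (\<lambda>x. indicator A x *\<^sub>R (f x)\<^sup>2)"
    by (auto simp: indicator_def)
  ultimately show ?thesis using assms by (auto simp: square_integrable_def)
qed

text \<open>The Bessel inequality for the projection onto functions that are constant on the cells, by the
Cauchy-Schwarz inequality on each cell.\<close>

lemma sum_cell_integrals_square_le:
  assumes f: "square_integrable M f" and I: "finite I"
    and A: "\<And>i. i \<in> I \<Longrightarrow> A i \<in> sets M" "\<And>i. i \<in> I \<Longrightarrow> emeasure M (A i) \<le> ennreal d" and d: "d \<ge> 0"
    and disj: "\<And>i j. i \<in> I \<Longrightarrow> j \<in> I \<Longrightarrow> i \<noteq> j \<Longrightarrow> A i \<inter> A j = {}"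
  shows "(\<Sum>i\<in>I. (\<integral>x. indicator (A i) x * f x \<partial>M)\<^sup>2) \<le> d * (\<integral>x. (f x)\<^sup>2 \<partial>M)"
proof -
  have fin: "emeasure M (A i) < \<infinity>" if "i \<in> I" for i
    using le_less_trans[OF A(2)[OF that] ennreal_less_top] by simp
  have int: "integrable M (\<lambda>x. indicator (A i) x * (f x)\<^sup>2)" if "i \<in> I" for i
    using integrable_mult_indicator[OF A(1)[OF that], of "\<lambda>x. (f x)\<^sup>2"] f by (simp add: square_integrable_def)
  have one: "(\<integral>x. indicator (A i) x * f x \<partial>M)\<^sup>2 \<le> d * (\<integral>x. indicator (A i) x * (f x)\<^sup>2 \<partial>M)" if i: "i \<in> I" for i
  proof -
    have sq: "square_integrable M (indicator (A i))"
      using A(1)[OF i] fin[OF i] by (auto simp: square_integrable_def power2_eq_square indicator_inter_arith[symmetric])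
    have "(\<integral>x. indicator (A i) x * (indicator (A i) x * f x) \<partial>M)\<^sup>2
        \<le> (\<integral>x. (indicator (A i) x)\<^sup>2 \<partial>M) * (\<integral>x. (indicator (A i) x * f x)\<^sup>2 \<partial>M)"
      by (intro Cauchy_Schwarz_integral sq square_integrable_indicator_times f A i)
    also have "(\<lambda>x. indicator (A i) x * (indicator (A i) x * f x)) = (\<lambda>x. indicator (A i) x * f x)"
      by (auto simp: indicator_def)
    also have "(\<lambda>x. (indicator (A i) x * f x)\<^sup>2) = (\<lambda>x. indicator (A i) x * (f x)\<^sup>2)"
      by (auto simp: indicator_def)
    also have "(\<lambda>x. (indicator (A i) x :: real)\<^sup>2) = indicator (A i)"
      by (auto simp: indicator_def)
    also have "(\<integral>x. indicator (A i) x \<partial>M) = measure M (A i)"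
      using A(1)[OF i] fin[OF i] by simp
    also have "measure M (A i) * (\<integral>x. indicator (A i) x * (f x)\<^sup>2 \<partial>M) \<le> d * (\<integral>x. indicator (A i) x * (f x)\<^sup>2 \<partial>M)"
    proof (rule mult_right_mono)
      show "measure M (A i) \<le> d" unfolding measure_def using enn2real_mono[OF A(2)[OF i]] d by simp
    qed simp
    finally show ?thesis .
  qed
  have "(\<Sum>i\<in>I. (\<integral>x. indicator (A i) x * f x \<partial>M)\<^sup>2) \<le> (\<Sum>i\<in>I. d * (\<integral>x. indicator (A i) x * (f x)\<^sup>2 \<partial>M))"
    by (intro sum_mono one)
  also have "\<dots> = d * (\<integral>x. (\<Sum>i\<in>I. indicator (A i) x * (f x)\<^sup>2) \<partial>M)"
    by (simp add: sum_distrib_left int Bochner_Integration.integral_sum)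
  also have "\<dots> \<le> d * (\<integral>x. (f x)\<^sup>2 \<partial>M)"
  proof (intro mult_left_mono integral_mono d)
    show "integrable M (\<lambda>x. \<Sum>i\<in>I. indicator (A i) x * (f x)\<^sup>2)" by (intro Bochner_Integration.integrable_sum int)
    show "integrable M (\<lambda>x. (f x)\<^sup>2)" using f by (simp add: square_integrable_def)
    fix x
    have "(\<Sum>i\<in>I. indicator (A i) x :: real) \<le> 1"
    proof (cases "\<exists>i\<in>I. x \<in> A i")
      case True
      then obtain k where k: "k \<in> I" "x \<in> A k" by blast
      then have "(\<Sum>i\<in>I. indicator (A i) x :: real) = (\<Sum>i\<in>I. if i = k then 1 else 0)"
        using disj by (intro sum.cong) (auto simp: indicator_def)
      then show ?thesis using I k by simp
    next
      case False
      then show ?thesis by (simp add: indicator_def)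
    qed
    then show "(\<Sum>i\<in>I. indicator (A i) x * (f x)\<^sup>2) \<le> (f x)\<^sup>2"
      unfolding sum_distrib_right[symmetric] by (intro mult_left_le_one_le sum_nonneg) auto
  qed
  finally show ?thesis .
qed

lemma sum_indicator_disjoint_square:
  fixes b :: "'i \<Rightarrow> real"
  assumes "finite I" "\<And>i j. i \<in> I \<Longrightarrow> j \<in> I \<Longrightarrow> i \<noteq> j \<Longrightarrow> A i \<inter> A j = {}"
  shows "(\<Sum>i\<in>I. indicator (A i) s * b i)\<^sup>2 = (\<Sum>i\<in>I. indicator (A i) s * (b i)\<^sup>2)"
proof (cases "\<exists>k\<in>I. s \<in> A k")
  case True
  then obtain k where k: "k \<in> I" "s \<in> A k" by blast
  have *: "(\<Sum>i\<in>I. indicator (A i) s * g i) = g k" for g :: "'i \<Rightarrow> real"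
  proof -
    have "(\<Sum>i\<in>I. indicator (A i) s * g i) = (\<Sum>i\<in>I. if i = k then g i else 0)"
      using k assms(2) by (intro sum.cong) (auto simp: indicator_def)
    then show ?thesis using assms(1) k by simp
  qed
  show ?thesis by (simp add: *)
next
  case False
  then show ?thesis by (simp add: indicator_def)
qed

section \<open>The error functional on the grid\<close>

lemma square_integrable_sum:
  assumes "finite I" "\<And>i. i \<in> I \<Longrightarrow> square_integrable M (f i)"
  shows "square_integrable M (\<lambda>x. \<Sum>i\<in>I. f i x)"
  using assms
proof (induction I rule: finite_induct)
  case (insert i I)
  then show ?case using square_integrable_lincomb[of M "f i" "\<lambda>x. \<Sum>i\<in>I. f i x" 1 1] by simp
qed (simp add: square_integrable_def)

lemma set_integrable_indicator_continuous:
  fixes k :: "real \<Rightarrow> real"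
  assumes "continuous_on UNIV k" "A \<in> sets borel"
  shows "set_integrable lborel {a<..<b} (\<lambda>s. indicator A s * k s)"
proof -
  have "set_integrable lborel {a<..<b} k"
    by (rule set_integrable_subset[of _ "{a..b}"])
      (auto intro!: borel_integrable_atLeastAtMost' continuous_on_subset[OF assms(1)])
  then have "integrable lborel (\<lambda>s. indicator A s *\<^sub>R (indicator {a<..<b} s *\<^sub>R k s))"
    unfolding set_integrable_def by (rule integrable_mult_indicator[rotated]) (simp add: assms(2))
  moreover have "(\<lambda>s. indicator A s *\<^sub>R (indicator {a<..<b} s *\<^sub>R k s)) = (\<lambda>s. indicator {a<..<b} s *\<^sub>R (indicator A s * k s))"
    by (auto simp: indicator_def)
  ultimately show ?thesis unfolding set_integrable_def by (simp only:)
qed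

context dual_scheme
begin

lemma slot_disjoint:
  assumes "i < m" "j < m" "i \<noteq> j" shows "slot m i \<inter> slot m j = {}"
proof -
  have "slot m i = grid_interval \<tau> (m - i)" if "i < m" for i
  proof -
    have "real (m - i - 1) = real (m - i) - 1" using that by (simp add: of_nat_diff)
    then show ?thesis by (simp only: slot_def grid_interval_def)
  qed
  then show ?thesis using assms grid_interval_disjoint[OF tau, of "m - i" "m - j"] by simp
qed

text \<open>The pairing in space of the defect with a cell.\<close>

definition weight :: "real set \<Rightarrow> nat \<Rightarrow> nat \<Rightarrow> real \<Rightarrow> real" where
  "weight B m i s = L2_inner (indicator B) (defect i (real m * \<tau> - s))"

lemma indicator_L2: "B \<in> sets borel \<Longrightarrow> indicator B \<in> L2_space"
  by (rule L2_space_bounded[where B=1]) (auto intro: borel_measurable_unit)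

lemma L2_inner_defect:
  assumes "v \<in> L2_space"
  shows "L2_inner v (defect i t) = L2_inner v (dual_step i) - rho t * L2_inner v ef"
  unfolding defect_def[abs_def]
  using L2_inner_diff(2)[OF H01_space_L2[OF dual_step_H01] L2_space_scale[OF eigfun_L2] assms]
  by (simp add: L2_inner_scale)

lemma continuous_weight: "B \<in> sets borel \<Longrightarrow> continuous_on UNIV (weight B m i)"
  unfolding weight_def[abs_def] by (simp only: L2_inner_defect indicator_L2 rho_def) (intro continuous_intros)

text \<open>The pairings of the defect with all cells are controlled by its norm: apply the Bessel inequality
for cells in time and then, for each instant, in space. In this order every function that occurs
depends on one variable only.\<close>

lemma sum_cell_functionals_le:
  fixes A B :: "nat \<Rightarrow> real set"
  assumes fin: "finite NN" "finite JJ"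
    and A: "\<And>n. n \<in> NN \<Longrightarrow> A n \<in> sets borel" "\<And>n. n \<in> NN \<Longrightarrow> emeasure lborel (A n) \<le> ennreal a" "a \<ge> 0"
      "\<And>n n'. n \<in> NN \<Longrightarrow> n' \<in> NN \<Longrightarrow> n \<noteq> n' \<Longrightarrow> A n \<inter> A n' = {}"
    and B: "\<And>j. j \<in> JJ \<Longrightarrow> B j \<in> sets borel" "\<And>j. j \<in> JJ \<Longrightarrow> emeasure lborel (B j) \<le> ennreal b" "b \<ge> 0"
      "\<And>j j'. j \<in> JJ \<Longrightarrow> j' \<in> JJ \<Longrightarrow> j \<noteq> j' \<Longrightarrow> B j \<inter> B j' = {}"
    and BD: "\<And>j. j \<in> JJ \<Longrightarrow> B j \<subseteq> D"
  shows "(\<Sum>n\<in>NN. \<Sum>j\<in>JJ. (\<Sum>i<m. LBINT s:slot m i. indicator (A n) s * weight (B j) m i s)\<^sup>2)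
    \<le> a * b * defect_total m"
proof -
  define \<phi> where "\<phi> j s = (\<Sum>i<m. indicator (slot m i) s * weight (B j) m i s)" for j s
  have cont: "continuous_on UNIV (weight (B j) m i)" if "j \<in> JJ" for i j
    using B(1)[OF that] by (rule continuous_weight)
  have cont2: "continuous_on UNIV (\<lambda>s. (weight (B j) m i s)\<^sup>2)" if "j \<in> JJ" for i j
    by (intro continuous_intros cont that)
  have int2: "integrable lborel (\<lambda>s. indicator (slot m i) s * (weight (B j) m i s)\<^sup>2)" if "j \<in> JJ" for i j
    using slot_integrable_continuous[OF cont2[OF that]] unfolding set_integrable_def by simp
  have sq: "square_integrable lborel (\<phi> j)" if j: "j \<in> JJ" for j
    unfolding \<phi>_def[abs_def]
  proof (rule square_integrable_sum)
    fix i
    have [measurable]: "weight (B j) m i \<in> borel_measurable borel"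
      by (rule borel_measurable_continuous_onI[OF cont[OF j]])
    have "(\<lambda>s. indicator (slot m i) s * weight (B j) m i s) \<in> borel_measurable lborel" by measurable
    moreover have "(\<lambda>s. (indicator (slot m i) s * weight (B j) m i s)\<^sup>2) = (\<lambda>s. indicator (slot m i) s * (weight (B j) m i s)\<^sup>2)"
      by (auto simp: indicator_def)
    ultimately show "square_integrable lborel (\<lambda>s. indicator (slot m i) s * weight (B j) m i s)"
      using int2[OF j, of i] by (simp add: square_integrable_def)
  qed simp
  have functional: "(\<Sum>i<m. LBINT s:slot m i. indicator (A n) s * weight (B j) m i s)
      = (\<integral>s. indicator (A n) s * \<phi> j s \<partial>lborel)" if n: "n \<in> NN" and j: "j \<in> JJ" for n j
  proof -
    have "(\<integral>s. indicator (A n) s * \<phi> j s \<partial>lborel)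
        = (\<integral>s. (\<Sum>i<m. indicator (slot m i) s *\<^sub>R (indicator (A n) s * weight (B j) m i s)) \<partial>lborel)"
      unfolding \<phi>_def sum_distrib_left real_scaleR_def by (simp only: mult.left_commute)
    also have "\<dots> = (\<Sum>i<m. \<integral>s. indicator (slot m i) s *\<^sub>R (indicator (A n) s * weight (B j) m i s) \<partial>lborel)"
      using set_integrable_indicator_continuous[OF cont[OF j] A(1)[OF n]]
      by (intro Bochner_Integration.integral_sum) (simp add: slot_def set_integrable_def)
    finally show ?thesis by (simp add: set_lebesgue_integral_def)
  qed
  have space: "(\<Sum>j\<in>JJ. (weight (B j) m i s)\<^sup>2) \<le> b * L2_inner (defect i (real m * \<tau> - s)) (defect i (real m * \<tau> - s))" for i s
  proof -
    let ?V = "defect i (real m * \<tau> - s)"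
    have "(\<Sum>j\<in>JJ. (\<integral>x. indicator (B j) x * ?V x \<partial>\<mu>)\<^sup>2) \<le> b * (\<integral>x. (?V x)\<^sup>2 \<partial>\<mu>)"
    proof (rule sum_cell_integrals_square_le[OF _ fin(2)])
      show "square_integrable \<mu> ?V" using defect_L2 by (simp add: L2_space_iff)
      fix j assume j: "j \<in> JJ"
      have "B j = D \<inter> B j" using BD[OF j] by auto
      then show "B j \<in> sets \<mu>" using B(1)[OF j] by (auto simp: sets_unit sets_restrict_space)
      then show "emeasure \<mu> (B j) \<le> ennreal b"
        unfolding unit_measure_def using BD[OF j] B(2)[OF j] by (simp add: emeasure_restrict_space)
    qed (use B in auto)
    then show ?thesis by (simp add: weight_def L2_inner_eq power2_eq_square)
  qed
  have time: "(\<integral>s. (\<phi> j s)\<^sup>2 \<partial>lborel) = (\<Sum>i<m. LBINT s:slot m i. (weight (B j) m i s)\<^sup>2)" if j: "j \<in> JJ" for j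
  proof -
    have eq: "(\<phi> j s)\<^sup>2 = (\<Sum>i<m. indicator (slot m i) s * (weight (B j) m i s)\<^sup>2)" for s
      unfolding \<phi>_def
    proof (rule sum_indicator_disjoint_square)
      fix i k assume "i \<in> {..<m}" "k \<in> {..<m}" "i \<noteq> k"
      then show "slot m i \<inter> slot m k = {}" by (intro slot_disjoint) simp_all
    qed simp
    show ?thesis
      by (simp only: eq Bochner_Integration.integral_sum int2[OF j] set_lebesgue_integral_def real_scaleR_def)
  qed
  have "(\<Sum>n\<in>NN. \<Sum>j\<in>JJ. (\<Sum>i<m. LBINT s:slot m i. indicator (A n) s * weight (B j) m i s)\<^sup>2)
      = (\<Sum>j\<in>JJ. \<Sum>n\<in>NN. (\<integral>s. indicator (A n) s * \<phi> j s \<partial>lborel)\<^sup>2)"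
    by (subst sum.swap) (intro sum.cong refl, simp add: functional)
  also have "\<dots> \<le> (\<Sum>j\<in>JJ. a * (\<integral>s. (\<phi> j s)\<^sup>2 \<partial>lborel))"
    using A by (intro sum_mono sum_cell_integrals_square_le sq fin(1)) auto
  also have "\<dots> = a * (\<Sum>i<m. \<Sum>j\<in>JJ. LBINT s:slot m i. (weight (B j) m i s)\<^sup>2)"
    by (subst sum.swap) (simp add: time sum_distrib_left)
  also have "\<dots> \<le> a * (\<Sum>i<m. b * (LBINT s:slot m i. L2_inner (defect i (real m * \<tau> - s)) (defect i (real m * \<tau> - s))))"
  proof (intro mult_left_mono sum_mono A(3))
    fix i
    have "(\<Sum>j\<in>JJ. LBINT s:slot m i. (weight (B j) m i s)\<^sup>2) = (LBINT s:slot m i. \<Sum>j\<in>JJ. (weight (B j) m i s)\<^sup>2)"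
      by (simp only: set_lebesgue_integral_def real_scaleR_def sum_distrib_left Bochner_Integration.integral_sum int2)
    also have "\<dots> \<le> (LBINT s:slot m i. b * L2_inner (defect i (real m * \<tau> - s)) (defect i (real m * \<tau> - s)))"
      by (intro set_integral_mono slot_integrable_continuous space continuous_on_sum cont2
          continuous_on_mult continuous_on_const continuous_defect_norm)
    also have "\<dots> = b * (LBINT s:slot m i. L2_inner (defect i (real m * \<tau> - s)) (defect i (real m * \<tau> - s)))"
      by (rule set_integral_mult_right)
    finally show "(\<Sum>j\<in>JJ. LBINT s:slot m i. (weight (B j) m i s)\<^sup>2)
        \<le> b * (LBINT s:slot m i. L2_inner (defect i (real m * \<tau> - s)) (defect i (real m * \<tau> - s)))" .
  qed
  also have "\<dots> = a * b * defect_total m"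
    by (simp only: defect_total_def sum_distrib_left mult.assoc)
  finally show ?thesis .
qed

text \<open>Summation by parts in time. With \<open>b u v = (u, v) + \<tau>/2 energy u v\<close> and \<open>c u v = (u, v) - \<tau>/2 energy u v\<close>,
the scheme reads \<open>b (U (l + 1)) v = c (U l) v + F (l + 1) v\<close> and the dual scheme reads
\<open>b (Y (p + 1)) v = c (Y p) v\<close>. As both forms are symmetric, each step down in \<open>U\<close> becomes a step up in \<open>Y\<close>.\<close>

lemma duality:
  assumes cn: "crank_nicolson T M Z f U" and \<tau>: "\<tau> = T / M" and m: "m \<le> M"
  shows "L2_inner (U m) ef = (\<Sum>i<m. LBINT s:slot m i. L2_inner (f s) (dual_step i))"
proof -
  have UZ: "U l \<in> Z" if "l \<le> M" for l using cn that by (auto simp: crank_nicolson_def)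
  have UH: "U l \<in> H01_space" if "l \<le> M" for l by (rule fe_space_H01[OF fe UZ[OF that]])
  define F where "F l v = (LBINT s:{real (l - 1) * \<tau><..<real l * \<tau>}. L2_inner (f s) v)" for l v
  have step: "L2_inner (U (Suc l)) v + \<tau> / 2 * energy (U (Suc l)) v
      = L2_inner (U l) v - \<tau> / 2 * energy (U l) v + F (Suc l) v" if l: "Suc l \<le> M" and v: "v \<in> Z" for l v
  proof -
    have vH: "v \<in> H01_space" by (rule fe_space_H01[OF fe v])
    have lM: "l \<le> M" using l by simp
    have "Suc l \<in> {1..M}" using l by simp
    then have "L2_inner (\<lambda>x. U (Suc l) x - U l x) v + \<tau> / 2 * energy (\<lambda>x. U (Suc l) x + U l x) v = F (Suc l) v"
      using cn v unfolding crank_nicolson_def energy_def F_def \<tau> by fastforce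
    moreover have "L2_inner (\<lambda>x. U (Suc l) x - U l x) v = L2_inner (U (Suc l)) v - L2_inner (U l) v"
      by (rule L2_inner_diff(1)[OF H01_space_L2[OF UH[OF l]] H01_space_L2[OF UH[OF lM]] H01_space_L2[OF vH]])
    moreover have "energy (\<lambda>x. U (Suc l) x + U l x) v = energy (U (Suc l)) v + energy (U l) v"
      using energy_lincomb[OF UH[OF l] UH[OF lM] vH, of 1 1] by simp
    ultimately show ?thesis by (simp add: algebra_simps add_divide_distrib)
  qed
  have U0: "L2_inner (U 0) v = 0" "energy (U 0) v = 0" if v: "v \<in> Z" for v
  proof -
    have vH: "v \<in> H01_space" by (rule fe_space_H01[OF fe v])
    have ae: "AE x in \<mu>. U 0 x = 0"
      using AE_space by eventually_elim (use cn in \<open>auto simp: crank_nicolson_def space_unit\<close>)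
    have U0H: "U 0 \<in> H01_space" by (rule UH) simp
    show "energy (U 0) v = 0" by (rule energy_AE_zero[OF ae U0H vH])
    show "L2_inner (U 0) v = 0" by (rule L2_inner_AE_zero[OF ae H01_space_L2[OF U0H] H01_space_L2[OF vH]])
  qed
  have telescope: "p \<le> m \<Longrightarrow> L2_inner (U m) ef
      = L2_inner (U (m - p)) (dual_step p) + \<tau> / 2 * energy (U (m - p)) (dual_step p)
        + (\<Sum>i<p. F (m - i) (dual_step i))" for p
  proof (induction p)
    case 0
    show ?case
      using dual_step_0[OF UZ[OF m]] by (simp add: L2_inner_commute energy_commute)
  next
    case (Suc p)
    then obtain l where l: "m - p = Suc l" by (metis Suc_diff_Suc Suc_le_lessD)
    then have lM: "Suc l \<le> M" using m by linarith
    have ml: "m - Suc p = l" using l by simp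
    have lM': "l \<le> M" using lM by simp
    have dual: "L2_inner (U l) (dual_step p) - \<tau> / 2 * energy (U l) (dual_step p)
        = L2_inner (U l) (dual_step (Suc p)) + \<tau> / 2 * energy (U l) (dual_step (Suc p))"
      using dual_step_Suc[OF UZ[OF lM'], of p]
      by (simp only: L2_inner_commute[of "U l"] energy_commute[of "U l"])
    show ?case
      using Suc step[OF lM dual_step_mem, of p] dual unfolding l ml by (simp add: l)
  qed
  have "L2_inner (U m) ef = (\<Sum>i<m. F (m - i) (dual_step i))"
    using telescope[of m] U0[OF dual_step_mem] by simp
  then show ?thesis by (simp add: F_def slot_def)
qed

text \<open>The time steps partition the time interval up to finitely many points.\<close>

lemma slots_cover:
  fixes g :: "real \<Rightarrow> real"
  assumes g: "set_integrable lborel {0<..<real m * \<tau>} g"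
  shows "(LBINT s:{0<..<real m * \<tau>}. g s) = (\<Sum>i<m. LBINT s:slot m i. g s)"
proof -
  have "k \<le> m \<Longrightarrow> (LBINT s:{0<..<real k * \<tau>}. g s) = (\<Sum>l<k. LBINT s:{real l * \<tau><..<real (Suc l) * \<tau>}. g s)" for k
  proof (induction k)
    case 0
    then show ?case by (simp add: set_lebesgue_integral_def)
  next
    case (Suc k)
    let ?A = "{0<..<real k * \<tau>}" and ?B = "{real k * \<tau><..<real (Suc k) * \<tau>}" and ?C = "{0<..<real (Suc k) * \<tau>}"
    have le: "real (Suc k) * \<tau> \<le> real m * \<tau>" "real k * \<tau> \<le> real (Suc k) * \<tau>" "0 \<le> real k * \<tau>"
      using Suc.prems tau by (auto intro!: mult_right_mono)
    have int: "set_integrable lborel ?A g" "set_integrable lborel ?B g" "set_integrable lborel ?C g"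
      by (rule set_integrable_subset[OF g]; use le in auto)+
    have "(LBINT s:?C. g s) = (\<integral>s. indicator ?A s *\<^sub>R g s + indicator ?B s *\<^sub>R g s \<partial>lborel)"
      unfolding set_lebesgue_integral_def
    proof (rule integral_cong_AE)
      show "AE s in lborel. indicator ?C s *\<^sub>R g s = indicator ?A s *\<^sub>R g s + indicator ?B s *\<^sub>R g s"
        using AE_lborel_singleton[of "real k * \<tau>"] by eventually_elim (use le in \<open>auto simp: indicator_def\<close>)
    qed (use int in \<open>auto simp: set_integrable_def\<close>)
    also have "\<dots> = (LBINT s:?A. g s) + (LBINT s:?B. g s)"
      using int unfolding set_integrable_def set_lebesgue_integral_def by (intro Bochner_Integration.integral_add) auto
    finally show ?case using Suc by simp
  qed
  from this[of m] have "(LBINT s:{0<..<real m * \<tau>}. g s) = (\<Sum>l<m. LBINT s:{real l * \<tau><..<real (Suc l) * \<tau>}. g s)" by simp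
  also have "\<dots> = (\<Sum>i<m. LBINT s:{real (m - Suc i) * \<tau><..<real (Suc (m - Suc i)) * \<tau>}. g s)"
    by (rule sum.nat_diff_reindex[symmetric])
  also have "\<dots> = (\<Sum>i<m. LBINT s:slot m i. g s)"
    by (intro sum.cong refl) (simp add: slot_def Suc_diff_Suc)
  finally show ?thesis .
qed

end

section \<open>The sine series of the regularized solution\<close>

lemma eigval_Suc_square: "(eigval (Suc k))\<^sup>2 = pi\<^sup>2 * (real (Suc k))\<^sup>2"
  by (simp add: eigval_def power_mult_distrib)

lemma summable_inverse_eigval_square: "summable (\<lambda>k. 1 / (eigval (Suc k))\<^sup>2)"
proof -
  have "summable (\<lambda>k. inverse ((real (Suc k))\<^sup>2))"
    using inverse_power_summable[of 2, where 'a=real] by (subst summable_Suc_iff) simp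
  then have "summable (\<lambda>k. (1 / pi\<^sup>2) * inverse ((real (Suc k))\<^sup>2))" by (rule summable_mult)
  then show ?thesis unfolding eigval_Suc_square by (simp add: field_simps)
qed

lemma eigval_Suc_pos: "(eigval (Suc k))\<^sup>2 > 0"
  using eigval_pos[of "Suc k"] by simp

lemma exp_neg_le_inverse: "x > 0 \<Longrightarrow> exp (- x) \<le> 1 / x" for x :: real
proof -
  assume x: "x > 0"
  have "x \<le> exp x" using exp_ge_add_one_self[of x] by linarith
  then show ?thesis using x by (simp add: exp_minus field_simps)
qed

lemma exp_eigval_le:
  assumes "t > 0" shows "exp (- (eigval (Suc k))\<^sup>2 * t) \<le> 1 / ((eigval (Suc k))\<^sup>2 * t)"
  using exp_neg_le_inverse[of "(eigval (Suc k))\<^sup>2 * t"] eigval_Suc_pos[of k] assms by simp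

lemma eigfun_mult_bound: "\<bar>eigfun k x * eigfun l y\<bar> \<le> 2"
proof -
  have "\<bar>eigfun k x\<bar> * \<bar>eigfun l y\<bar> \<le> sqrt 2 * sqrt 2" by (intro mult_mono eigfun_bound) auto
  then show ?thesis by (simp add: abs_mult)
qed

text \<open>For positive time the series of the kernel converges absolutely and uniformly, so it may be integrated
term by term.\<close>

lemma integral_heat_kernel:
  assumes f: "f \<in> borel_measurable \<mu>" "\<And>y. \<bar>f y\<bar> \<le> B" and t: "t > 0"
  shows "(LBINT y:D. heat_kernel t x y * f y)
    = (\<Sum>k. exp (- (eigval (Suc k))\<^sup>2 * t) * eigfun (Suc k) x * L2_inner f (eigfun (Suc k)))"
proof -
  have B0: "B \<ge> 0" using f(2)[of 0] by simp
  have fL2: "f \<in> L2_space" using f by (intro L2_space_bounded)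
  let ?g = "\<lambda>k y. exp (- (eigval (Suc k))\<^sup>2 * t) * eigfun (Suc k) x * (f y * eigfun (Suc k) y)"
  let ?b = "\<lambda>k. 1 / (eigval (Suc k))\<^sup>2 * (2 * B / t)"
  have int: "integrable \<mu> (?g k)" for k
    using fL2 eigfun_L2[of "Suc k"] by (intro integrable_mult_right square_integrable_times) (simp_all add: L2_space_iff)
  have bound: "norm (?g k y) \<le> ?b k" for k y
  proof -
    have "norm (?g k y) = exp (- (eigval (Suc k))\<^sup>2 * t) * (\<bar>eigfun (Suc k) x * eigfun (Suc k) y\<bar> * \<bar>f y\<bar>)"
      by (simp add: abs_mult)
    also have "\<dots> \<le> 1 / ((eigval (Suc k))\<^sup>2 * t) * (2 * B)"
      using t by (intro mult_mono exp_eigval_le eigfun_mult_bound f) auto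
    finally show ?thesis by simp
  qed
  have sb: "summable ?b" by (intro summable_mult2 summable_inverse_eigval_square)
  have sn: "summable (\<lambda>k. norm (?g k y))" for y
    by (rule summable_comparison_test[OF _ sb]) (use bound in auto)
  have hk: "heat_kernel t x y * f y = (\<Sum>k. ?g k y)" for y
  proof -
    have s: "summable (\<lambda>k. exp (- (eigval (Suc k))\<^sup>2 * t) * eigfun (Suc k) x * eigfun (Suc k) y)"
    proof (rule summable_comparison_test[OF _ summable_mult2[OF summable_inverse_eigval_square, of "2 / t"]], intro exI allI impI)
      fix k
      have "norm (exp (- (eigval (Suc k))\<^sup>2 * t) * eigfun (Suc k) x * eigfun (Suc k) y)
          = exp (- (eigval (Suc k))\<^sup>2 * t) * \<bar>eigfun (Suc k) x * eigfun (Suc k) y\<bar>" by (simp add: abs_mult)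
      also have "\<dots> \<le> 1 / ((eigval (Suc k))\<^sup>2 * t) * 2"
        using t by (intro mult_mono exp_eigval_le eigfun_mult_bound) auto
      finally show "norm (exp (- (eigval (Suc k))\<^sup>2 * t) * eigfun (Suc k) x * eigfun (Suc k) y)
          \<le> 1 / (eigval (Suc k))\<^sup>2 * (2 / t)" by simp
    qed
    show ?thesis unfolding heat_kernel_def by (subst suminf_mult2[OF s]) (simp add: mult_ac)
  qed
  have "(LBINT y:D. heat_kernel t x y * f y) = (\<integral>y. (\<Sum>k. ?g k y) \<partial>\<mu>)"
    by (simp only: set_integral_unit hk)
  also have "\<dots> = (\<Sum>k. \<integral>y. ?g k y \<partial>\<mu>)"
  proof (rule integral_suminf[OF int])
    show "AE y in \<mu>. summable (\<lambda>k. norm (?g k y))" by (intro AE_I2 sn)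
    show "summable (\<lambda>k. \<integral>y. norm (?g k y) \<partial>\<mu>)"
    proof (rule summable_comparison_test[OF _ sb], intro exI allI impI)
      fix k
      have "(\<integral>y. norm (?g k y) \<partial>\<mu>) \<le> ?b k"
        by (intro unit.integral_le_const integrable_norm int AE_I2 bound)
      then show "norm (\<integral>y. norm (?g k y) \<partial>\<mu>) \<le> ?b k" by simp
    qed
  qed
  also have "\<dots> = (\<Sum>k. exp (- (eigval (Suc k))\<^sup>2 * t) * eigfun (Suc k) x * L2_inner f (eigfun (Suc k)))"
    by (simp add: L2_inner_eq)
  finally show ?thesis .
qed

text \<open>Duhamel's formula for the \<open>k\<close>-th sine coefficient of the solution at time \<open>t\<close> with source \<open>f\<close>.\<close>

definition fourier_coeff :: "(real \<Rightarrow> real \<Rightarrow> real) \<Rightarrow> real \<Rightarrow> nat \<Rightarrow> real" where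
  "fourier_coeff f t k = (LBINT s:{0<..<t}. exp (- (eigval k)\<^sup>2 * (t - s)) * L2_inner (f s) (eigfun k))"

lemma exp_integral:
  fixes l t :: real
  assumes "l > 0" "t \<ge> 0"
  shows "set_integrable lborel {0<..<t} (\<lambda>s. exp (- l * (t - s)))"
    and "(LBINT s:{0<..<t}. exp (- l * (t - s))) \<le> 1 / l"
proof -
  have cont: "continuous_on A (\<lambda>s. exp (- l * (t - s)))" for A
    by (intro continuous_on_exp continuous_on_mult continuous_on_diff continuous_on_const continuous_on_id)
  show "set_integrable lborel {0<..<t} (\<lambda>s. exp (- l * (t - s)))"
    by (rule set_integrable_subset[of _ "{0..t}"]) (use borel_integrable_atLeastAtMost'[OF cont] in auto)
  have "(LBINT s:{0<..<t}. exp (- l * (t - s))) = (\<integral>s. exp (- l * (t - s)) * indicator {0..t} s \<partial>lborel)"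
    unfolding set_lebesgue_integral_def
  proof (rule integral_cong_AE)
    show "AE s in lborel. indicator {0<..<t} s *\<^sub>R exp (- l * (t - s)) = exp (- l * (t - s)) * indicator {0..t} s"
      using AE_lborel_singleton[of 0] AE_lborel_singleton[of t] by eventually_elim (auto simp: indicator_def)
  qed simp_all
  also have "\<dots> = exp (- l * (t - t)) / l - exp (- l * (t - 0)) / l"
  proof (rule integral_FTC_Icc_real[OF assms(2)])
    fix s
    show "((\<lambda>s. exp (- l * (t - s)) / l) has_real_derivative exp (- l * (t - s))) (at s)"
      using assms by (auto intro!: derivative_eq_intros)
    show "isCont (\<lambda>s. exp (- l * (t - s))) s" by (intro continuous_intros)
  qed
  also have "\<dots> \<le> 1 / l" using assms by simp
  finally show "(LBINT s:{0<..<t}. exp (- l * (t - s))) \<le> 1 / l" .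
qed

text \<open>The measurability of \<open>f\<close> in time is only required after pairing with a function of space, which is
what Duhamel's formula needs.\<close>

locale bounded_source =
  fixes f :: "real \<Rightarrow> real \<Rightarrow> real" and B :: real
  assumes f_meas: "\<And>s. f s \<in> borel_measurable \<mu>"
    and f_bound: "\<And>s y. \<bar>f s y\<bar> \<le> B"
    and f_inner: "\<And>v. v \<in> L2_space \<Longrightarrow> (\<lambda>s. L2_inner (f s) v) \<in> borel_measurable borel"
begin

lemma B_nonneg: "0 \<le> B" using f_bound[of 0 0] by linarith

lemma f_L2: "f s \<in> L2_space" using f_meas f_bound by (intro L2_space_bounded)

lemma inner_bound: "k \<ge> 1 \<Longrightarrow> \<bar>L2_inner (f s) (eigfun k)\<bar> \<le> B"
proof -
  assume k: "k \<ge> 1"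
  have "L2_inner (f s) (f s) \<le> B\<^sup>2"
    unfolding L2_inner_eq
  proof (rule unit.integral_le_const)
    show "integrable \<mu> (\<lambda>x. f s x * f s x)" using f_L2 by (simp add: L2_space_iff square_integrable_times)
    have "\<bar>f s x\<bar> * \<bar>f s x\<bar> \<le> B * B" for x by (intro mult_mono f_bound) (use B_nonneg in auto)
    then show "AE x in \<mu>. f s x * f s x \<le> B\<^sup>2" by (simp add: power2_eq_square)
  qed
  then have "L2_norm (f s) \<le> B" using B_nonneg by (simp add: L2_norm_def real_le_lsqrt)
  then show ?thesis
    using L2_inner_Cauchy_Schwarz[OF f_L2 eigfun_L2, of s k] eigfun_normalized[OF k] by (simp add: L2_norm_def)
qed

lemma coeff_integrable:
  assumes "t \<ge> 0" "k \<ge> 1"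
  shows "set_integrable lborel {0<..<t} (\<lambda>s. exp (- (eigval k)\<^sup>2 * (t - s)) * L2_inner (f s) (eigfun k))"
    and "\<bar>fourier_coeff f t k\<bar> \<le> B / (eigval k)\<^sup>2"
    and "(LBINT s:{0<..<t}. \<bar>exp (- (eigval k)\<^sup>2 * (t - s)) * L2_inner (f s) (eigfun k)\<bar>) \<le> B / (eigval k)\<^sup>2"
proof -
  let ?h = "\<lambda>s. exp (- (eigval k)\<^sup>2 * (t - s)) * L2_inner (f s) (eigfun k)"
  let ?e = "\<lambda>s. exp (- (eigval k)\<^sup>2 * (t - s)) * B"
  have l: "(eigval k)\<^sup>2 > 0" using eigval_pos[OF assms(2)] by simp
  have [measurable]: "(\<lambda>s. L2_inner (f s) (eigfun k)) \<in> borel_measurable borel" by (rule f_inner[OF eigfun_L2])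
  have ei: "set_integrable lborel {0<..<t} ?e" using exp_integral(1)[OF l assms(1)] by (rule set_integrable_mult_left)
  have le: "\<bar>?h s\<bar> \<le> ?e s" for s
    by (simp add: abs_mult inner_bound[OF assms(2)])
  show hi: "set_integrable lborel {0<..<t} ?h"
  proof (rule set_integrable_bound[OF ei])
    show "set_borel_measurable lborel {0<..<t} ?h" unfolding set_borel_measurable_def by measurable
    have "\<bar>?h s\<bar> \<le> \<bar>?e s\<bar>" for s using le[of s] by linarith
    then show "AE s in lborel. s \<in> {0<..<t} \<longrightarrow> norm (?h s) \<le> norm (?e s)" by simp
  qed
  have "(LBINT s:{0<..<t}. \<bar>?h s\<bar>) \<le> (LBINT s:{0<..<t}. ?e s)"
    by (intro set_integral_mono set_integrable_abs hi ei le)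
  also have "\<dots> = (LBINT s:{0<..<t}. exp (- (eigval k)\<^sup>2 * (t - s))) * B" by (rule set_integral_mult_left)
  also have "\<dots> \<le> 1 / (eigval k)\<^sup>2 * B"
    using exp_integral(2)[OF l assms(1)] B_nonneg by (intro mult_right_mono) auto
  finally show abs: "(LBINT s:{0<..<t}. \<bar>?h s\<bar>) \<le> B / (eigval k)\<^sup>2" by simp
  have "\<bar>fourier_coeff f t k\<bar> \<le> (LBINT s:{0<..<t}. \<bar>?h s\<bar>)"
    unfolding fourier_coeff_def using set_integral_norm_bound[OF hi] by simp
  then show "\<bar>fourier_coeff f t k\<bar> \<le> B / (eigval k)\<^sup>2" using abs by linarith
qed

definition series :: "real \<Rightarrow> real \<Rightarrow> real" where
  "series t x = (\<Sum>k. fourier_coeff f t (Suc k) * eigfun (Suc k) x)"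

lemma coeff_term_bound:
  assumes "t \<ge> 0"
  shows "\<bar>fourier_coeff f t (Suc k) * eigfun (Suc k) x\<bar> \<le> 1 / (eigval (Suc k))\<^sup>2 * (B * sqrt 2)"
proof -
  have "\<bar>fourier_coeff f t (Suc k)\<bar> * \<bar>eigfun (Suc k) x\<bar> \<le> B / (eigval (Suc k))\<^sup>2 * sqrt 2"
    using coeff_integrable(2)[OF assms, of "Suc k"] B_nonneg by (intro mult_mono eigfun_bound) auto
  then show ?thesis by (simp add: abs_mult)
qed

lemma summable_coeff_bound: "summable (\<lambda>k. 1 / (eigval (Suc k))\<^sup>2 * (B * sqrt 2))"
  by (intro summable_mult2 summable_inverse_eigval_square)

text \<open>The time integral of the \<open>k\<close>-th term is of order \<open>1 / k\<^sup>2\<close>, uniformly in \<open>x\<close>. The kernel is singular at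
\<open>s = t\<close>, but the interchange of sum and integral only needs these integrals to be summable.\<close>

lemma solution_eq_series:
  assumes t: "t \<ge> 0"
  shows "(LBINT s:{0<..<t}. LBINT y:D. heat_kernel (t - s) x y * f s y) = series t x"
proof -
  let ?h = "\<lambda>k s. exp (- (eigval (Suc k))\<^sup>2 * (t - s)) * L2_inner (f s) (eigfun (Suc k))"
  let ?g = "\<lambda>k s. eigfun (Suc k) x * (indicator {0<..<t} s * ?h k s)"
  have eq: "indicator {0<..<t} s *\<^sub>R (LBINT y:D. heat_kernel (t - s) x y * f s y) = (\<Sum>k. ?g k s)" for s
  proof (cases "s \<in> {0<..<t}")
    case True
    then have "t - s > 0" by simp
    from integral_heat_kernel[OF f_meas f_bound this]
    show ?thesis using True by (simp add: mult_ac)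
  qed simp
  have hint: "integrable lborel (\<lambda>s. indicator {0<..<t} s * ?h k s)" for k
    using coeff_integrable(1)[OF t, of "Suc k"] by (simp add: set_integrable_def)
  have "(LBINT s:{0<..<t}. LBINT y:D. heat_kernel (t - s) x y * f s y) = (\<integral>s. (\<Sum>k. ?g k s) \<partial>lborel)"
    unfolding set_lebesgue_integral_def[of lborel "{0<..<t}"] eq ..
  also have "\<dots> = (\<Sum>k. \<integral>s. ?g k s \<partial>lborel)"
  proof (rule integral_suminf)
    show "integrable lborel (?g k)" for k by (intro integrable_mult_right hint)
    show "AE s in lborel. summable (\<lambda>k. norm (?g k s))"
    proof (rule AE_I2)
      fix s
      show "summable (\<lambda>k. norm (?g k s))"
      proof (cases "s \<in> {0<..<t}")
        case True
        then have ts: "t - s > 0" by simp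
        show ?thesis
        proof (rule summable_comparison_test[OF _ summable_mult2[OF summable_inverse_eigval_square, of "sqrt 2 * B / (t - s)"]], intro exI allI impI)
          fix k
          have "norm (norm (?g k s)) = \<bar>eigfun (Suc k) x\<bar> * (exp (- (eigval (Suc k))\<^sup>2 * (t - s)) * \<bar>L2_inner (f s) (eigfun (Suc k))\<bar>)"
            using True by (simp add: abs_mult)
          also have "\<dots> \<le> sqrt 2 * (1 / ((eigval (Suc k))\<^sup>2 * (t - s)) * B)"
            using ts by (intro mult_mono eigfun_bound exp_eigval_le inner_bound) auto
          finally show "norm (norm (?g k s)) \<le> 1 / (eigval (Suc k))\<^sup>2 * (sqrt 2 * B / (t - s))" by (simp add: mult_ac)
        qed
      qed simp
    qed
    show "summable (\<lambda>k. \<integral>s. norm (?g k s) \<partial>lborel)"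
    proof (rule summable_comparison_test[OF _ summable_coeff_bound], intro exI allI impI)
      fix k
      have "(\<integral>s. norm (?g k s) \<partial>lborel) = \<bar>eigfun (Suc k) x\<bar> * (LBINT s:{0<..<t}. \<bar>?h k s\<bar>)"
        by (simp add: abs_mult set_lebesgue_integral_def mult_ac)
      also have "\<dots> \<le> sqrt 2 * (B / (eigval (Suc k))\<^sup>2)"
        using coeff_integrable(3)[OF t, of "Suc k"]
        by (intro mult_mono eigfun_bound) (auto simp: set_lebesgue_integral_def intro!: integral_nonneg_AE)
      finally show "norm (\<integral>s. norm (?g k s) \<partial>lborel) \<le> 1 / (eigval (Suc k))\<^sup>2 * (B * sqrt 2)"
        by (simp add: mult_ac)
    qed
  qed
  also have "\<dots> = series t x"
    by (simp add: series_def fourier_coeff_def set_lebesgue_integral_def mult_ac)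
  finally show ?thesis .
qed

lemma series_boundary: "series t 0 = 0" "series t 1 = 0"
  by (simp_all add: series_def)

text \<open>The series converges uniformly by the Weierstrass test. Together with the zero boundary values this
makes the completeness of the sines applicable to the error.\<close>

lemma continuous_series:
  assumes t: "t \<ge> 0" shows "continuous_on {0..1} (series t)"
proof -
  have "uniform_limit {0..1} (\<lambda>n x. \<Sum>k<n. fourier_coeff f t (Suc k) * eigfun (Suc k) x) (series t) sequentially"
    unfolding series_def[abs_def]
    by (rule Weierstrass_m_test[OF _ summable_coeff_bound]) (use coeff_term_bound[OF t] in auto)
  then show ?thesis
    by (rule uniform_limit_theorem[rotated]) (auto intro!: always_eventually continuous_intros)
qed

lemma series_L2: "t \<ge> 0 \<Longrightarrow> series t \<in> L2_space"
  by (intro L2_space_continuous continuous_series)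

lemma series_coefficient:
  assumes t: "t \<ge> 0" and l: "l \<ge> 1"
  shows "L2_inner (series t) (eigfun l) = fourier_coeff f t l"
proof -
  obtain i where i: "l = Suc i" using l by (cases l) auto
  let ?g = "\<lambda>k x. fourier_coeff f t (Suc k) * (eigfun (Suc k) x * eigfun l x)"
  let ?b = "\<lambda>k. 1 / (eigval (Suc k))\<^sup>2 * (B * sqrt 2) * sqrt 2"
  have sb: "summable ?b" by (intro summable_mult2 summable_coeff_bound)
  have bound: "norm (?g k x) \<le> ?b k" for k x
  proof -
    have "\<bar>fourier_coeff f t (Suc k) * eigfun (Suc k) x\<bar> * \<bar>eigfun l x\<bar> \<le> ?b k"
      using coeff_term_bound[OF t] B_nonneg by (intro mult_mono eigfun_bound) auto
    then show ?thesis by (simp add: abs_mult)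
  qed
  have int: "integrable \<mu> (?g k)" for k
    using eigfun_L2 by (intro integrable_mult_right square_integrable_times) (simp_all add: L2_space_iff)
  have "series t x * eigfun l x = (\<Sum>k. ?g k x)" for x
  proof -
    have "summable (\<lambda>k. fourier_coeff f t (Suc k) * eigfun (Suc k) x)"
      by (rule summable_comparison_test[OF _ summable_coeff_bound]) (use coeff_term_bound[OF t] in auto)
    then show ?thesis unfolding series_def by (subst suminf_mult2) (simp_all add: mult_ac)
  qed
  then have "L2_inner (series t) (eigfun l) = (\<integral>x. (\<Sum>k. ?g k x) \<partial>\<mu>)" by (simp add: L2_inner_eq)
  also have "\<dots> = (\<Sum>k. \<integral>x. ?g k x \<partial>\<mu>)"
  proof (rule integral_suminf[OF int])
    show "AE x in \<mu>. summable (\<lambda>k. norm (?g k x))"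
      by (intro AE_I2 summable_comparison_test[OF _ sb]) (use bound in auto)
    show "summable (\<lambda>k. \<integral>x. norm (?g k x) \<partial>\<mu>)"
    proof (rule summable_comparison_test[OF _ sb], intro exI allI impI)
      fix k
      have "(\<integral>x. norm (?g k x) \<partial>\<mu>) \<le> ?b k"
        by (intro unit.integral_le_const integrable_norm int AE_I2 bound)
      then show "norm (\<integral>x. norm (?g k x) \<partial>\<mu>) \<le> ?b k" by simp
    qed
  qed
  also have "\<dots> = (\<Sum>k. if k = i then fourier_coeff f t l else 0)"
  proof (rule arg_cong[where f=suminf], rule ext)
    fix k
    have "(\<integral>x. ?g k x \<partial>\<mu>) = fourier_coeff f t (Suc k) * L2_inner (eigfun (Suc k)) (eigfun l)"
      unfolding L2_inner_eq by (rule integral_mult_right_zero)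
    then show "(\<integral>x. ?g k x \<partial>\<mu>) = (if k = i then fourier_coeff f t l else 0)"
      using eigfun_normalized[of l] eigfun_orthogonal[of "Suc k" l] l i by auto
  qed
  also have "\<dots> = fourier_coeff f t l" by (subst suminf_finite[of "{i}"]) auto
  finally show ?thesis .
qed

end

section \<open>The error estimate\<close>

subsection \<open>Summing over the modes\<close>

text \<open>Comparison with the telescoping sum of \<open>1 / (k * (k + 1))\<close>.\<close>

lemma sum_inverse_squares_tail:
  assumes "K \<ge> 1" shows "(\<Sum>k=K..<n. 1 / (real (Suc k))\<^sup>2) \<le> 1 / real K"
proof (cases "K \<le> n")
  case True
  then have "(\<Sum>k=K..<n. 1 / (real (Suc k))\<^sup>2) \<le> 1 / real K - 1 / real n"
  proof (induction n rule: dec_induct)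
    case (step n)
    then have n: "real n \<ge> 1" using assms by linarith
    have "1 / (real (Suc n))\<^sup>2 \<le> 1 / (real n * real (Suc n))"
      using n unfolding power2_eq_square by (intro divide_left_mono mult_right_mono mult_pos_pos) auto
    also have "\<dots> = 1 / real n - 1 / real (Suc n)" using n by (simp add: field_simps)
    finally show ?case using step by simp
  qed simp
  then show ?thesis by (smt (verit) divide_nonneg_nonneg of_nat_0_le_iff)
qed simp

text \<open>Split the sum at \<open>K = \<lceil>1 / d\<rceil>\<close>.\<close>

lemma sum_min_inverse_square_le:
  assumes d: "d > 0" shows "(\<Sum>k<n. min (1 / (real (Suc k))\<^sup>2) (d\<^sup>2)) \<le> 3 * d"
proof -
  define K where "K = nat \<lceil>1 / d\<rceil>"
  let ?a = "\<lambda>k. min (1 / (real (Suc k))\<^sup>2) (d\<^sup>2)"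
  have "0 < \<lceil>1 / d\<rceil>" using d by simp
  then have K1: "K \<ge> 1" and Keq: "real K = real_of_int \<lceil>1 / d\<rceil>" unfolding K_def by linarith+
  have Kge: "1 / d \<le> real K" and Kle: "real K \<le> 1 / d + 1"
    unfolding Keq by linarith+
  have a0: "0 \<le> ?a k" for k by simp
  have "(\<Sum>k<n. ?a k) \<le> (\<Sum>k\<in>{..<K} \<union> {K..<n}. ?a k)" by (intro sum_mono2) auto
  also have "\<dots> = (\<Sum>k<K. ?a k) + (\<Sum>k=K..<n. ?a k)" by (intro sum.union_disjoint) auto
  also have "(\<Sum>k=K..<n. ?a k) \<le> (\<Sum>k=K..<n. 1 / (real (Suc k))\<^sup>2)" by (intro sum_mono) simp
  also have "(\<Sum>k=K..<n. 1 / (real (Suc k))\<^sup>2) \<le> 1 / real K" by (rule sum_inverse_squares_tail[OF K1])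
  also have "1 / real K \<le> d" using Kge K1 d by (simp add: field_simps)
  also have "(\<Sum>k<K. ?a k) \<le> 2 * d"
  proof (cases "d \<ge> 1")
    case True
    then have "1 / d \<le> 1" by simp
    then have "K = 1" using Kle K1 unfolding K_def by (simp add: ceiling_le_iff le_antisym nat_le_iff)
    then show ?thesis using True by simp
  next
    case False
    have "(\<Sum>k<K. ?a k) \<le> (\<Sum>k<K. d\<^sup>2)" by (intro sum_mono) simp
    also have "\<dots> = real K * d\<^sup>2" by simp
    also have "\<dots> \<le> (1 / d + 1) * d\<^sup>2" by (intro mult_right_mono Kle) simp
    also have "\<dots> = d + d * d" using d by (simp add: field_simps power2_eq_square)
    also have "\<dots> \<le> d + d * 1" using d False by (intro add_left_mono mult_left_mono) auto
    finally show ?thesis by simp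
  qed
  finally show ?thesis by simp
qed

lemma suminf_min_inverse_square_le:
  assumes "d > 0" shows "(\<Sum>k. ennreal (min (1 / (real (Suc k))\<^sup>2) (d\<^sup>2))) \<le> ennreal (3 * d)"
proof (rule suminf_le_const)
  fix n
  have "(\<Sum>k<n. ennreal (min (1 / (real (Suc k))\<^sup>2) (d\<^sup>2))) = ennreal (\<Sum>k<n. min (1 / (real (Suc k))\<^sup>2) (d\<^sup>2))"
    by (intro sum_ennreal) simp
  also have "\<dots> \<le> ennreal (3 * d)" by (intro ennreal_leI sum_min_inverse_square_le assms)
  finally show "(\<Sum>k<n. ennreal (min (1 / (real (Suc k))\<^sup>2) (d\<^sup>2))) \<le> ennreal (3 * d)" .
qed simp

subsection \<open>Step functions on the grid\<close>

text \<open>The functions of time and space that are constant on the products \<open>A n \<times> B j\<close>; the regularized noise is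
one of them for each realization.\<close>

definition grid_function :: "nat \<Rightarrow> nat \<Rightarrow> (nat \<Rightarrow> real set) \<Rightarrow> (nat \<Rightarrow> real set) \<Rightarrow> (nat \<Rightarrow> nat \<Rightarrow> real) \<Rightarrow> real \<Rightarrow> real \<Rightarrow> real" where
  "grid_function N J A B c s y = (\<Sum>n=1..N. \<Sum>j=1..J. c n j * (indicator (A n) s * indicator (B j) y))"

lemma L2_inner_grid_function:
  assumes B: "\<And>j. B j \<in> sets borel" and v: "v \<in> L2_space"
  shows "L2_inner (grid_function N J A B c s) v
    = (\<Sum>n=1..N. \<Sum>j=1..J. c n j * (indicator (A n) s * L2_inner (indicator (B j)) v))"
proof -
  have iL2: "indicator (B j) \<in> L2_space" for j
  proof (rule L2_space_bounded[where B=1])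
    show "indicator (B j) \<in> borel_measurable \<mu>" by (intro borel_measurable_unit borel_measurable_indicator B)
  qed auto
  have int: "integrable \<mu> (\<lambda>y. indicator (B j) y * v y)" for j
    using iL2[of j] v unfolding L2_space_iff by (rule square_integrable_times)
  have "L2_inner (grid_function N J A B c s) v
      = (\<integral>y. (\<Sum>n=1..N. \<Sum>j=1..J. (c n j * indicator (A n) s) * (indicator (B j) y * v y)) \<partial>\<mu>)"
    unfolding L2_inner_eq grid_function_def by (simp only: sum_distrib_right mult.assoc)
  also have "\<dots> = (\<Sum>n=1..N. \<Sum>j=1..J. (c n j * indicator (A n) s) * (\<integral>y. indicator (B j) y * v y \<partial>\<mu>))"
    by (simp only: Bochner_Integration.integral_sum Bochner_Integration.integrable_sum integrable_mult_right int
        integral_mult_right_zero)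
  finally show ?thesis by (simp only: L2_inner_eq mult.assoc)
qed

lemma bounded_source_grid_function:
  assumes A: "\<And>n. A n \<in> sets borel" and B: "\<And>j. B j \<in> sets borel"
  shows "bounded_source (grid_function N J A B c) (\<Sum>n=1..N. \<Sum>j=1..J. \<bar>c n j\<bar>)"
proof
  fix s
  have "grid_function N J A B c s \<in> borel_measurable borel"
    unfolding grid_function_def[abs_def] using B by measurable
  then show "grid_function N J A B c s \<in> borel_measurable \<mu>" by (rule borel_measurable_unit)
next
  fix s y
  have "\<bar>grid_function N J A B c s y\<bar> \<le> (\<Sum>n=1..N. \<bar>\<Sum>j=1..J. c n j * (indicator (A n) s * indicator (B j) y)\<bar>)"
    unfolding grid_function_def by (rule sum_abs)
  also have "\<dots> \<le> (\<Sum>n=1..N. \<Sum>j=1..J. \<bar>c n j * (indicator (A n) s * indicator (B j) y)\<bar>)"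
    by (intro sum_mono sum_abs)
  also have "\<dots> \<le> (\<Sum>n=1..N. \<Sum>j=1..J. \<bar>c n j\<bar>)"
    by (intro sum_mono) (auto simp: indicator_def)
  finally show "\<bar>grid_function N J A B c s y\<bar> \<le> (\<Sum>n=1..N. \<Sum>j=1..J. \<bar>c n j\<bar>)" .
next
  fix v assume v: "v \<in> L2_space"
  show "(\<lambda>s. L2_inner (grid_function N J A B c s) v) \<in> borel_measurable borel"
    unfolding L2_inner_grid_function[OF B v] using A by measurable
qed

lemma regularized_noise_eq_grid_function:
  "regularized_noise T W N J \<omega> = grid_function N J (grid_interval (T / N)) (grid_interval (1 / J))
      (\<lambda>n j. W (cell T N J n j) \<omega> / (T / N * (1 / J)))"
proof (intro ext)
  fix s y
  have "indicator (cell T N J n j) (s, y) = (indicator (grid_interval (T / N) n) s * indicator (grid_interval (1 / J) j) y :: real)" for n j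
    unfolding cell_eq by (auto simp: indicator_def)
  then show "regularized_noise T W N J \<omega> s y = grid_function N J (grid_interval (T / N)) (grid_interval (1 / J))
      (\<lambda>n j. W (cell T N J n j) \<omega> / (T / N * (1 / J))) s y"
    by (simp only: regularized_noise_def grid_function_def sum_distrib_left times_divide_eq_left mult_1 divide_inverse mult_ac)
qed

context dual_scheme
begin

definition cell_functional :: "(nat \<Rightarrow> real set) \<Rightarrow> (nat \<Rightarrow> real set) \<Rightarrow> nat \<Rightarrow> nat \<Rightarrow> nat \<Rightarrow> real" where
  "cell_functional A B m k j = (\<Sum>i<m. LBINT s:slot m i. indicator (A k) s * weight (B j) m i s)"

text \<open>The left-hand side is the sine coefficient of the error, by duality for the scheme and by Duhamel's
formula for the solution.\<close>

lemma coefficient_error: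
  assumes A: "\<And>n. A n \<in> sets borel" and B: "\<And>j. B j \<in> sets borel"
  shows "(\<Sum>i<m. LBINT s:slot m i. L2_inner (grid_function N J A B c s) (dual_step i))
      - fourier_coeff (grid_function N J A B c) (real m * \<tau>) n
    = (\<Sum>k=1..N. \<Sum>j=1..J. c k j * cell_functional A B m k j)"
proof -
  let ?f = "grid_function N J A B c"
  interpret bounded_source ?f "\<Sum>n=1..N. \<Sum>j=1..J. \<bar>c n j\<bar>"
    by (rule bounded_source_grid_function[OF A B])
  have mt: "0 \<le> real m * \<tau>" using tau by simp
  let ?h = "\<lambda>s. rho (real m * \<tau> - s) * L2_inner (?f s) ef"
  have h: "set_integrable lborel {0<..<real m * \<tau>} ?h"
    using coeff_integrable(1)[OF mt n] by (simp add: rho_def)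
  have coeff: "fourier_coeff ?f (real m * \<tau>) n = (\<Sum>i<m. LBINT s:slot m i. ?h s)"
    unfolding slots_cover[OF h, symmetric] by (simp add: fourier_coeff_def rho_def)
  have slot_sub: "slot m i \<subseteq> {0<..<real m * \<tau>}" if "i < m" for i
  proof -
    have "0 \<le> real (m - i - 1) * \<tau>" "real (m - i) * \<tau> \<le> real m * \<tau>" using tau by auto
    then show ?thesis by (auto simp: slot_def)
  qed
  have slot_term: "(LBINT s:slot m i. L2_inner (?f s) (dual_step i)) - (LBINT s:slot m i. ?h s)
      = (\<Sum>k=1..N. \<Sum>j=1..J. c k j * (LBINT s:slot m i. indicator (A k) s * weight (B j) m i s))"
    if i: "i < m" for i
  proof -
    have w: "integrable lborel (\<lambda>s. indicator (slot m i) s * (indicator (A k) s * weight (B j) m i s))" for k j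
      using set_integrable_indicator_continuous[OF continuous_weight[OF B] A]
      by (simp add: slot_def set_integrable_def)
    have d: "integrable lborel (\<lambda>s. indicator (slot m i) s * (indicator (A k) s * a))" for k and a :: real
      using set_integrable_indicator_continuous[of "\<lambda>_. a" "A k"] A
      by (simp add: slot_def set_integrable_def)
    have int1: "set_integrable lborel (slot m i) (\<lambda>s. L2_inner (?f s) (dual_step i))"
    proof -
      have "(\<lambda>s. indicator (slot m i) s *\<^sub>R L2_inner (?f s) (dual_step i))
          = (\<lambda>s. \<Sum>k=1..N. \<Sum>j=1..J. c k j * (indicator (slot m i) s * (indicator (A k) s * L2_inner (indicator (B j)) (dual_step i))))"
        unfolding L2_inner_grid_function[OF B H01_space_L2[OF dual_step_H01]] real_scaleR_def sum_distrib_left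
        by (simp only: mult.left_commute)
      then show ?thesis unfolding set_integrable_def
        by (simp only:) (intro Bochner_Integration.integrable_sum integrable_mult_right d)
    qed
    have int2: "set_integrable lborel (slot m i) ?h"
      by (rule set_integrable_subset[OF h _ slot_sub[OF i]]) simp
    have "(LBINT s:slot m i. L2_inner (?f s) (dual_step i)) - (LBINT s:slot m i. ?h s)
        = (LBINT s:slot m i. L2_inner (?f s) (dual_step i) - ?h s)"
      using int1 int2 by (rule set_integral_diff(2)[symmetric])
    also have "\<dots> = (\<integral>s. (\<Sum>k=1..N. \<Sum>j=1..J. c k j * (indicator (slot m i) s * (indicator (A k) s * weight (B j) m i s))) \<partial>lborel)"
      unfolding set_lebesgue_integral_def
    proof (intro Bochner_Integration.integral_cong refl)
      fix s
      have "L2_inner (?f s) (dual_step i) - ?h s = L2_inner (?f s) (defect i (real m * \<tau> - s))"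
        by (simp add: L2_inner_defect f_L2)
      also have "\<dots> = (\<Sum>k=1..N. \<Sum>j=1..J. c k j * (indicator (A k) s * weight (B j) m i s))"
        unfolding L2_inner_grid_function[OF B defect_L2] weight_def ..
      finally have eq: "L2_inner (?f s) (dual_step i) - ?h s
          = (\<Sum>k=1..N. \<Sum>j=1..J. c k j * (indicator (A k) s * weight (B j) m i s))" .
      show "indicator (slot m i) s *\<^sub>R (L2_inner (?f s) (dual_step i) - ?h s)
          = (\<Sum>k=1..N. \<Sum>j=1..J. c k j * (indicator (slot m i) s * (indicator (A k) s * weight (B j) m i s)))"
        unfolding eq real_scaleR_def sum_distrib_left by (simp only: mult.left_commute)
    qed
    also have "\<dots> = (\<Sum>k=1..N. \<Sum>j=1..J. c k j * (\<integral>s. indicator (slot m i) s * (indicator (A k) s * weight (B j) m i s) \<partial>lborel))"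
      by (simp only: Bochner_Integration.integral_sum Bochner_Integration.integrable_sum integrable_mult_right w
          integral_mult_right_zero)
    finally show ?thesis by (simp only: set_lebesgue_integral_def real_scaleR_def)
  qed
  have "(\<Sum>i<m. LBINT s:slot m i. L2_inner (?f s) (dual_step i)) - fourier_coeff ?f (real m * \<tau>) n
      = (\<Sum>i<m. \<Sum>k=1..N. \<Sum>j=1..J. c k j * (LBINT s:slot m i. indicator (A k) s * weight (B j) m i s))"
    unfolding coeff sum_subtractf[symmetric] by (intro sum.cong refl slot_term) simp
  also have "\<dots> = (\<Sum>k=1..N. \<Sum>i<m. \<Sum>j=1..J. c k j * (LBINT s:slot m i. indicator (A k) s * weight (B j) m i s))"
    by (rule sum.swap)
  also have "\<dots> = (\<Sum>k=1..N. \<Sum>j=1..J. \<Sum>i<m. c k j * (LBINT s:slot m i. indicator (A k) s * weight (B j) m i s))"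
    by (intro sum.cong refl sum.swap)
  finally show ?thesis by (simp only: cell_functional_def sum_distrib_left)
qed

lemma sum_cell_functional_square_le:
  assumes T: "T > 0" and N: "N \<ge> 1" and J: "J \<ge> 1"
  shows "(\<Sum>k=1..N. \<Sum>j=1..J. (cell_functional (grid_interval (T / N)) (grid_interval (1 / J)) m k j)\<^sup>2)
    \<le> T / N * (1 / J) * defect_total m"
  unfolding cell_functional_def
proof (rule sum_cell_functionals_le)
  have t: "T / N > 0" "1 / real J > 0" using assms by auto
  show "grid_interval (T / N) k \<inter> grid_interval (T / N) k' = {}" if "k \<noteq> k'" for k k'
    using that by (rule grid_interval_disjoint[OF t(1)])
  show "grid_interval (1 / J) k \<inter> grid_interval (1 / J) k' = {}" if "k \<noteq> k'" for k k'
    using that by (rule grid_interval_disjoint[OF t(2)])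
  show "grid_interval (1 / J) j \<subseteq> D" if "j \<in> {1..J}" for j
    using grid_interval_subset[of "1 / J" j J] that t J by simp
qed (use assms in \<open>auto simp: emeasure_grid_interval\<close>)

text \<open>The stability bound is split over the two terms of the error bound. In the term with \<open>\<tau>\<close>, the minimum
of \<open>1 / lam\<close> and \<open>4 lam \<tau>\<^sup>2\<close> is at most their geometric mean \<open>2 \<tau>\<close>, which turns it into the form to
which the summation lemma applies.\<close>

lemma defect_total_le_min:
  assumes ap: "approximation_property C h Z" and C: "C > 0"
  shows "defect_total m \<le> 2 * min (1 / (real n)\<^sup>2) ((4 * C * h)\<^sup>2) + 2 * min (1 / (real n)\<^sup>2) ((sqrt (2 * \<tau>))\<^sup>2)"
proof -
  have n2: "(real n)\<^sup>2 \<le> lam"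
  proof -
    have "real n * 1 \<le> real n * pi" using pi_gt3 by (intro mult_left_mono) auto
    then show ?thesis unfolding eigval_def by (intro power_mono) auto
  qed
  have n0: "(real n)\<^sup>2 > 0" using n by simp
  have a: "1 / lam \<le> 1 / (real n)\<^sup>2" by (intro divide_left_mono n2 mult_pos_pos lam_pos n0) simp
  have Q1: "defect_total m \<le> 2 / lam" by (rule defect_total_le_stability)
  have "lam * (L2_norm ritz_error)\<^sup>2 \<le> (2 * C * h)\<^sup>2"
    using Aubin_Nitsche[OF ap C] lam_pos by (simp add: L2_norm_square field_simps)
  moreover have "(4 * C * h)\<^sup>2 = 4 * (2 * C * h)\<^sup>2" by (simp add: power2_eq_square)
  moreover have "defect_total m \<le> 8 * (lam * (L2_norm ritz_error)\<^sup>2) + 8 * (lam * \<tau>\<^sup>2)"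
    using defect_total_le_error[of m] by (simp add: algebra_simps)
  ultimately have Q2: "defect_total m \<le> 2 * (4 * C * h)\<^sup>2 + 8 * (lam * \<tau>\<^sup>2)" by linarith
  have s: "(sqrt (2 * \<tau>))\<^sup>2 = 2 * \<tau>" using tau by simp
  have gm: "min (1 / lam) (4 * (lam * \<tau>\<^sup>2)) \<le> 2 * \<tau>"
  proof (rule ccontr)
    assume "\<not> ?thesis"
    then have small: "2 * \<tau> < 1 / lam" and large: "2 * \<tau> < 4 * (lam * \<tau>\<^sup>2)"
      by (simp_all only: min_le_iff_disj de_Morgan_disj not_le)
    have "4 * (lam * \<tau>\<^sup>2) = 2 * \<tau> * (2 * \<tau> * lam)" by (simp add: power2_eq_square)
    with large have "2 * \<tau> * 1 < 2 * \<tau> * (2 * \<tau> * lam)" by linarith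
    then have "1 < 2 * \<tau> * lam" using tau by (simp add: mult_less_cancel_left_pos)
    moreover have "2 * \<tau> * lam < 1" using small lam_pos by (simp add: less_divide_eq)
    ultimately show False by simp
  qed
  have "defect_total m \<le> 2 * min (1 / lam) ((4 * C * h)\<^sup>2) + 2 * min (1 / lam) (4 * (lam * \<tau>\<^sup>2))"
  proof -
    have "Q \<le> 2 * min x y + 2 * min x z" if "Q \<le> 2 * x" "Q \<le> 2 * y + 2 * z" "0 \<le> x" "0 \<le> y" "0 \<le> z"
      for Q x y z :: real
      using that by (simp add: min_def)
    then show ?thesis using Q1 Q2 lam_pos by simp
  qed
  moreover have "min (1 / lam) ((4 * C * h)\<^sup>2) \<le> min (1 / (real n)\<^sup>2) ((4 * C * h)\<^sup>2)"
    using a by (intro min.mono) auto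
  moreover have "min (1 / lam) (4 * (lam * \<tau>\<^sup>2)) \<le> min (1 / (real n)\<^sup>2) ((sqrt (2 * \<tau>))\<^sup>2)"
    using a gm unfolding s by (auto simp: min_le_iff_disj)
  ultimately show ?thesis by linarith
qed

end


subsection \<open>Assembling the estimate\<close>

text \<open>Pathwise: completeness of the sines applied to the error, whose coefficients are functionals of the
cell values of the noise.\<close>

lemma Fourier_error_expansion:
  assumes fe: "fe_space r h Z" and T: "T > 0" and N: "N \<ge> 1" and J: "J \<ge> 1" and M: "M \<ge> 1" and m: "m \<le> M"
    and cn: "crank_nicolson T M Z (regularized_noise T W N J \<omega>) U"
    and X: "\<And>k. dual_scheme r h Z (T / M) (Suc k) (X k)"
  shows "ennreal ((L2_norm (\<lambda>x. U m x - regularized_solution T W N J \<omega> (real m * (T / M)) x))\<^sup>2)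
    \<le> (\<Sum>k. ennreal ((\<Sum>i=1..N. \<Sum>j=1..J. W (cell T N J i j) \<omega> / (T / N * (1 / J)) *
        dual_scheme.cell_functional (T / M) (Suc k) (X k) (grid_interval (T / N)) (grid_interval (1 / J)) m i j)\<^sup>2))"
proof -
  let ?\<tau> = "T / real M" and ?t = "real m * (T / real M)"
  let ?A = "grid_interval (T / real N)" and ?B = "grid_interval (1 / real J)"
  let ?c = "\<lambda>n j. W (cell T N J n j) \<omega> / (T / real N * (1 / real J))"
  let ?f = "grid_function N J ?A ?B ?c"
  have f: "regularized_noise T W N J \<omega> = ?f" by (rule regularized_noise_eq_grid_function)
  interpret bounded_source ?f "\<Sum>n=1..N. \<Sum>j=1..J. \<bar>?c n j\<bar>"
    by (rule bounded_source_grid_function) simp_all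
  have t: "0 \<le> ?t" using T M by simp
  have sol: "regularized_solution T W N J \<omega> ?t = series ?t"
    unfolding regularized_solution_def f by (rule ext) (rule solution_eq_series[OF t])
  have UZ: "U m \<in> Z" using cn m by (auto simp: crank_nicolson_def)
  have UH: "U m \<in> H01_space" by (rule fe_space_H01[OF fe UZ])
  have UL: "U m \<in> L2_space" by (rule H01_space_L2[OF UH])
  let ?e = "\<lambda>x. U m x - series ?t x"
  have eL: "?e \<in> L2_space" by (intro L2_space_diff UL series_L2 t)
  obtain F where F: "continuous_on {0..1} F" "AE x in \<mu>. U m x = F x" "F 0 = 0" "F 1 = 0"
    by (rule H01_spaceE[OF UH])
  have ae: "AE x in \<mu>. ?e x = F x - series ?t x" using F(2) by eventually_elim simp
  have "ennreal (L2_inner ?e ?e) \<le> (\<Sum>k. ennreal ((L2_inner ?e (eigfun (Suc k)))\<^sup>2))"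
  proof (rule sine_completeness[OF eL ae])
    show "continuous_on {0..1} (\<lambda>x. F x - series ?t x)" by (intro continuous_on_diff continuous_series t F)
    show "F 0 - series ?t 0 = 0" "F 1 - series ?t 1 = 0" unfolding series_boundary F by simp_all
  qed
  moreover have "L2_inner ?e (eigfun (Suc k)) = (\<Sum>i=1..N. \<Sum>j=1..J. ?c i j *
        dual_scheme.cell_functional (T / M) (Suc k) (X k) ?A ?B m i j)" for k
  proof -
    interpret dual_scheme r h Z ?\<tau> "Suc k" "X k" by (rule X)
    have "L2_inner ?e (eigfun (Suc k)) = L2_inner (U m) (eigfun (Suc k)) - fourier_coeff ?f ?t (Suc k)"
      by (simp only: L2_inner_diff(1)[OF UL series_L2[OF t] eigfun_L2] series_coefficient[OF t n])
    also have "L2_inner (U m) (eigfun (Suc k)) = (\<Sum>i<m. LBINT s:slot m i. L2_inner (?f s) (dual_step i))"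
      by (rule duality[OF cn[unfolded f] refl m])
    also have "\<dots> - fourier_coeff ?f ?t (Suc k) = (\<Sum>i=1..N. \<Sum>j=1..J. ?c i j * cell_functional ?A ?B m i j)"
      by (rule coefficient_error) simp_all
    finally show ?thesis .
  qed
  ultimately show ?thesis unfolding sol L2_norm_square by simp
qed

text \<open>The bound without exponents \<open>\<epsilon>1\<close> and \<open>\<epsilon>2\<close>. The expectation is estimated through the nonnegative
integral, which exchanges with the series over the modes and bounds the expectation of any
nonnegative function.\<close>

lemma (in white_noise) mean_square_error:
  assumes fe: "fe_space r h Z" and ap: "approximation_property C h Z" and C: "C > 0" and T: "T > 0"
    and N: "N \<ge> 1" and J: "J \<ge> 1" and M: "M \<ge> 1" and m: "m \<le> M"
    and cn: "\<And>\<omega>. \<omega> \<in> space P \<Longrightarrow> crank_nicolson T M Z (regularized_noise T W N J \<omega>) (\<lambda>m. U m \<omega>)"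
  shows "expectation (\<lambda>\<omega>. (L2_norm (\<lambda>x. U m \<omega> x - regularized_solution T W N J \<omega> (real m * (T / M)) x))\<^sup>2)
    \<le> 24 * C * h + 6 * sqrt (2 * (T / M))"
proof -
  let ?\<tau> = "T / real M" and ?v = "T / real N * (1 / real J)"
  have tau: "?\<tau> > 0" and v: "?v > 0" using T M N J by auto
  have h: "h > 0" by (rule fe_space_mesh_size(1)[OF fe])
  have "\<forall>k. \<exists>X. dual_scheme r h Z ?\<tau> (Suc k) X"
    using dual_scheme_exists[OF fe tau] by (metis le_add1 plus_1_eq_Suc)
  then obtain X where X: "\<And>k. dual_scheme r h Z ?\<tau> (Suc k) (X k)" by metis
  \<comment> \<open>The coefficient of the noise on cell \<open>(i, j)\<close> in the \<open>k\<close>-th sine coefficient of the error.\<close>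
  define a where "a k = (\<lambda>(i, j). dual_scheme.cell_functional ?\<tau> (Suc k) (X k)
      (grid_interval (T / N)) (grid_interval (1 / J)) m i j / ?v)" for k
  define I where "I = {1..N} \<times> {1..J}"
  define S where "S = (\<lambda>(i, j). cell T N J i j)"
  let ?g = "\<lambda>k \<omega>. (\<Sum>p\<in>I. a k p * W (S p) \<omega>)\<^sup>2"
  have S: "S p \<in> sets borel" "S p \<subseteq> {0..T} \<times> D" "measure lborel (S p) = ?v" if pI: "p \<in> I" for p
  proof -
    obtain i j where p: "p = (i, j)" "i \<in> {1..N}" "j \<in> {1..J}" using pI unfolding I_def by blast
    show "S p \<in> sets borel" "S p \<subseteq> {0..T} \<times> D" "measure lborel (S p) = ?v"
      unfolding S_def p(1) prod.case using cell_properties(1,2)[OF T N J] cell_properties(3)[OF T N J p(2,3)] by blast+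
  qed
  have disj: "S p \<inter> S q = {}" if "p \<noteq> q" for p q
    using that cell_properties(4)[OF T N J] unfolding S_def by (cases p; cases q) simp
  have fin: "finite I" by (simp add: I_def)
  note mom = second_moment_disjoint[OF fin v S disj]
  let ?q = "\<lambda>k d. min (1 / (real (Suc k))\<^sup>2) (d\<^sup>2)"
  have second: "(\<integral>\<^sup>+\<omega>. ennreal (?g k \<omega>) \<partial>P) \<le> 2 * ennreal (?q k (4 * C * h)) + 2 * ennreal (?q k (sqrt (2 * ?\<tau>)))" for k
  proof -
    interpret ds: dual_scheme r h Z ?\<tau> "Suc k" "X k" by (rule X)
    have "(\<integral>\<^sup>+\<omega>. ennreal (?g k \<omega>) \<partial>P) = ennreal (expectation (?g k))"
      by (rule nn_integral_eq_integral[OF mom(1)]) simp_all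
    also have "expectation (?g k) = ?v * (\<Sum>p\<in>I. (a k p)\<^sup>2)" by (rule mom(2)) simp_all
    also have "\<dots> = 1 / ?v * (\<Sum>i=1..N. \<Sum>j=1..J. (ds.cell_functional (grid_interval (T / N)) (grid_interval (1 / J)) m i j)\<^sup>2)"
    proof -
      have sq: "?v * (y / ?v)\<^sup>2 = 1 / ?v * y\<^sup>2" for y
        using v by (simp only: power_divide) (simp only: power2_eq_square times_divide_eq_left times_divide_eq_right mult_1 nonzero_divide_mult_cancel_left, simp)
      show ?thesis
        unfolding I_def a_def sum.cartesian_product' sum_distrib_left prod.case sq ..
    qed
    also have "\<dots> \<le> 1 / ?v * (?v * ds.defect_total m)"
      by (intro mult_left_mono ds.sum_cell_functional_square_le[OF T N J] divide_nonneg_pos v) simp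
    also have "\<dots> = ds.defect_total m"
    proof -
      have "1 / x * (x * y) = y" if "x > 0" for x y :: real using that by simp
      then show ?thesis using v by blast
    qed
    also have "\<dots> \<le> 2 * ?q k (4 * C * h) + 2 * ?q k (sqrt (2 * ?\<tau>))" by (rule ds.defect_total_le_min[OF ap C])
    finally have "(\<integral>\<^sup>+\<omega>. ennreal (?g k \<omega>) \<partial>P) \<le> ennreal (2 * ?q k (4 * C * h) + 2 * ?q k (sqrt (2 * ?\<tau>)))"
      using ennreal_leI by auto
    also have "\<dots> = 2 * ennreal (?q k (4 * C * h)) + 2 * ennreal (?q k (sqrt (2 * ?\<tau>)))"
      by (subst ennreal_plus) (auto simp: ennreal_mult)
    finally show ?thesis .
  qed
  let ?err = "\<lambda>\<omega>. (L2_norm (\<lambda>x. U m \<omega> x - regularized_solution T W N J \<omega> (real m * (T / M)) x))\<^sup>2"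
  have expand: "ennreal (?err \<omega>) \<le> (\<Sum>k. ennreal (?g k \<omega>))" if "\<omega> \<in> space P" for \<omega>
  proof -
    have "(\<Sum>i=1..N. \<Sum>j=1..J. W (cell T N J i j) \<omega> / ?v *
        dual_scheme.cell_functional ?\<tau> (Suc k) (X k) (grid_interval (T / N)) (grid_interval (1 / J)) m i j)
      = (\<Sum>p\<in>I. a k p * W (S p) \<omega>)" for k
      unfolding I_def S_def a_def sum.cartesian_product' prod.case
      by (intro sum.cong refl) (simp add: mult_ac)
    then show ?thesis
      using Fourier_error_expansion[OF fe T N J M m cn[OF that] X] by simp
  qed
  have "(\<integral>\<^sup>+\<omega>. ennreal (?err \<omega>) \<partial>P) \<le> (\<integral>\<^sup>+\<omega>. (\<Sum>k. ennreal (?g k \<omega>)) \<partial>P)"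
    by (rule nn_integral_mono[OF expand])
  also have "\<dots> = (\<Sum>k. \<integral>\<^sup>+\<omega>. ennreal (?g k \<omega>) \<partial>P)"
  proof (rule nn_integral_suminf)
    fix k
    have "?g k \<in> borel_measurable P" by (rule borel_measurable_integrable[OF mom(1)]) simp_all
    then show "(\<lambda>\<omega>. ennreal (?g k \<omega>)) \<in> borel_measurable P" by simp
  qed
  also have "\<dots> \<le> (\<Sum>k. 2 * ennreal (?q k (4 * C * h)) + 2 * ennreal (?q k (sqrt (2 * ?\<tau>))))"
    by (intro suminf_le second) auto
  also have "\<dots> = 2 * (\<Sum>k. ennreal (?q k (4 * C * h))) + 2 * (\<Sum>k. ennreal (?q k (sqrt (2 * ?\<tau>))))"
    by (subst suminf_add[symmetric]) (auto simp: ennreal_suminf_cmult)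
  also have "\<dots> \<le> 2 * ennreal (3 * (4 * C * h)) + 2 * ennreal (3 * sqrt (2 * ?\<tau>))"
    using C h tau by (intro add_mono mult_left_mono suminf_min_inverse_square_le) auto
  also have "\<dots> = ennreal (24 * C * h + 6 * sqrt (2 * ?\<tau>))"
  proof -
    have "2 * ennreal x = ennreal (2 * x)" for x by (simp add: ennreal_mult')
    moreover have "0 \<le> 2 * (3 * (4 * C * h))" "0 \<le> 2 * (3 * sqrt (2 * ?\<tau>))" using C h tau by simp_all
    ultimately show ?thesis by (simp only: ennreal_plus[symmetric]) (simp add: mult_ac)
  qed
  finally show ?thesis using C h tau by (intro integral_real_bounded) auto
qed

text \<open>From the root of the mean square bound to the form with arbitrary small losses in the exponents. The
factor \<open>max 1 T\<close> accounts for time steps larger than 1.\<close>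

lemma error_bound_with_powers:
  assumes C: "C > 0" and h: "0 < h" "h \<le> 1" and \<tau>: "0 < \<tau>" "\<tau> \<le> T"
    and \<epsilon>1: "\<epsilon>1 \<in> {0<..1/2}" and \<epsilon>2: "\<epsilon>2 \<in> {0<..1/4}"
    and E: "E \<le> 24 * C * h + 6 * sqrt (2 * \<tau>)"
  shows "sqrt E \<le> (sqrt (24 * C) + 3 * max 1 T) *
    (\<epsilon>1 powr (-1/2) * h powr (1/2 - \<epsilon>1) + \<epsilon>2 powr (-1/2) * \<tau> powr (1/4 - \<epsilon>2))"
proof -
  have pow1: "1 \<le> e powr (-1/2)" if "0 < e" "e \<le> 1" for e :: real
  proof -
    have "1 powr (-1/2) \<le> e powr (-1/2)" using that by (intro powr_mono2') auto
    then show ?thesis by simp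
  qed
  have H: "sqrt h \<le> \<epsilon>1 powr (-1/2) * h powr (1/2 - \<epsilon>1)"
  proof -
    have "sqrt h = h powr (1/2)" using h by (simp add: powr_half_sqrt)
    also have "\<dots> \<le> h powr (1/2 - \<epsilon>1)" using h \<epsilon>1 by (intro powr_mono') auto
    also have "\<dots> \<le> \<epsilon>1 powr (-1/2) * h powr (1/2 - \<epsilon>1)"
      using pow1[of \<epsilon>1] \<epsilon>1 mult_right_mono[of 1 "\<epsilon>1 powr (-1/2)" "h powr (1/2 - \<epsilon>1)"] by simp
    finally show ?thesis .
  qed
  have K: "\<tau> powr (1/4) \<le> max 1 T * (\<epsilon>2 powr (-1/2) * \<tau> powr (1/4 - \<epsilon>2))"
  proof -
    have "\<tau> powr \<epsilon>2 \<le> max 1 T powr \<epsilon>2" using \<tau> \<epsilon>2 by (intro powr_mono2) auto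
    also have "\<dots> \<le> max 1 T powr 1" using \<epsilon>2 by (intro powr_mono) auto
    finally have *: "\<tau> powr \<epsilon>2 \<le> max 1 T" by simp
    have "\<tau> powr (1/4) = \<tau> powr \<epsilon>2 * \<tau> powr (1/4 - \<epsilon>2)" using \<tau> by (simp add: powr_add[symmetric])
    also have "\<dots> \<le> max 1 T * (\<epsilon>2 powr (-1/2) * \<tau> powr (1/4 - \<epsilon>2))"
      using * pow1[of \<epsilon>2] \<epsilon>2 mult_right_mono[of 1 "\<epsilon>2 powr (-1/2)" "\<tau> powr (1/4 - \<epsilon>2)"]
      by (intro mult_mono) auto
    finally show ?thesis .
  qed
  have "sqrt E \<le> sqrt (24 * C * h + 6 * sqrt (2 * \<tau>))" using E by simp
  also have "\<dots> \<le> sqrt (24 * C * h) + sqrt (6 * sqrt (2 * \<tau>))"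
    using C h \<tau> by (intro sqrt_add_le_add_sqrt) auto
  also have "sqrt (24 * C * h) = sqrt (24 * C) * sqrt h" by (simp add: real_sqrt_mult)
  also have "sqrt (6 * sqrt (2 * \<tau>)) \<le> 3 * \<tau> powr (1/4)"
  proof (rule real_le_lsqrt)
    have q: "(\<tau> powr (1/4))\<^sup>2 = sqrt \<tau>"
      using \<tau> by (simp add: powr_power powr_half_sqrt)
    have "sqrt 2 \<le> 3/2" by (rule real_le_lsqrt) (auto simp: power2_eq_square)
    then have "6 * (sqrt 2 * sqrt \<tau>) \<le> 9 * sqrt \<tau>" using \<tau> mult_right_mono[of "sqrt 2" "3/2" "sqrt \<tau>"] by simp
    then show "6 * sqrt (2 * \<tau>) \<le> (3 * \<tau> powr (1/4))\<^sup>2"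
      unfolding power_mult_distrib q by (simp add: real_sqrt_mult)
  qed simp
  also have "sqrt (24 * C) * sqrt h \<le> sqrt (24 * C) * (\<epsilon>1 powr (-1/2) * h powr (1/2 - \<epsilon>1))"
    using C by (intro mult_left_mono H) simp
  also have "3 * \<tau> powr (1/4) \<le> 3 * max 1 T * (\<epsilon>2 powr (-1/2) * \<tau> powr (1/4 - \<epsilon>2))"
    using K by simp
  finally have "sqrt E \<le> sqrt (24 * C) * (\<epsilon>1 powr (-1/2) * h powr (1/2 - \<epsilon>1))
      + 3 * max 1 T * (\<epsilon>2 powr (-1/2) * \<tau> powr (1/4 - \<epsilon>2))" by simp
  also have "\<dots> \<le> (sqrt (24 * C) + 3 * max 1 T) * (\<epsilon>1 powr (-1/2) * h powr (1/2 - \<epsilon>1))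
      + (sqrt (24 * C) + 3 * max 1 T) * (\<epsilon>2 powr (-1/2) * \<tau> powr (1/4 - \<epsilon>2))"
    using C by (intro add_mono mult_right_mono) auto
  finally show ?thesis by (simp only: distrib_left)
qed

theorem theorem5p3:
  fixes T C_FE :: real and r :: nat
    and P :: "'w measure" and W :: "(real \<times> real) set \<Rightarrow> 'w \<Rightarrow> real"
    and H :: "real set" and Z :: "real \<Rightarrow> (real \<Rightarrow> real) set"
  assumes "T > 0" and "white_noise P T W"
    and "r \<ge> 1" and "C_FE > 0"
    and "\<And>h. h \<in> H \<Longrightarrow> fe_space r h (Z h)"
    and "\<And>h. h \<in> H \<Longrightarrow> approximation_property C_FE h (Z h)"
  shows "\<exists>C>0. \<forall>(N::nat) (J::nat) (M::nat) (U :: nat \<Rightarrow> 'w \<Rightarrow> real \<Rightarrow> real). \<forall>h\<in>H.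
    N \<ge> 1 \<longrightarrow> J \<ge> 1 \<longrightarrow> M \<ge> 1 \<longrightarrow>
    (\<forall>\<omega>\<in>space P. crank_nicolson T M (Z h) (regularized_noise T W N J \<omega>) (\<lambda>m. U m \<omega>)) \<longrightarrow>
    (\<forall>\<epsilon>1\<in>{0<..1/2}. \<forall>\<epsilon>2\<in>{0<..1/4}.
      (MAX m\<in>{0..M}. sqrt (prob_space.expectation P (\<lambda>\<omega>.
         (L2_norm (\<lambda>x. U m \<omega> x - regularized_solution T W N J \<omega> (real m * (T / M)) x))\<^sup>2)))
      \<le> C * (\<epsilon>1 powr (-1/2) * h powr (1/2 - \<epsilon>1)
            + \<epsilon>2 powr (-1/2) * (T / M) powr (1/4 - \<epsilon>2)))"
proof (intro exI[of _ "sqrt (24 * C_FE) + 3 * max 1 T"] conjI allI ballI impI)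
  show "0 < sqrt (24 * C_FE) + 3 * max 1 T" using assms(4) by (intro add_pos_pos) auto
next
  fix N J M :: nat and U :: "nat \<Rightarrow> 'w \<Rightarrow> real \<Rightarrow> real" and h \<epsilon>1 \<epsilon>2 :: real
  assume h: "h \<in> H" and N: "1 \<le> N" and J: "1 \<le> J" and M: "1 \<le> M"
    and cn: "\<forall>\<omega>\<in>space P. crank_nicolson T M (Z h) (regularized_noise T W N J \<omega>) (\<lambda>m. U m \<omega>)"
    and \<epsilon>1: "\<epsilon>1 \<in> {0<..1/2}" and \<epsilon>2: "\<epsilon>2 \<in> {0<..1/4}"
  note fe = assms(5)[OF h] and ap = assms(6)[OF h]
  have \<tau>: "0 < T / real M" "T / real M \<le> T"
    using assms(1) M by (auto simp: divide_le_eq)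
  have "sqrt (prob_space.expectation P (\<lambda>\<omega>.
         (L2_norm (\<lambda>x. U m \<omega> x - regularized_solution T W N J \<omega> (real m * (T / M)) x))\<^sup>2))
      \<le> (sqrt (24 * C_FE) + 3 * max 1 T) * (\<epsilon>1 powr (-1/2) * h powr (1/2 - \<epsilon>1)
            + \<epsilon>2 powr (-1/2) * (T / M) powr (1/4 - \<epsilon>2))" if m: "m \<in> {0..M}" for m
    by (rule error_bound_with_powers[OF assms(4) fe_space_mesh_size[OF fe] \<tau> \<epsilon>1 \<epsilon>2],
        rule white_noise.mean_square_error[OF assms(2) fe ap assms(4,1) N J M])
      (use m cn in auto)
  then show "(MAX m\<in>{0..M}. sqrt (prob_space.expectation P (\<lambda>\<omega>.
         (L2_norm (\<lambda>x. U m \<omega> x - regularized_solution T W N J \<omega> (real m * (T / M)) x))\<^sup>2)))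
      \<le> (sqrt (24 * C_FE) + 3 * max 1 T) * (\<epsilon>1 powr (-1/2) * h powr (1/2 - \<epsilon>1)
            + \<epsilon>2 powr (-1/2) * (T / M) powr (1/4 - \<epsilon>2))"
    by (intro Max.boundedI) auto
qed

end
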